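(* Suppose the joint kernel $\mathcal Q$ of the Markov-renewal specification described in the context is time homogeneous, the waiting times are strictly positive, and the event process is non-explosive. Let $\widehat Z_t$, $e_t$ and $Y_t=\pi_X(\widehat Z_t)$ be the calendar process, its age and the lower-level observable defined in the context. (i) The calendar process $\widehat Z_t$ is semi-Markov. Under standard measurability and regularity conditions for the semi-Markov kernel, $(\widehat Z_t,e_t)$ has a Markov representation. (ii) If, conditional on the current event state, the residual law of the next jump time and destination is independent of the current age, then the age variable is unnecessary and $\widehat Z_t$ is Markov in that state. For general holding-time laws it need not be. (iii) A further projection $Y_t=\pi_X(\widehat Z_t)$ is not automatically Markov. It is Markov when the projected state is sufficient for the future law; clock state or age can otherwise remain dynamically relevant.
   Context: $(\mathsf Z,\mathcal Z)$ is a measurable space, the sufficient event-state space, and $(\mathsf X,\mathcal X)$ is a measurable space, the lower-level state space. For each event index $n=0,1,2,\ldots$, the event state $Z_n\in\mathsf Z$ contains the event-level variables needed to determine both the next state and its waiting time, including the lower-level state $X_n\in\mathsf X$ and any selection variables (which resolve a choice among admissible transition laws) or clock variables when these affect the event law. The waiting time (holding time) from event $n$ to event $n+1$ is $\tau_{n+1}>0$. Let $\mathcal F_n$ be the $\sigma$-field generated by $(Z_0,\tau_1,Z_1,\ldots,\tau_n,Z_n)$. The joint kernel $\mathcal Q$ for the next sufficient event state and holding time satisfies, for $E\in\mathcal Z$ and Borel $I\subset(0,\infty)$, $$\Pr\left(Z_{n+1}\in E,\ \tau_{n+1}\in I\mid\mathcal F_n\right)=\mathcal Q(Z_n,E\times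 I),$$ which is a Markov-renewal specification. For calendar time $t\ge0$, the event epochs and counting process are $$T_0=0,\qquad T_n=\sum_{j=1}^{n}\tau_j,\qquad N(t)=\max\{n:T_n\le t\}.$$ Non-explosion means $T_n\to\infty$ almost surely. The calendar process on the sufficient event state and its age are $$\widehat Z_t=Z_{N(t)},\qquad e_t=t-T_{N(t)},$$ so $e_t$ is the elapsed time since the most recent event. The map $\pi_X:\mathsf Z\to\mathsf X$ is the lower-level projection, and the lower-level observable is $Y_t=\pi_X(\widehat Z_t)$. *)

theory Defs
  imports "HOL-Probability.Probability"
begin

definition generated :: "'w measure \<Rightarrow> 's measure \<Rightarrow> 'i set \<Rightarrow> ('i \<Rightarrow> 'w \<Rightarrow> 's) \<Rightarrow> 'w measure" where
  "generated M S I X = sigma (space M) {X i -` A \<inter> space M | i A. i \<in> I \<and> A \<in> sets S}"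

definition cprob :: "'w measure \<Rightarrow> 'w measure \<Rightarrow> ('w \<Rightarrow> bool) \<Rightarrow> 'w \<Rightarrow> real" where
  "cprob M F E = real_cond_exp M F (indicator {\<omega> \<in> space M. E \<omega>})"

text \<open>The ordinary Markov property with respect to the process's own history. No homogeneity
  and no regular transition kernels are required, so its negation is as strong as possible.\<close>

definition markov_process :: "'w measure \<Rightarrow> 's measure \<Rightarrow> (real \<Rightarrow> 'w \<Rightarrow> 's) \<Rightarrow> bool" where
  "markov_process M S X \<longleftrightarrow>
     (\<forall>t\<ge>0. X t \<in> measurable M S) \<and>
     (\<forall>s t A. 0 \<le> s \<longrightarrow> s \<le> t \<longrightarrow> A \<in> sets S \<longrightarrow>
        (AE \<omega> in M. cprob M (generated M S {0..s} X) (\<lambda>\<omega>. X t \<omega> \<in> A) \<omega>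
                   = cprob M (generated M S {s} X) (\<lambda>\<omega>. X t \<omega> \<in> A) \<omega>))"

definition transition_semigroup :: "'s measure \<Rightarrow> (real \<Rightarrow> 's \<Rightarrow> 's measure) \<Rightarrow> bool" where
  "transition_semigroup S P \<longleftrightarrow>
     (\<forall>t\<ge>0. P t \<in> measurable S (prob_algebra S)) \<and>
     (\<forall>x\<in>space S. P 0 x = return S x) \<and>
     (\<forall>s\<ge>0. \<forall>t\<ge>0. \<forall>x\<in>space S. P (s + t) x = Giry_Monad.bind (P s x) (P t))"

definition homogeneous_markov_process ::
    "'w measure \<Rightarrow> 's measure \<Rightarrow> (real \<Rightarrow> 'w \<Rightarrow> 's) \<Rightarrow> bool" where
  "homogeneous_markov_process M S X \<longleftrightarrow>
     markov_process M S X \<and>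
     (\<exists>P. transition_semigroup S P \<and>
        (\<forall>s\<ge>0. \<forall>t\<ge>0. \<forall>A\<in>sets S.
           AE \<omega> in M. cprob M (generated M S {0..s} X) (\<lambda>\<omega>. X (s + t) \<omega> \<in> A) \<omega>
                     = measure (P t (X s \<omega>)) A))"

text \<open>Meant for \<open>Y\<close> a function of a Markov process \<open>W\<close>. Only the current value of \<open>W\<close>
  enters, not its past, so the Markov property of \<open>Y\<close> is not built in; and only single future
  times are considered, which is weaker than asking for the law of the whole future path.\<close>

definition sufficient_for_future ::
    "'w measure \<Rightarrow> 's measure \<Rightarrow> (real \<Rightarrow> 'w \<Rightarrow> 's) \<Rightarrow> 'y measure \<Rightarrow> (real \<Rightarrow> 'w \<Rightarrow> 'y) \<Rightarrow> bool" where
  "sufficient_for_future M S W R Y \<longleftrightarrow>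
     (\<forall>s t A. 0 \<le> s \<longrightarrow> s \<le> t \<longrightarrow> A \<in> sets R \<longrightarrow>
        (AE \<omega> in M. cprob M (generated M S {s} W) (\<lambda>\<omega>. Y t \<omega> \<in> A) \<omega>
                   = cprob M (generated M R {s} Y) (\<lambda>\<omega>. Y t \<omega> \<in> A) \<omega>))"

definition dynamically_relevant ::
    "'w measure \<Rightarrow> 'y measure \<Rightarrow> (real \<Rightarrow> 'w \<Rightarrow> 'y) \<Rightarrow> 'v measure \<Rightarrow> (real \<Rightarrow> 'w \<Rightarrow> 'v) \<Rightarrow> bool" where
  "dynamically_relevant M R Y V C \<longleftrightarrow>
     (\<exists>s t A. 0 \<le> s \<and> s \<le> t \<and> A \<in> sets R \<and>
        \<not> (AE \<omega> in M.
              cprob M (generated M (R \<Otimes>\<^sub>M V) {s} (\<lambda>u \<omega>. (Y u \<omega>, C u \<omega>))) (\<lambda>\<omega>. Y t \<omega> \<in> A) \<omega>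
            = cprob M (generated M R {s} Y) (\<lambda>\<omega>. Y t \<omega> \<in> A) \<omega>))"

definition renewal_kernel :: "'z measure \<Rightarrow> ('z \<Rightarrow> ('z \<times> real) measure) \<Rightarrow> bool" where
  "renewal_kernel S Q \<longleftrightarrow>
     Q \<in> measurable S (prob_algebra (S \<Otimes>\<^sub>M borel)) \<and>
     (\<forall>z\<in>space S. AE (z', u) in Q z. 0 < u)"

text \<open>The waiting times are \<open>\<tau> 1, \<tau> 2, \<dots>\<close>; the value \<open>\<tau> 0\<close> is never used.\<close>

definition event_history ::
    "'w measure \<Rightarrow> 'z measure \<Rightarrow> (nat \<Rightarrow> 'w \<Rightarrow> 'z) \<Rightarrow> (nat \<Rightarrow> 'w \<Rightarrow> real) \<Rightarrow> nat \<Rightarrow> 'w measure" where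
  "event_history M S Z \<tau> n =
     sigma (space M) (sets (generated M S {0..n} Z) \<union> sets (generated M borel {1..n} \<tau>))"

definition markov_renewal ::
    "'w measure \<Rightarrow> 'z measure \<Rightarrow> ('z \<Rightarrow> ('z \<times> real) measure) \<Rightarrow>
     (nat \<Rightarrow> 'w \<Rightarrow> 'z) \<Rightarrow> (nat \<Rightarrow> 'w \<Rightarrow> real) \<Rightarrow> bool" where
  "markov_renewal M S Q Z \<tau> \<longleftrightarrow>
     prob_space M \<and> renewal_kernel S Q \<and>
     (\<forall>n. Z n \<in> measurable M S) \<and>
     (\<forall>n. \<tau> (Suc n) \<in> borel_measurable M) \<and>
     (\<forall>n. \<forall>\<omega>\<in>space M. 0 < \<tau> (Suc n) \<omega>) \<and>
     (\<forall>n. \<forall>E\<in>sets S. \<forall>I\<in>sets borel. I \<subseteq> {0<..} \<longrightarrow>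
        (AE \<omega> in M. cprob M (event_history M S Z \<tau> n)
                       (\<lambda>\<omega>. Z (Suc n) \<omega> \<in> E \<and> \<tau> (Suc n) \<omega> \<in> I) \<omega>
                   = measure (Q (Z n \<omega>)) (E \<times> I)))"

definition epoch :: "(nat \<Rightarrow> 'w \<Rightarrow> real) \<Rightarrow> nat \<Rightarrow> 'w \<Rightarrow> real" where
  "epoch \<tau> n \<omega> = (\<Sum>j=1..n. \<tau> j \<omega>)"

text \<open>The set is finite unless the path explodes before \<open>t\<close>; then \<open>Max\<close> is an unspecified constant.\<close>

definition event_count :: "(nat \<Rightarrow> 'w \<Rightarrow> real) \<Rightarrow> real \<Rightarrow> 'w \<Rightarrow> nat" where
  "event_count \<tau> t \<omega> = Max {n. epoch \<tau> n \<omega> \<le> t}"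

definition non_explosive :: "'w measure \<Rightarrow> (nat \<Rightarrow> 'w \<Rightarrow> real) \<Rightarrow> bool" where
  "non_explosive M \<tau> \<longleftrightarrow> (AE \<omega> in M. filterlim (\<lambda>n. epoch \<tau> n \<omega>) at_top sequentially)"

definition calendar :: "(nat \<Rightarrow> 'w \<Rightarrow> 'z) \<Rightarrow> (nat \<Rightarrow> 'w \<Rightarrow> real) \<Rightarrow> real \<Rightarrow> 'w \<Rightarrow> 'z" where
  "calendar Z \<tau> t \<omega> = Z (event_count \<tau> t \<omega>) \<omega>"

definition age :: "(nat \<Rightarrow> 'w \<Rightarrow> real) \<Rightarrow> real \<Rightarrow> 'w \<Rightarrow> real" where
  "age \<tau> t \<omega> = t - epoch \<tau> (event_count \<tau> t \<omega>) \<omega>"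

definition calendar_age ::
    "(nat \<Rightarrow> 'w \<Rightarrow> 'z) \<Rightarrow> (nat \<Rightarrow> 'w \<Rightarrow> real) \<Rightarrow> real \<Rightarrow> 'w \<Rightarrow> 'z \<times> real" where
  "calendar_age Z \<tau> t \<omega> = (calendar Z \<tau> t \<omega>, age \<tau> t \<omega>)"

text \<open>The classical definition through a Markov renewal sequence \<open>(Z\<^sub>n, T\<^sub>n)\<close>: with semi-Markov
  kernel \<open>Q(z, E, u) = Q z (E \<times> (0, u])\<close>,
  \<open>Pr(Z\<^sub>n\<^sub>+\<^sub>1 \<in> E, T\<^sub>n\<^sub>+\<^sub>1 - T\<^sub>n \<le> u | Z\<^sub>0, \<dots>, Z\<^sub>n, T\<^sub>0, \<dots>, T\<^sub>n) = Q(Z\<^sub>n, E, u)\<close>, and the process equals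
  \<open>Z\<^sub>n\<close> on \<open>[T\<^sub>n, T\<^sub>n\<^sub>+\<^sub>1)\<close>.\<close>

definition semi_markov_process ::
    "'w measure \<Rightarrow> 'z measure \<Rightarrow> ('z \<Rightarrow> ('z \<times> real) measure) \<Rightarrow> (real \<Rightarrow> 'w \<Rightarrow> 'z) \<Rightarrow> bool" where
  "semi_markov_process M S Q X \<longleftrightarrow>
     prob_space M \<and> renewal_kernel S Q \<and>
     (\<forall>t\<ge>0. X t \<in> measurable M S) \<and>
     (\<exists>Z T.
        (\<forall>n. Z n \<in> measurable M S) \<and>
        (\<forall>n. T n \<in> borel_measurable M) \<and>
        (\<forall>\<omega>\<in>space M. T 0 \<omega> = 0 \<and> (\<forall>n. T n \<omega> < T (Suc n) \<omega>)) \<and>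
        (AE \<omega> in M. filterlim (\<lambda>n. T n \<omega>) at_top sequentially) \<and>
        (\<forall>n. \<forall>E\<in>sets S. \<forall>u.
           AE \<omega> in M. cprob M
               (sigma (space M) (sets (generated M S {0..n} Z) \<union> sets (generated M borel {0..n} T)))
               (\<lambda>\<omega>. Z (Suc n) \<omega> \<in> E \<and> T (Suc n) \<omega> - T n \<omega> \<le> u) \<omega>
             = measure (Q (Z n \<omega>)) (E \<times> {0<..u})) \<and>
        (\<forall>\<omega>\<in>space M. \<forall>n t. T n \<omega> \<le> t \<and> t < T (Suc n) \<omega> \<longrightarrow> X t \<omega> = Z n \<omega>))"

definition survival :: "'z measure \<Rightarrow> ('z \<Rightarrow> ('z \<times> real) measure) \<Rightarrow> 'z \<Rightarrow> real \<Rightarrow> real" where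
  "survival S Q z a = measure (Q z) (space S \<times> {a<..})"

text \<open>Joint law of destination and remaining holding time, given event state \<open>z\<close> and that the
  holding time exceeds the age \<open>a\<close>. Only meaningful where the survival probability is positive.\<close>

definition residual_law ::
    "'z measure \<Rightarrow> ('z \<Rightarrow> ('z \<times> real) measure) \<Rightarrow> 'z \<Rightarrow> real \<Rightarrow> ('z \<times> real) measure" where
  "residual_law S Q z a =
     distr (uniform_measure (Q z) (space S \<times> {a<..})) (S \<Otimes>\<^sub>M borel) (\<lambda>(z', u). (z', u - a))"

definition age_independent :: "'z measure \<Rightarrow> ('z \<Rightarrow> ('z \<times> real) measure) \<Rightarrow> bool" where
  "age_independent S Q \<longleftrightarrow>
     (\<forall>z\<in>space S. \<forall>a\<ge>0. \<forall>b\<ge>0. 0 < survival S Q z a \<longrightarrow> 0 < survival S Q z b \<longrightarrow>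
        residual_law S Q z a = residual_law S Q z b)"

end

theory Submission imports Defs begin

text \<open>
  Everything rests on the law of (state, age) at time \<open>c\<close> restricted to exactly \<open>k\<close> jumps.
  Intersected with the event that the holding time exceeds the initial age, it is an operator \<open>G\<^sub>k\<close>
  that obeys a recursion on the first jump; dividing by the survival probability gives \<open>V\<^sub>k\<close>, and
  the sum of the \<open>V\<^sub>k\<close> is the transition operator. Splitting at the first jump after \<open>s\<close> gives
  \<open>G\<^sub>n(s + t) = \<Sum>\<^sub>k\<^sub>\<le>\<^sub>n G\<^sub>k(s) V\<^sub>n\<^sub>-\<^sub>k(t)\<close>, hence the semigroup identity, a Cauchy product.
  For the process, the past up to \<open>s\<close> agrees on \<open>{T\<^sub>n \<le> s < T\<^sub>n\<^sub>+\<^sub>1}\<close> with an event of the history at the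
  \<open>n\<close>-th event, so the same first-jump recursion computes the conditional law. If the residual law
  does not depend on the age, neither do these operators on functions of the state. Sufficient
  projections are Markov by the tower property.

  Non-Markov examples follow one pattern: past, present and future events \<open>B\<close>, \<open>E\<close>, \<open>A\<close>, with \<open>E\<close> an
  atom of the present, such that \<open>B \<inter> E\<close> and \<open>E \<inter> A\<close> have positive probability and \<open>B \<inter> E \<inter> A\<close>
  is null.
\<close>

section \<open>Transition operators of the pair (state, age)\<close>

text \<open>The specification gives conditional laws only at random event epochs, while the Markov
  property concerns a fixed time \<open>s\<close> inside a holding interval. The event
  \<open>s < T (Suc n)\<close> is not in the history \<open>F n\<close>, so conditioning on it has
  to be traded for a factor \<open>surv\<close>. This is why the operators are first kept undivided:
  after a jump the age is 0, where the survival probability is 1, so the recursion contains no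
  quotient and one kernel step per jump evaluates it. Values in \<open>ennreal\<close> let sums and
  integrals be exchanged freely.

  The counterexamples have deterministic sequences of states: all randomness lies in independent
  waiting times, and positive probabilities are bounded below by those of boxes. Null and positive
  events avoid computing any conditional probability. One example is memoryless with a hidden
  component, the other shows the whole state but hides the age, which separates the two sources of
  failure.\<close>

lemma suminf_swap_ennreal:
  fixes f :: "nat \<Rightarrow> nat \<Rightarrow> ennreal"
  shows "(\<Sum>i. \<Sum>j. f i j) = (\<Sum>j. \<Sum>i. f i j)"
proof -
  have "(\<Sum>i. \<Sum>j. f i j) = (\<integral>\<^sup>+i. (\<Sum>j. f i j) \<partial>count_space UNIV)"
    by (simp add: nn_integral_count_space_nat)
  also have "\<dots> = (\<Sum>j. \<integral>\<^sup>+i. f i j \<partial>count_space UNIV)"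
    by (rule nn_integral_suminf) simp
  finally show ?thesis by (simp add: nn_integral_count_space_nat)
qed

text \<open>Zero extension makes the triangular sum a full double series; after the exchange, the
  series in \<open>n\<close> for fixed \<open>k\<close> is a shift by \<open>k\<close>.\<close>

lemma suminf_convolution_ennreal:
  fixes f :: "nat \<Rightarrow> nat \<Rightarrow> ennreal"
  shows "(\<Sum>n. \<Sum>k\<le>n. f k (n - k)) = (\<Sum>k. \<Sum>m. f k m)"
proof -
  have "(\<Sum>k\<le>n. f k (n - k)) = (\<Sum>k. if k \<le> n then f k (n - k) else 0)" for n
    by (subst suminf_finite[of "{..n}"]) auto
  moreover have "(\<Sum>n. if k \<le> n then f k (n - k) else 0) = (\<Sum>m. f k m)" for k
    using suminf_offset[of "\<lambda>n. if k \<le> n then f k (n - k) else 0" k] by simp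
  ultimately show ?thesis
    by (simp add: suminf_swap_ennreal[of "\<lambda>n k. if k \<le> n then f k (n - k) else 0"])
qed

section \<open>The kernel and its survival probabilities\<close>

locale semi_markov_kernel =
  fixes S :: "'z measure" and Q :: "'z \<Rightarrow> ('z \<times> real) measure"
  assumes kernel: "renewal_kernel S Q"
begin

abbreviation SA :: "('z \<times> real) measure" where
  "SA \<equiv> S \<Otimes>\<^sub>M borel"

lemma Q_measurable: "Q \<in> measurable S (prob_algebra SA)"
  and Q_pos: "z \<in> space S \<Longrightarrow> AE (z', u) in Q z. 0 < u"
  using kernel by (auto simp: renewal_kernel_def)

lemma Q_subprob [measurable]: "Q \<in> measurable S (subprob_algebra SA)"
  using Q_measurable by (rule measurable_prob_algebraD)

lemma Q_prob: "z \<in> space S \<Longrightarrow> prob_space (Q z)"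
  and Q_sets: "z \<in> space S \<Longrightarrow> sets (Q z) = sets SA"
  using measurable_space[OF Q_measurable] by (auto simp: space_prob_algebra)

lemma Q_space: "z \<in> space S \<Longrightarrow> space (Q z) = space S \<times> UNIV"
  using sets_eq_imp_space_eq[OF Q_sets] by (simp add: space_pair_measure)

definition surv :: "'z \<Rightarrow> real \<Rightarrow> ennreal" where
  "surv z a = emeasure (Q z) (space S \<times> {a<..})"

text \<open>The age moves from the set into the integrand, so that parameter-dependent kernel
  integrals give joint measurability in state and age.\<close>

lemma surv_nn_integral:
  assumes "z \<in> space S"
  shows "surv z a = (\<integral>\<^sup>+(z', u). indicator {a<..} u \<partial>Q z)"
proof -
  have "surv z a = (\<integral>\<^sup>+x. indicator (space S \<times> {a<..}) x \<partial>Q z)"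
    using assms by (simp add: surv_def Q_sets)
  also have "\<dots> = (\<integral>\<^sup>+(z', u). indicator {a<..} u \<partial>Q z)"
    using assms by (intro nn_integral_cong) (auto simp: Q_space indicator_def)
  finally show ?thesis .
qed

lemma surv_measurable [measurable]: "(\<lambda>(z, a). surv z a) \<in> borel_measurable SA"
proof -
  have "(\<lambda>x. \<integral>\<^sup>+y. indicator {snd x<..} (snd y) \<partial>Q (fst x)) \<in> borel_measurable SA"
    unfolding indicator_def greaterThan_iff
    by (rule nn_integral_measurable_subprob_algebra2[where N = SA]) measurable
  then show ?thesis
    by (rule measurable_cong[THEN iffD1, rotated])
       (auto simp: surv_nn_integral space_pair_measure split_beta')
qed

lemma surv_le_1: "z \<in> space S \<Longrightarrow> surv z a \<le> 1"
  unfolding surv_def using prob_space.emeasure_le_1[OF Q_prob] .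

text \<open>Holding times are strictly positive under the kernel, so age 0 is survived with
  certainty and starting there involves no conditioning.\<close>

lemma surv_0: "z \<in> space S \<Longrightarrow> surv z 0 = 1"
proof -
  assume z: "z \<in> space S"
  interpret prob_space "Q z" using z by (rule Q_prob)
  show ?thesis
    unfolding surv_def using Q_pos[OF z]
    by (intro emeasure_eq_1_AE) (auto simp: Q_sets z Q_space elim!: AE_mp)
qed

lemma surv_less_top: "z \<in> space S \<Longrightarrow> surv z a < \<top>"
  using surv_le_1[of z a] by (auto simp: less_top[symmetric] top_unique)

lemma survival_eq: "survival S Q z a = enn2real (surv z a)"
  by (simp add: survival_def surv_def measure_def)

lemma survival_pos_iff: "z \<in> space S \<Longrightarrow> 0 < survival S Q z a \<longleftrightarrow> surv z a \<noteq> 0"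
  using surv_less_top[of z a] by (simp add: survival_eq enn2real_positive_iff zero_less_iff_neq_zero)

text \<open>\<open>jump_op k \<phi> c z a\<close> is the expectation of \<open>\<phi>\<close> at time \<open>c\<close> over paths from \<open>z\<close> with age \<open>a\<close>
  that jump \<open>k\<close> times, without dividing by the probability that the holding time exceeds \<open>a\<close>.\<close>

primrec jump_op :: "nat \<Rightarrow> ('z \<times> real \<Rightarrow> ennreal) \<Rightarrow> real \<Rightarrow> 'z \<Rightarrow> real \<Rightarrow> ennreal" where
  "jump_op 0 \<phi> c z a = \<phi> (z, a + c) * surv z (a + c)"
| "jump_op (Suc k) \<phi> c z a =
     (\<integral>\<^sup>+(z', u). indicator {a<..a + c} u * jump_op k \<phi> (a + c - u) z' 0 \<partial>Q z)"

text \<open>The time has to be among the variables because the recursive call runs for the remaining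
  time \<open>a + c - u\<close>, which varies with the integration variable.\<close>

lemma jump_op_measurable [measurable]:
  assumes [measurable]: "\<phi> \<in> borel_measurable SA"
  shows "(\<lambda>(c, z, a). jump_op k \<phi> c z a) \<in> borel_measurable (borel \<Otimes>\<^sub>M SA)"
proof (induction k)
  case 0
  show ?case by simp
next
  case (Suc k)
  have [measurable (raw)]: "f \<in> borel_measurable N \<Longrightarrow> g \<in> measurable N S \<Longrightarrow> h \<in> borel_measurable N \<Longrightarrow>
     (\<lambda>x. jump_op k \<phi> (f x) (g x) (h x)) \<in> borel_measurable N" for f g h and N :: "'n measure"
    using measurable_compose[OF _ Suc, of "\<lambda>x. (f x, g x, h x)" N] by simp
  have "(\<lambda>x. \<integral>\<^sup>+y. of_bool (snd (snd x) < snd y \<and> snd y \<le> snd (snd x) + fst x) *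
      jump_op k \<phi> (snd (snd x) + fst x - snd y) (fst y) 0 \<partial>Q (fst (snd x)))
      \<in> borel_measurable (borel \<Otimes>\<^sub>M SA)"
    by (rule nn_integral_measurable_subprob_algebra2[where N = SA]) measurable
  then show ?case
    by (simp add: split_beta' indicator_def)
qed

lemma jump_op_measurable' [measurable (raw)]:
  assumes "\<phi> \<in> borel_measurable SA" "f \<in> borel_measurable N" "g \<in> measurable N S" "h \<in> borel_measurable N"
  shows "(\<lambda>x. jump_op k \<phi> (f x) (g x) (h x)) \<in> borel_measurable N"
  using measurable_compose[OF _ jump_op_measurable[OF assms(1)], of "\<lambda>x. (f x, g x, h x)" N k] assms by simp

lemma surv_measurable' [measurable (raw)]:
  assumes "g \<in> measurable N S" "h \<in> borel_measurable N"
  shows "(\<lambda>x. surv (g x) (h x)) \<in> borel_measurable N"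
  using measurable_compose[OF _ surv_measurable, of "\<lambda>x. (g x, h x)" N] assms by simp

lemma Q_borel_measurable: "z \<in> space S \<Longrightarrow> f \<in> borel_measurable SA \<Longrightarrow> f \<in> borel_measurable (Q z)"
  using measurable_cong_sets[OF Q_sets refl] by blast

lemma jump_integrand_measurable:
  assumes "z \<in> space S" and [measurable]: "\<phi> \<in> borel_measurable SA"
  shows "(\<lambda>x. indicator {a<..b} (snd x) * jump_op k \<phi> (b - snd x) (fst x) 0) \<in> borel_measurable (Q z)"
  by (rule Q_borel_measurable[OF assms(1)]) measurable

text \<open>The factor \<open>surv\<close> in the base case kills pairs without survival, and the
  indicator keeps the remaining time nonnegative, so no negative age is reached.\<close>

lemma jump_op_cong:
  assumes "\<And>z a. z \<in> space S \<Longrightarrow> 0 \<le> a \<Longrightarrow> surv z a \<noteq> 0 \<Longrightarrow> \<phi> (z, a) = \<psi> (z, a)"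
  shows "0 \<le> c \<Longrightarrow> 0 \<le> a \<Longrightarrow> z \<in> space S \<Longrightarrow> jump_op k \<phi> c z a = jump_op k \<psi> c z a"
proof (induction k arbitrary: c z a)
  case 0
  then show ?case using assms[of z "a + c"] by (cases "surv z (a + c) = 0") auto
next
  case (Suc k)
  then show ?case
    by (auto simp: Q_space intro!: nn_integral_cong split: split_indicator)
qed

section \<open>Linearity and monotone continuity in the test function\<close>

lemma jump_op_suminf:
  assumes [measurable]: "\<And>i. \<phi> i \<in> borel_measurable SA" and "z \<in> space S"
  shows "jump_op k (\<lambda>x. \<Sum>i. \<phi> i x) c z a = (\<Sum>i::nat. jump_op k (\<phi> i) c z a)"
  using assms(2)
proof (induction k arbitrary: c z a)
  case (Suc k)
  have "jump_op (Suc k) (\<lambda>x. \<Sum>i. \<phi> i x) c z a =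
    (\<integral>\<^sup>+(z', u). (\<Sum>i. indicator {a<..a + c} u * jump_op k (\<phi> i) (a + c - u) z' 0) \<partial>Q z)"
    using Suc by (auto simp: Q_space intro!: nn_integral_cong)
  also have "\<dots> = (\<Sum>i. jump_op (Suc k) (\<phi> i) c z a)"
    unfolding jump_op.simps split_beta'
    by (rule nn_integral_suminf) (simp add: jump_integrand_measurable Suc)
  finally show ?case .
qed simp

lemma jump_op_add:
  assumes [measurable]: "\<phi> \<in> borel_measurable SA" "\<psi> \<in> borel_measurable SA" and "z \<in> space S"
  shows "jump_op k (\<lambda>x. \<phi> x + \<psi> x) c z a = jump_op k \<phi> c z a + jump_op k \<psi> c z a"
  using assms(3)
proof (induction k arbitrary: c z a)
  case (Suc k)
  have "jump_op (Suc k) (\<lambda>x. \<phi> x + \<psi> x) c z a =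
    (\<integral>\<^sup>+(z', u). indicator {a<..a + c} u * jump_op k \<phi> (a + c - u) z' 0
        + indicator {a<..a + c} u * jump_op k \<psi> (a + c - u) z' 0 \<partial>Q z)"
    using Suc by (auto simp: Q_space distrib_left intro!: nn_integral_cong)
  also have "\<dots> = jump_op (Suc k) \<phi> c z a + jump_op (Suc k) \<psi> c z a"
    by (simp add: split_beta' nn_integral_add jump_integrand_measurable Suc)
  finally show ?case .
qed (simp add: distrib_right)

lemma jump_op_cmult:
  assumes [measurable]: "\<phi> \<in> borel_measurable SA" and "z \<in> space S"
  shows "jump_op k (\<lambda>x. r * \<phi> x) c z a = r * jump_op k \<phi> c z a"
  using assms(2)
proof (induction k arbitrary: c z a)
  case (Suc k)
  have "jump_op (Suc k) (\<lambda>x. r * \<phi> x) c z a =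
    (\<integral>\<^sup>+(z', u). r * (indicator {a<..a + c} u * jump_op k \<phi> (a + c - u) z' 0) \<partial>Q z)"
    using Suc by (auto simp: Q_space ac_simps intro!: nn_integral_cong)
  also have "\<dots> = r * jump_op (Suc k) \<phi> c z a"
    by (simp add: split_beta' nn_integral_cmult jump_integrand_measurable Suc)
  finally show ?case .
qed (simp add: ac_simps)

lemma jump_op_mono:
  assumes "\<And>z a. z \<in> space S \<Longrightarrow> \<phi> (z, a) \<le> \<psi> (z, a)"
  shows "z \<in> space S \<Longrightarrow> jump_op k \<phi> c z a \<le> jump_op k \<psi> c z a"
proof (induction k arbitrary: c z a)
  case 0
  then show ?case using assms[of z "a + c"] by (auto intro!: mult_right_mono)
next
  case (Suc k)
  then show ?case
    by (auto simp: Q_space intro!: nn_integral_mono mult_left_mono)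
qed

lemma jump_op_SUP:
  assumes [measurable]: "\<And>i. \<phi> i \<in> borel_measurable SA" and "incseq \<phi>" and "z \<in> space S"
  shows "jump_op k (\<lambda>x. SUP i. \<phi> i x) c z a = (SUP i::nat. jump_op k (\<phi> i) c z a)"
  using assms(3)
proof (induction k arbitrary: c z a)
  case (Suc k)
  have "jump_op (Suc k) (\<lambda>x. SUP i. \<phi> i x) c z a =
    (\<integral>\<^sup>+(z', u). (SUP i. indicator {a<..a + c} u * jump_op k (\<phi> i) (a + c - u) z' 0) \<partial>Q z)"
    using Suc by (auto simp: Q_space SUP_mult_left_ennreal intro!: nn_integral_cong)
  also have "\<dots> = (SUP i. jump_op (Suc k) (\<phi> i) c z a)"
    unfolding jump_op.simps split_beta'
  proof (rule nn_integral_monotone_convergence_SUP_AE)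
    fix i
    have "jump_op k (\<phi> i) (a + c - u) z' 0 \<le> jump_op k (\<phi> (Suc i)) (a + c - u) z' 0"
      if "z' \<in> space S" for z' u
      using assms(2) that by (intro jump_op_mono) (auto simp: incseq_Suc_iff le_fun_def)
    then show "AE x in Q z. indicator {a<..a + c} (snd x) * jump_op k (\<phi> i) (a + c - snd x) (fst x) 0
        \<le> indicator {a<..a + c} (snd x) * jump_op k (\<phi> (Suc i)) (a + c - snd x) (fst x) 0"
      using Suc.prems by (auto simp: Q_space intro!: AE_I2 mult_left_mono)
  qed (simp add: jump_integrand_measurable Suc)
  finally show ?case .
qed (simp add: SUP_mult_right_ennreal)

text \<open>Mass balance at the first jump: holding times beyond \<open>a + c\<close> give the term
  without jumps, those in \<open>(a, a + c]\<close> restart with mass at most 1, and the two ranges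
  partition the holding times beyond \<open>a\<close>.\<close>

lemma jump_op_sum_le_surv:
  assumes "0 \<le> c" "z \<in> space S"
  shows "(\<Sum>k\<le>n. jump_op k (\<lambda>_. 1) c z a) \<le> surv z a"
  using assms
proof (induction n arbitrary: c z a)
  case 0
  then show ?case
    by (auto simp: surv_nn_integral intro!: nn_integral_mono split: split_indicator)
next
  case (Suc n)
  have "(\<Sum>k\<le>Suc n. jump_op k (\<lambda>_. 1) c z a) = jump_op 0 (\<lambda>_. 1) c z a +
     (\<Sum>k\<le>n. jump_op (Suc k) (\<lambda>_. 1) c z a)"
    by (subst sum.atMost_Suc_shift) simp
  also have "(\<Sum>k\<le>n. jump_op (Suc k) (\<lambda>_. 1) c z a) =
     (\<integral>\<^sup>+(z', u). (\<Sum>k\<le>n. indicator {a<..a + c} u * jump_op k (\<lambda>_. 1) (a + c - u) z' 0) \<partial>Q z)"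
    unfolding jump_op.simps split_beta'
    by (rule nn_integral_sum[symmetric]) (simp add: jump_integrand_measurable Suc)
  also have "\<dots> \<le> (\<integral>\<^sup>+(z', u). indicator {a<..a + c} u \<partial>Q z)"
  proof (intro nn_integral_mono, clarify)
    fix z' u assume "(z', u) \<in> space (Q z)"
    then have z': "z' \<in> space S" using Suc.prems(2) by (simp add: Q_space)
    have "indicator {a<..a + c} u * (\<Sum>k\<le>n. jump_op k (\<lambda>_. 1) (a + c - u) z' 0) \<le> indicator {a<..a + c} u"
      using order_trans[OF Suc.IH[of "a + c - u" z' 0] surv_le_1[OF z']] z'
      by (auto split: split_indicator)
    then show "(\<Sum>k\<le>n. indicator {a<..a + c} u * jump_op k (\<lambda>_. 1) (a + c - u) z' 0)
       \<le> indicator {a<..a + c} u"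
      by (simp add: sum_distrib_left)
  qed
  also have "jump_op 0 (\<lambda>_. 1) c z a + (\<integral>\<^sup>+(z', u). indicator {a<..a + c} u \<partial>Q z) =
     (\<integral>\<^sup>+(z', u). indicator {a + c<..} u + indicator {a<..a + c} u \<partial>Q z)"
    using Suc.prems by (simp add: split_beta' surv_nn_integral nn_integral_add Q_borel_measurable)
  also have "\<dots> = surv z a"
    using Suc.prems by (auto simp: surv_nn_integral intro!: nn_integral_cong split: split_indicator)
  finally show ?case by (simp add: add_left_mono)
qed

lemma jump_op_surv_0:
  assumes "z \<in> space S" "0 \<le> c" "surv z a = 0"
  shows "jump_op k \<phi> c z a = 0"
proof (cases k)
  case 0
  have "surv z (a + c) \<le> surv z a"
    unfolding surv_nn_integral[OF assms(1)]
    using assms by (auto intro!: nn_integral_mono split: split_indicator)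
  then show ?thesis using assms(3) 0 by simp
next
  case (Suc m)
  have "AE x in Q z. \<not> a < snd x"
    using assms by (subst AE_iff_measurable[of "space S \<times> {a<..}"])
      (auto simp: Q_sets Q_space surv_def)
  then have "AE x in Q z. (case x of (z', u) \<Rightarrow> indicator {a<..a + c} u * jump_op m \<phi> (a + c - u) z' 0) = 0"
    by (rule AE_mp) (auto split: split_indicator)
  then show ?thesis
    using Suc nn_integral_cong_AE[of "\<lambda>x. case x of (z', u) \<Rightarrow> indicator {a<..a + c} u * jump_op m \<phi> (a + c - u) z' 0" "\<lambda>_. 0" "Q z"]
    by simp
qed

section \<open>Division by the survival probability\<close>

definition jump_exp :: "nat \<Rightarrow> ('z \<times> real \<Rightarrow> ennreal) \<Rightarrow> real \<Rightarrow> 'z \<times> real \<Rightarrow> ennreal" where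
  "jump_exp k \<phi> t = (\<lambda>(z, a). jump_op k \<phi> t z a / surv z a)"

lemma jump_exp_measurable [measurable]:
  assumes [measurable]: "\<phi> \<in> borel_measurable SA"
  shows "jump_exp k \<phi> t \<in> borel_measurable SA"
  unfolding jump_exp_def by measurable

text \<open>Multiplying back is valid even where the survival probability is 0, because
  \<open>jump_op\<close> vanishes there too.\<close>

lemma jump_exp_surv:
  assumes "z \<in> space S" "0 \<le> t"
  shows "jump_exp k \<phi> t (z, a) * surv z a = jump_op k \<phi> t z a"
  using surv_less_top[OF assms(1), of a] jump_op_surv_0[OF assms, of a k \<phi>]
  by (cases "surv z a = 0") (auto simp: jump_exp_def ennreal_divide_times ennreal_times_divide[symmetric] ennreal_divide_self)

lemma jump_op_semigroup:
  assumes [measurable]: "\<phi> \<in> borel_measurable SA"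
    and "0 \<le> s" "0 \<le> t" "0 \<le> a" "z \<in> space S"
  shows "jump_op n \<phi> (s + t) z a = (\<Sum>k\<le>n. jump_op k (jump_exp (n - k) \<phi> t) s z a)"
  using assms(2-)
proof (induction n arbitrary: s z a)
  case 0
  then show ?case using jump_exp_surv[of z t 0 \<phi> "a + s"] by (simp add: add.assoc)
next
  case (Suc n)
  have eq: "jump_op n \<phi> (a + (s + t) - u) z' 0 = (\<Sum>k\<le>n. jump_op k (jump_exp (n - k) \<phi> t) (a + s - u) z' 0)"
    if "z' \<in> space S" "u \<le> a + s" for z' u
    using Suc.IH[of "a + s - u" 0 z'] that Suc.prems by (simp add: algebra_simps)
  \<comment> \<open>The first holding time is split at \<open>a + s\<close>. Beyond it there is no
    jump by time \<open>s\<close>, which becomes the summand \<open>k = 0\<close> with the pair at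
    age \<open>a + s\<close>; up to it the induction hypothesis applies after the restart at age
    0.\<close>
  have "jump_op (Suc n) \<phi> (s + t) z a =
     (\<integral>\<^sup>+(z', u). indicator {a + s<..a + s + t} u * jump_op n \<phi> (a + s + t - u) z' 0 +
       indicator {a<..a + s} u * (\<Sum>k\<le>n. jump_op k (jump_exp (n - k) \<phi> t) (a + s - u) z' 0) \<partial>Q z)"
    unfolding jump_op.simps
    using Suc.prems by (auto simp: Q_space eq add.assoc intro!: nn_integral_cong split: split_indicator)
  also have "\<dots> = jump_op (Suc n) \<phi> t z (a + s) +
      (\<integral>\<^sup>+(z', u). (\<Sum>k\<le>n. indicator {a<..a + s} u * jump_op k (jump_exp (n - k) \<phi> t) (a + s - u) z' 0) \<partial>Q z)"
    unfolding jump_op.simps split_beta' sum_distrib_left[symmetric]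
    by (intro nn_integral_add Q_borel_measurable[OF Suc.prems(4)]) measurable
  also have "(\<integral>\<^sup>+(z', u). (\<Sum>k\<le>n. indicator {a<..a + s} u * jump_op k (jump_exp (n - k) \<phi> t) (a + s - u) z' 0) \<partial>Q z)
     = (\<Sum>k\<le>n. jump_op (Suc k) (jump_exp (n - k) \<phi> t) s z a)"
    unfolding jump_op.simps split_beta'
    by (rule nn_integral_sum) (simp add: jump_integrand_measurable Suc)
  also have "jump_op (Suc n) \<phi> t z (a + s) = jump_op 0 (jump_exp (Suc n) \<phi> t) s z a"
    using jump_exp_surv[of z t "Suc n" \<phi> "a + s"] Suc.prems by simp
  finally show ?case
    by (subst sum.atMost_Suc_shift) simp
qed

section \<open>Summation over the number of jumps\<close>

definition trans_op :: "('z \<times> real \<Rightarrow> ennreal) \<Rightarrow> real \<Rightarrow> 'z \<times> real \<Rightarrow> ennreal" where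
  "trans_op \<phi> t x = (\<Sum>k. jump_exp k \<phi> t x)"

lemma trans_op_measurable [measurable]:
  assumes [measurable]: "\<phi> \<in> borel_measurable SA"
  shows "trans_op \<phi> t \<in> borel_measurable SA"
  unfolding trans_op_def by measurable

lemma trans_op_suminf:
  assumes "\<And>i. \<phi> i \<in> borel_measurable SA" and "x \<in> space SA"
  shows "trans_op (\<lambda>x. \<Sum>i. \<phi> i x) t x = (\<Sum>i::nat. trans_op (\<phi> i) t x)"
  using assms(2) unfolding trans_op_def
  by (subst suminf_swap_ennreal)
     (auto simp: jump_exp_def jump_op_suminf[OF assms(1)] space_pair_measure)

lemma trans_op_add:
  assumes "\<phi> \<in> borel_measurable SA" "\<psi> \<in> borel_measurable SA" and "x \<in> space SA"
  shows "trans_op (\<lambda>x. \<phi> x + \<psi> x) t x = trans_op \<phi> t x + trans_op \<psi> t x"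
  using assms(3) unfolding trans_op_def
  by (auto simp: suminf_add[OF summableI summableI] jump_exp_def jump_op_add[OF assms(1,2)]
      space_pair_measure add_divide_distrib_ennreal)

lemma trans_op_cmult:
  assumes "\<phi> \<in> borel_measurable SA" and "x \<in> space SA"
  shows "trans_op (\<lambda>x. r * \<phi> x) t x = r * trans_op \<phi> t x"
  using assms(2) unfolding trans_op_def
  by (auto simp: jump_exp_def jump_op_cmult[OF assms(1)] space_pair_measure ennreal_times_divide[symmetric])

lemma trans_op_mono:
  assumes "\<And>z a. z \<in> space S \<Longrightarrow> \<phi> (z, a) \<le> \<psi> (z, a)" "z \<in> space S"
  shows "trans_op \<phi> t (z, a) \<le> trans_op \<psi> t (z, a)"
  unfolding trans_op_def jump_exp_def
  by (auto intro!: suminf_le summableI divide_right_mono_ennreal jump_op_mono assms)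

lemma trans_op_SUP:
  assumes "\<And>i. \<phi> i \<in> borel_measurable SA" and "incseq \<phi>" and "x \<in> space SA"
  shows "trans_op (\<lambda>x. SUP i. \<phi> i x) t x = (SUP i::nat. trans_op (\<phi> i) t x)"
proof -
  obtain z a where x: "x = (z, a)" "z \<in> space S"
    using assms(3) by (cases x) (auto simp: space_pair_measure)
  have "incseq (\<lambda>i. jump_exp k (\<phi> i) t x)" for k
    using assms(2) x(2) unfolding x jump_exp_def
    by (auto simp: incseq_def le_fun_def intro!: divide_right_mono_ennreal jump_op_mono)
  then have "(SUP i. trans_op (\<phi> i) t x) = (\<Sum>k. SUP i. jump_exp k (\<phi> i) t x)"
    unfolding trans_op_def by (rule ennreal_suminf_SUP_eq[symmetric])
  then show ?thesis
    using x by (simp add: trans_op_def jump_exp_def jump_op_SUP[OF assms(1,2)] divide_ennreal_def SUP_mult_right_ennreal)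
qed

lemma trans_op_cong:
  assumes "\<And>z a. z \<in> space S \<Longrightarrow> 0 \<le> a \<Longrightarrow> surv z a \<noteq> 0 \<Longrightarrow> \<phi> (z, a) = \<psi> (z, a)" "0 \<le> t" "0 \<le> a" "z \<in> space S"
  shows "trans_op \<phi> t (z, a) = trans_op \<psi> t (z, a)"
  unfolding trans_op_def jump_exp_def using jump_op_cong[of \<phi> \<psi> t a z] assms by simp

text \<open>Only an inequality, since mass may be lost to paths with infinitely many jumps by time
  \<open>t\<close>.\<close>

lemma trans_op_1_le:
  assumes "0 \<le> t" "z \<in> space S"
  shows "trans_op (\<lambda>_. 1) t (z, a) \<le> 1"
proof (cases "surv z a = 0")
  case True
  then show ?thesis using assms by (simp add: trans_op_def jump_exp_def jump_op_surv_0)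
next
  case False
  have "(\<Sum>k<n. jump_op k (\<lambda>_. 1) t z a) \<le> surv z a" for n :: nat
    using order_trans[OF sum_mono2 jump_op_sum_le_surv[OF assms, of a n]] by (metis (no_types) finite_atMost lessThan_subset_iff atMost_iff lessThan_iff less_imp_le_nat subsetI zero_le)
  then have "(\<Sum>k. jump_op k (\<lambda>_. 1) t z a) \<le> surv z a"
    using suminf_le_const[OF summableI] by blast
  then have "(\<Sum>k. jump_op k (\<lambda>_. 1) t z a) / surv z a \<le> surv z a / surv z a"
    by (rule divide_right_mono_ennreal)
  then show ?thesis
    using False surv_less_top[OF assms(2), of a] by (simp add: trans_op_def jump_exp_def ennreal_divide_self)
qed

text \<open>A jump would need a holding time in the empty interval \<open>(a, a]\<close>, so only
  the term without jumps remains, and its nonzero survival factor cancels.\<close>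

lemma trans_op_0:
  assumes "z \<in> space S" "surv z a \<noteq> 0"
  shows "trans_op \<phi> 0 (z, a) = \<phi> (z, a)"
proof -
  have "trans_op \<phi> 0 (z, a) = (\<Sum>k. if k = 0 then \<phi> (z, a) else 0)"
    unfolding trans_op_def
  proof (intro arg_cong[where f = suminf] ext)
    fix k show "jump_exp k \<phi> 0 (z, a) = (if k = 0 then \<phi> (z, a) else 0)"
      using assms surv_less_top[OF assms(1), of a]
      by (cases k) (auto simp: jump_exp_def ennreal_times_divide[symmetric] ennreal_divide_self split_beta')
  qed
  also have "\<dots> = \<phi> (z, a)"
    by (subst suminf_finite[of "{0}"]) auto
  finally show ?thesis .
qed

lemma trans_op_semigroup:
  assumes [measurable]: "\<phi> \<in> borel_measurable SA"
    and "0 \<le> s" "0 \<le> t" "0 \<le> a" "z \<in> space S"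
  shows "trans_op \<phi> (s + t) (z, a) = trans_op (trans_op \<phi> t) s (z, a)"
proof -
  have "trans_op \<phi> (s + t) (z, a) = (\<Sum>n. \<Sum>k\<le>n. jump_exp k (jump_exp (n - k) \<phi> t) s (z, a))"
    by (simp add: trans_op_def jump_exp_def[of _ _ "s + t"] jump_op_semigroup assms)
       (simp add: jump_exp_def[of _ _ s] divide_ennreal_def sum_distrib_right[symmetric])
  also have "\<dots> = (\<Sum>k. \<Sum>m. jump_exp k (jump_exp m \<phi> t) s (z, a))"
    by (rule suminf_convolution_ennreal)
  also have "\<dots> = trans_op (\<lambda>x. \<Sum>m. jump_exp m \<phi> t x) s (z, a)"
    using assms(5) by (simp add: trans_op_def jump_exp_def[of _ _ s] jump_op_suminf)
  also have "(\<lambda>x. \<Sum>m. jump_exp m \<phi> t x) = trans_op \<phi> t"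
    by (simp add: trans_op_def fun_eq_iff)
  finally show ?thesis .
qed

end

section \<open>Transition kernels\<close>

context semi_markov_kernel
begin

text \<open>A transition semigroup has to satisfy its identities at every pair, also where the age is
  negative, the survival probability vanishes or the process may explode. Such pairs are made
  absorbing; this is consistent because almost no path from a regular pair meets them.\<close>

definition regular :: "('z \<times> real) set" where
  "regular = {x \<in> space SA. 0 \<le> snd x \<and> surv (fst x) (snd x) \<noteq> 0 \<and>
     (\<forall>m::nat. trans_op (\<lambda>_. 1) (real m) x = 1)}"

definition trans_kernel :: "real \<Rightarrow> 'z \<times> real \<Rightarrow> ('z \<times> real) measure" where
  "trans_kernel t x = (if x \<in> regular
     then measure_of (space SA) (sets SA) (\<lambda>A. trans_op (indicator A) t x) else return SA x)"

lemma regular_sets [measurable]: "regular \<in> sets SA"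
  unfolding regular_def by measurable

lemma regular_space: "x \<in> regular \<Longrightarrow> x \<in> space SA"
  by (simp add: regular_def)

text \<open>By the semigroup identity mass cannot grow with time, so full mass at a natural time
  beyond \<open>t\<close> forces full mass at \<open>t\<close>. Asking only for natural times makes
  \<open>regular\<close> a countable intersection, hence measurable and suited to almost sure
  statements.\<close>

lemma regular_trans_op_1:
  assumes "x \<in> regular" "0 \<le> t"
  shows "trans_op (\<lambda>_. 1) t x = 1"
proof -
  obtain z a where x: "x = (z, a)" "z \<in> space S" "0 \<le> a"
    using assms(1) by (cases x) (auto simp: regular_def space_pair_measure)
  obtain m :: nat where m: "t \<le> m"
    using real_arch_simple by blast
  have "1 = trans_op (\<lambda>_. 1) (t + (m - t)) x"
    using assms(1) by (simp add: regular_def)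
  also have "\<dots> = trans_op (trans_op (\<lambda>_. 1) (m - t)) t x"
    using assms m x unfolding x by (subst trans_op_semigroup) auto
  also have "\<dots> \<le> trans_op (\<lambda>_. 1) t x"
    using x m unfolding x by (intro trans_op_mono trans_op_1_le) auto
  finally show ?thesis
    using trans_op_1_le[OF assms(2) x(2), of a] x(1) by simp
qed

lemma sets_trans_kernel [simp]: "sets (trans_kernel t x) = sets SA"
  by (simp add: trans_kernel_def)

lemma space_trans_kernel [simp]: "space (trans_kernel t x) = space SA"
  by (rule sets_eq_imp_space_eq) simp

lemma emeasure_trans_kernel:
  assumes "x \<in> regular" "A \<in> sets SA"
  shows "emeasure (trans_kernel t x) A = trans_op (indicator A) t x"
proof (rule emeasure_measure_of)
  show "trans_kernel t x = measure_of (space SA) (sets SA) (\<lambda>A. trans_op (indicator A) t x)"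
    using assms by (simp add: trans_kernel_def)
  show "positive (sets (trans_kernel t x)) (\<lambda>A. trans_op (indicator A) t x)"
    using trans_op_cmult[of "\<lambda>_. 0" x 0 t] regular_space[OF assms(1)]
    by (simp add: positive_def indicator_def[abs_def])
  show "countably_additive (sets (trans_kernel t x)) (\<lambda>A. trans_op (indicator A) t x)"
  proof (rule countably_additiveI)
    fix B :: "nat \<Rightarrow> ('z \<times> real) set"
    assume B: "range B \<subseteq> sets (trans_kernel t x)" "disjoint_family B"
    have "(indicator (\<Union> (range B)) :: _ \<Rightarrow> ennreal) = (\<lambda>y. \<Sum>i. indicator (B i) y)"
      using suminf_indicator[OF B(2)] by (auto simp: fun_eq_iff)
    then show "(\<Sum>i. trans_op (indicator (B i)) t x) = trans_op (indicator (\<Union> (range B))) t x"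
      using B(1) regular_space[OF assms(1)] by (simp add: trans_op_suminf image_subset_iff)
  qed
qed (use assms in \<open>auto simp: sets.space_closed\<close>)

text \<open>Composing two kernels integrates functions of the form \<open>trans_op \<phi> t\<close>,
  hence the extension beyond indicators.\<close>

lemma nn_integral_trans_kernel:
  assumes "x \<in> regular" and "\<phi> \<in> borel_measurable SA"
  shows "(\<integral>\<^sup>+y. \<phi> y \<partial>trans_kernel t x) = trans_op \<phi> t x"
  using assms(2)
proof (induction rule: borel_measurable_induct)
  case (cong f g)
  have "trans_op f t x = trans_op g t x"
  proof -
    obtain z a where x: "x = (z, a)" "z \<in> space S"
      using assms(1) by (cases x) (auto simp: regular_def space_pair_measure)
    have "f (z, a) = g (z, a)" if "z \<in> space S" for z a
      using cong(3)[of "(z, a)"] that by (simp add: space_pair_measure)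
    then show ?thesis
      unfolding x using x(2) by (intro antisym trans_op_mono) auto
  qed
  moreover have "(\<integral>\<^sup>+y. f y \<partial>trans_kernel t x) = (\<integral>\<^sup>+y. g y \<partial>trans_kernel t x)"
    using cong(3) by (intro nn_integral_cong) simp
  ultimately show ?case using cong(4) by simp
next
  case (set A)
  then show ?case using assms(1) by (simp add: emeasure_trans_kernel)
next
  case (mult u c)
  have [measurable]: "u \<in> borel_measurable (trans_kernel t x)"
    using mult by (simp cong: measurable_cong_sets)
  show ?case using mult assms(1) regular_space by (simp add: nn_integral_cmult trans_op_cmult)
next
  case (add u v)
  have [measurable]: "u \<in> borel_measurable (trans_kernel t x)" "v \<in> borel_measurable (trans_kernel t x)"
    using add by (simp_all cong: measurable_cong_sets)
  show ?case using add assms(1) regular_space by (simp add: nn_integral_add trans_op_add add.commute)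
next
  case (seq U)
  have [measurable]: "U i \<in> borel_measurable (trans_kernel t x)" for i
    using seq(1)[of i] by (simp cong: measurable_cong_sets)
  show ?case
    using seq assms(1) regular_space
    by (simp add: image_image SUP_apply[abs_def] nn_integral_monotone_convergence_SUP trans_op_SUP)
qed

lemma trans_kernel_prob:
  assumes "x \<in> space SA" "0 \<le> t"
  shows "prob_space (trans_kernel t x)"
proof (cases "x \<in> regular")
  case True
  have "(\<integral>\<^sup>+y. 1 \<partial>trans_kernel t x) = 1"
    using True assms by (simp add: nn_integral_trans_kernel regular_trans_op_1 del: nn_integral_const)
  then show ?thesis by (intro prob_spaceI) simp
next
  case False
  then show ?thesis using assms by (simp add: trans_kernel_def prob_space_return)
qed

lemma trans_kernel_measurable:
  assumes "0 \<le> t"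
  shows "trans_kernel t \<in> measurable SA (prob_algebra SA)"
proof (rule measurable_prob_algebraI)
  show "trans_kernel t \<in> measurable SA (subprob_algebra SA)"
  proof (rule measurable_subprob_algebra)
    fix A assume [measurable]: "A \<in> sets SA"
    have "(\<lambda>x. if x \<in> regular then trans_op (indicator A) t x else indicator A x) \<in> borel_measurable SA"
      by measurable
    then show "(\<lambda>x. emeasure (trans_kernel t x) A) \<in> borel_measurable SA"
      by (rule measurable_cong[THEN iffD1, rotated])
         (auto simp: emeasure_trans_kernel, simp add: trans_kernel_def)
  qed (use assms in \<open>auto intro: prob_space_imp_subprob_space trans_kernel_prob\<close>)
qed (use assms in \<open>auto intro: trans_kernel_prob\<close>)

text \<open>Negative ages and vanishing survival are null by \<open>trans_op_cong\<close>. For the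
  mass, the semigroup identity makes the mean of \<open>trans_op (\<lambda>_. 1) (real m)\<close>
  equal to the mass at \<open>t + m\<close>, which is 1; a function bounded by 1 with mean 1 is 1
  almost everywhere.\<close>

lemma AE_trans_kernel_regular:
  assumes "x \<in> regular" "0 \<le> t"
  shows "AE y in trans_kernel t x. y \<in> regular"
proof -
  obtain z a where x: "x = (z, a)" "z \<in> space S" "0 \<le> a"
    using assms(1) by (cases x) (auto simp: regular_def space_pair_measure)
  interpret P: prob_space "trans_kernel t x"
    using assms by (intro trans_kernel_prob) (auto simp: regular_def)
  have [measurable_cong]: "sets (trans_kernel t x) = sets SA" by simp
  define B where "B = {y \<in> space SA. \<not> (0 \<le> snd y \<and> surv (fst y) (snd y) \<noteq> 0)}"
  have [measurable]: "B \<in> sets SA"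
    unfolding B_def by measurable
  have "emeasure (trans_kernel t x) B = trans_op (\<lambda>_. 0) t x"
    unfolding emeasure_trans_kernel[OF assms(1) \<open>B \<in> sets SA\<close>] unfolding x
    using x assms by (intro trans_op_cong) (auto simp: B_def)
  also have "\<dots> = 0"
    using trans_op_cmult[of "\<lambda>_. 0" x 0 t] regular_space[OF assms(1)] by simp
  finally have "AE y in trans_kernel t x. y \<notin> B"
    by (subst AE_iff_measurable[of B]) (auto simp: B_def)
  moreover have "AE y in trans_kernel t x. trans_op (\<lambda>_. 1) (real m) y = 1" for m :: nat
  proof -
    have le: "trans_op (\<lambda>_. 1) (real m) y \<le> 1" if "y \<in> space SA" for y
      using that trans_op_1_le by (cases y) (auto simp: space_pair_measure)
    have "(\<integral>\<^sup>+y. trans_op (\<lambda>_. 1) (real m) y \<partial>trans_kernel t x) = 1"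
      using assms x regular_trans_op_1[OF assms(1), of "t + m"]
      by (simp add: nn_integral_trans_kernel trans_op_semigroup x)
    then have "(\<integral>\<^sup>+y. 1 - trans_op (\<lambda>_. 1) (real m) y \<partial>trans_kernel t x) = 0"
      using le P.emeasure_space_1 by (subst nn_integral_diff) (auto intro!: AE_I2)
    then have "AE y in trans_kernel t x. 1 - trans_op (\<lambda>_. 1) (real m) y = 0"
      by (subst (asm) nn_integral_0_iff_AE) auto
    then show ?thesis
      by (rule AE_mp) (auto intro!: AE_I2 antisym le simp: diff_eq_0_iff_ennreal less_top_ennreal)
  qed
  ultimately have "AE y in trans_kernel t x. y \<notin> B \<and> (\<forall>m::nat. trans_op (\<lambda>_. 1) (real m) y = 1)"
    by (simp add: AE_all_countable)
  then show ?thesis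
    by (rule AE_mp) (auto intro!: AE_I2 simp: B_def regular_def)
qed

lemma trans_kernel_0: "x \<in> space SA \<Longrightarrow> trans_kernel 0 x = return SA x"
proof (cases "x \<in> regular")
  case True
  then show ?thesis
    by (intro measure_eqI) (auto simp: emeasure_trans_kernel regular_def space_pair_measure trans_op_0)
qed (simp add: trans_kernel_def)

lemma trans_kernel_semigroup:
  assumes "0 \<le> s" "0 \<le> t" "x \<in> space SA"
  shows "trans_kernel (s + t) x = bind (trans_kernel s x) (trans_kernel t)"
proof (cases "x \<in> regular")
  case True
  have [measurable_cong]: "sets (trans_kernel s x) = sets SA" by simp
  have m: "trans_kernel t \<in> measurable (trans_kernel s x) (subprob_algebra SA)"
    using measurable_prob_algebraD[OF trans_kernel_measurable[OF assms(2)]]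
    by (simp cong: measurable_cong_sets)
  have ne: "space (trans_kernel s x) \<noteq> {}"
    using assms by auto
  obtain z a where x: "x = (z, a)" "z \<in> space S" "0 \<le> a"
    using True by (cases x) (auto simp: regular_def space_pair_measure)
  show ?thesis
  proof (rule measure_eqI)
    show "sets (trans_kernel (s + t) x) = sets (trans_kernel s x \<bind> trans_kernel t)"
      using sets_bind[OF _ ne, of "trans_kernel t" SA] by simp
    fix A assume "A \<in> sets (trans_kernel (s + t) x)"
    then have [measurable]: "A \<in> sets SA" by simp
    have "emeasure (trans_kernel s x \<bind> trans_kernel t) A = (\<integral>\<^sup>+y. emeasure (trans_kernel t y) A \<partial>trans_kernel s x)"
      by (rule emeasure_bind[OF ne m]) simp
    also have "\<dots> = (\<integral>\<^sup>+y. trans_op (indicator A) t y \<partial>trans_kernel s x)"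
      using AE_trans_kernel_regular[OF True assms(1)]
      by (intro nn_integral_cong_AE) (auto simp: emeasure_trans_kernel)
    also have "\<dots> = trans_op (indicator A) (s + t) x"
      using True assms x by (simp add: nn_integral_trans_kernel trans_op_semigroup)
    finally show "emeasure (trans_kernel (s + t) x) A = emeasure (trans_kernel s x \<bind> trans_kernel t) A"
      using True by (simp add: emeasure_trans_kernel)
  qed
next
  case False
  then have "trans_kernel s x = return SA x" "trans_kernel (s + t) x = trans_kernel t x"
    by (auto simp: trans_kernel_def)
  then show ?thesis
    using bind_return[OF measurable_prob_algebraD[OF trans_kernel_measurable[OF assms(2)]] assms(3)] by simp
qed

lemma transition_semigroup_trans_kernel: "transition_semigroup SA trans_kernel"
  by (simp add: transition_semigroup_def trans_kernel_measurable trans_kernel_0 trans_kernel_semigroup)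

section \<open>Residual laws and transitions that forget the age\<close>

lemma nn_integral_residual_law:
  assumes "z \<in> space S" and [measurable]: "f \<in> borel_measurable SA"
  shows "(\<integral>\<^sup>+y. f y \<partial>residual_law S Q z a) =
    (\<integral>\<^sup>+(z', u). indicator {a<..} u * f (z', u - a) \<partial>Q z) / surv z a"
proof -
  note [measurable_cong] = Q_sets[OF assms(1)]
  have um: "(\<lambda>x. (fst x, snd x - a)) \<in> measurable (uniform_measure (Q z) (space S \<times> {a<..})) SA"
  proof -
    have "sets (uniform_measure (Q z) (space S \<times> {a<..})) = sets SA"
      by (simp only: sets_uniform_measure Q_sets[OF assms(1)])
    then show ?thesis
      by (subst measurable_cong_sets[OF _ refl]) measurable
  qed
  have E: "space S \<times> {a<..} \<in> sets (Q z)"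
    using assms(1) by (simp add: Q_sets)
  have "(\<integral>\<^sup>+y. f y \<partial>residual_law S Q z a) =
     (\<integral>\<^sup>+x. f (fst x, snd x - a) \<partial>uniform_measure (Q z) (space S \<times> {a<..}))"
    unfolding residual_law_def split_beta' by (rule nn_integral_distr[OF um]) simp
  also have "\<dots> = (\<integral>\<^sup>+x. f (fst x, snd x - a) * indicator (space S \<times> {a<..}) x \<partial>Q z) / surv z a"
    unfolding surv_def by (rule nn_integral_uniform_measure[OF Q_borel_measurable[OF assms(1)] E]) measurable
  also have "(\<integral>\<^sup>+x. f (fst x, snd x - a) * indicator (space S \<times> {a<..}) x \<partial>Q z) =
     (\<integral>\<^sup>+(z', u). indicator {a<..} u * f (z', u - a) \<partial>Q z)"
    using assms(1) by (intro nn_integral_cong) (auto simp: Q_space indicator_def)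
  finally show ?thesis .
qed

context
  assumes age_indep: "age_independent S Q"
begin

text \<open>\<open>jump_exp\<close> is the integral against the residual law of an integrand that
  does not mention the age. This relies on a test function of the state only: without a jump, the
  age at time \<open>c\<close> still depends on the initial one.\<close>

lemma jump_exp_age_free:
  assumes [measurable]: "\<psi> \<in> borel_measurable S" and c: "0 \<le> c" and z: "z \<in> space S" "0 \<le> a" "surv z a \<noteq> 0"
  shows "jump_exp k (\<lambda>x. \<psi> (fst x)) c (z, a) = jump_exp k (\<lambda>x. \<psi> (fst x)) c (z, 0)"
proof -
  let ?\<phi> = "\<lambda>x. \<psi> (fst x)"
  \<comment> \<open>The outcome as a function of destination and remaining holding time. With no
    jump the remaining time exceeds \<open>c\<close>; otherwise it is at most \<open>c\<close>, and
    the motion restarts at age 0 for the time left.\<close>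
  define f where "f = (case k of 0 \<Rightarrow> (\<lambda>x. \<psi> z * indicator {c<..} (snd x))
     | Suc m \<Rightarrow> (\<lambda>x. indicator {0<..c} (snd x) * jump_op m ?\<phi> (c - snd x) (fst x) 0))"
  have [measurable]: "f \<in> borel_measurable SA"
    unfolding f_def by (cases k) simp_all
  have "(\<integral>\<^sup>+(z', u). indicator {b<..} u * f (z', u - b) \<partial>Q z) = jump_op k ?\<phi> c z b" for b
  proof (cases k)
    case 0
    have "(\<integral>\<^sup>+(z', u). indicator {b<..} u * f (z', u - b) \<partial>Q z) =
      (\<integral>\<^sup>+x. \<psi> z * (case x of (z', u) \<Rightarrow> indicator {b + c<..} u) \<partial>Q z)"
    proof (rule nn_integral_cong, clarify)
      fix z' u
      have "indicator {b<..} u * indicator {c<..} (u - b) = (indicator {b + c<..} u :: ennreal)"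
        using c by (simp add: indicator_def)
      then show "indicator {b<..} u * f (z', u - b) = \<psi> z * indicator {b + c<..} u"
        by (simp add: f_def 0 mult.left_commute)
    qed
    also have "\<dots> = \<psi> z * surv z (b + c)"
      using z(1) by (simp add: nn_integral_cmult surv_nn_integral Q_borel_measurable split_beta')
    finally show ?thesis using 0 by simp
  next
    case (Suc m)
    have "indicator {b<..} u * f (z', u - b) = indicator {b<..b + c} u * jump_op m ?\<phi> (b + c - u) z' 0" for z' u
    proof -
      have "c - (u - b) = b + c - u" by simp
      then have "f (z', u - b) = indicator {0<..c} (u - b) * jump_op m ?\<phi> (b + c - u) z' 0"
        by (simp only: f_def Suc nat.case fst_conv snd_conv)
      moreover have "indicator {b<..} u * indicator {0<..c} (u - b) = (indicator {b<..b + c} u :: ennreal)"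
        by (auto simp: indicator_def)
      ultimately show ?thesis by (simp only: mult.assoc[symmetric])
    qed
    then show ?thesis by (simp only: Suc jump_op.simps)
  qed
  then have "jump_exp k ?\<phi> c (z, b) = (\<integral>\<^sup>+y. f y \<partial>residual_law S Q z b)" for b
    using z(1) by (simp add: nn_integral_residual_law jump_exp_def)
  \<comment> \<open>Comparison with age 0 is always permitted, since its survival probability is
    1.\<close>
  moreover have "residual_law S Q z a = residual_law S Q z 0"
  proof -
    have "0 < survival S Q z a" "0 < survival S Q z 0"
      using z by (simp_all add: survival_pos_iff surv_0)
    then show ?thesis
      using age_indep[unfolded age_independent_def] z(1,2) by blast
  qed
  ultimately show ?thesis by simp
qed

lemma trans_op_age_free:
  assumes "\<psi> \<in> borel_measurable S" "0 \<le> c" "z \<in> space S" "0 \<le> a" "surv z a \<noteq> 0"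
  shows "trans_op (\<lambda>x. \<psi> (fst x)) c (z, a) = trans_op (\<lambda>x. \<psi> (fst x)) c (z, 0)"
  unfolding trans_op_def using jump_exp_age_free[OF assms] by simp

lemma regular_age_0:
  assumes "x \<in> regular"
  shows "(fst x, 0) \<in> regular"
proof -
  have x: "fst x \<in> space S" "0 \<le> snd x" "surv (fst x) (snd x) \<noteq> 0"
    "trans_op (\<lambda>_. 1) (real m) (fst x, snd x) = 1" for m :: nat
    using assms by (auto simp: regular_def space_pair_measure)
  have "trans_op (\<lambda>_. 1) (real m) (fst x, 0) = 1" for m :: nat
    using trans_op_age_free[of "\<lambda>_. 1" "real m" "fst x" "snd x"] x(4)[of m] x by simp
  then show ?thesis
    using x(1) by (simp add: regular_def space_pair_measure surv_0)
qed

lemma emeasure_trans_kernel_age_free: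
  assumes "x \<in> regular" "0 \<le> t" "B \<in> sets S"
  shows "emeasure (trans_kernel t x) (B \<times> UNIV) = emeasure (trans_kernel t (fst x, 0)) (B \<times> UNIV)"
proof -
  have x: "fst x \<in> space S" "0 \<le> snd x" "surv (fst x) (snd x) \<noteq> 0"
    using assms(1) by (auto simp: regular_def space_pair_measure)
  have B: "B \<times> UNIV \<in> sets SA" using assms(3) by simp
  have ind: "(indicator (B \<times> UNIV) :: 'z \<times> real \<Rightarrow> ennreal) = (\<lambda>x. indicator B (fst x))"
    by (auto simp: fun_eq_iff indicator_def)
  have "trans_op (\<lambda>x. indicator B (fst x)) t (fst x, snd x) = trans_op (\<lambda>x. indicator B (fst x)) t (fst x, 0)"
    using assms x by (intro trans_op_age_free) auto
  then show ?thesis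
    unfolding emeasure_trans_kernel[OF assms(1) B] emeasure_trans_kernel[OF regular_age_0[OF assms(1)] B] ind
    by (simp only: prod.collapse)
qed

text \<open>Age 0 represents all ages: it always has positive survival, and it is regular as soon as
  some age of the same state is.\<close>

definition state_kernel :: "real \<Rightarrow> 'z \<Rightarrow> 'z measure" where
  "state_kernel t z = distr (trans_kernel t (z, 0)) S fst"

lemma emeasure_state_kernel:
  assumes "B \<in> sets S"
  shows "emeasure (state_kernel t z) B = emeasure (trans_kernel t (z, 0)) (B \<times> UNIV)"
proof -
  have m: "fst \<in> measurable (trans_kernel t (z, 0)) S"
    by (simp cong: measurable_cong_sets)
  have "fst -` B \<inter> space (trans_kernel t (z, 0)) = B \<times> UNIV"
    using sets.sets_into_space[OF assms] by (auto simp: space_pair_measure)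
  then show ?thesis
    unfolding state_kernel_def emeasure_distr[OF m assms] by simp
qed

lemma state_kernel_measurable:
  assumes "0 \<le> t"
  shows "state_kernel t \<in> measurable S (prob_algebra S)"
proof -
  note [measurable] = trans_kernel_measurable[OF assms]
  show ?thesis
    unfolding state_kernel_def[abs_def]
    by (rule measurable_distr_prob_space2[where M = SA]) measurable
qed

lemma AE_trans_kernel_age_free:
  assumes "0 \<le> s" "0 \<le> t" "z \<in> space S" "B \<in> sets S"
  shows "AE y in trans_kernel s (z, 0). emeasure (trans_kernel t y) (B \<times> UNIV) = emeasure (trans_kernel t (fst y, 0)) (B \<times> UNIV)"
proof (cases "(z, 0) \<in> regular")
  case True
  show ?thesis
    using AE_trans_kernel_regular[OF True assms(1)]
    by (rule AE_mp) (use assms in \<open>auto simp: emeasure_trans_kernel_age_free\<close>)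
next
  case False
  note [measurable] = measurable_prob_algebraD[OF trans_kernel_measurable[OF assms(2)]] assms(4)
  \<comment> \<open>The absorbed pair is \<open>(z, 0)\<close> itself, whose age is already
    0.\<close>
  have "AE y in return SA (z, 0). emeasure (trans_kernel t y) (B \<times> UNIV) = emeasure (trans_kernel t (fst y, 0)) (B \<times> UNIV)"
    using assms by (subst AE_return) (auto simp: space_pair_measure)
  moreover have "trans_kernel s (z, 0) = return SA (z, 0)"
    using False by (simp add: trans_kernel_def)
  ultimately show ?thesis by (simp only:)
qed

text \<open>The criterion for lumping a Markov kernel: the projected law over a further time
  \<open>t\<close> depends on the intermediate pair almost surely only through its state. So the
  Chapman-Kolmogorov identity of the pair, started from \<open>(z, 0)\<close>, closes on
  states.\<close>

lemma transition_semigroup_state_kernel: "transition_semigroup S state_kernel"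
  unfolding transition_semigroup_def
proof (intro conjI allI impI ballI)
  fix t :: real assume "0 \<le> t"
  then show "state_kernel t \<in> measurable S (prob_algebra S)" by (rule state_kernel_measurable)
next
  fix z assume "z \<in> space S"
  then show "state_kernel 0 z = return S z"
    by (simp add: state_kernel_def trans_kernel_0 space_pair_measure distr_return)
next
  fix s t :: real and z assume *: "0 \<le> s" "0 \<le> t" "z \<in> space S"
  note tk = measurable_prob_algebraD[OF trans_kernel_measurable[OF *(2)]]
  note sk = measurable_prob_algebraD[OF state_kernel_measurable[OF *(2)]]
  have [measurable_cong]: "sets (state_kernel r y) = sets S" for r y by (simp add: state_kernel_def)
  have [measurable_cong]: "sets (trans_kernel r y) = sets SA" for r y by simp
  have ne: "space (state_kernel s z) \<noteq> {}" "space (trans_kernel s (z, 0)) \<noteq> {}"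
    using *(3) by (auto simp: state_kernel_def space_pair_measure)
  have m: "state_kernel t \<in> measurable (state_kernel s z) (subprob_algebra S)"
       "trans_kernel t \<in> measurable (trans_kernel s (z, 0)) (subprob_algebra SA)"
    using sk tk by (auto simp: state_kernel_def cong: measurable_cong_sets)
  show "state_kernel (s + t) z = state_kernel s z \<bind> state_kernel t"
  proof (rule measure_eqI)
    show "sets (state_kernel (s + t) z) = sets (state_kernel s z \<bind> state_kernel t)"
      using sets_bind[OF _ ne(1), of "state_kernel t" S] by (simp add: state_kernel_def)
    fix B assume "B \<in> sets (state_kernel (s + t) z)"
    then have B [measurable]: "B \<in> sets S" by (simp add: state_kernel_def)
    have "emeasure (state_kernel s z \<bind> state_kernel t) B = (\<integral>\<^sup>+y. emeasure (state_kernel t y) B \<partial>state_kernel s z)"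
      by (rule emeasure_bind[OF ne(1) m(1) B])
    also have "\<dots> = (\<integral>\<^sup>+y. emeasure (state_kernel t (fst y)) B \<partial>trans_kernel s (z, 0))"
      unfolding state_kernel_def[of s]
      by (rule nn_integral_distr) (use measurable_emeasure_kernel[OF sk B] in \<open>auto cong: measurable_cong_sets\<close>)
    also have "\<dots> = (\<integral>\<^sup>+y. emeasure (trans_kernel t y) (B \<times> UNIV) \<partial>trans_kernel s (z, 0))"
      using AE_trans_kernel_age_free[OF * B]
      by (intro nn_integral_cong_AE) (auto simp: emeasure_state_kernel)
    also have "\<dots> = emeasure (trans_kernel s (z, 0) \<bind> trans_kernel t) (B \<times> UNIV)"
      by (rule emeasure_bind[OF ne(2) m(2), symmetric]) simp
    also have "\<dots> = emeasure (state_kernel (s + t) z) B"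
      using * by (simp add: emeasure_state_kernel trans_kernel_semigroup space_pair_measure)
    finally show "emeasure (state_kernel (s + t) z) B = emeasure (state_kernel s z \<bind> state_kernel t) B" ..
  qed
qed

end

end

section \<open>Conditioning on the event history\<close>

lemma measure_eqI_rectangles:
  assumes sets: "sets \<mu> = sets (A \<Otimes>\<^sub>M B)" "sets \<nu> = sets (A \<Otimes>\<^sub>M B)"
    and fin: "finite_measure \<mu>"
    and eq: "\<And>a b. a \<in> sets A \<Longrightarrow> b \<in> sets B \<Longrightarrow> emeasure \<mu> (a \<times> b) = emeasure \<nu> (a \<times> b)"
  shows "\<mu> = \<nu>"
proof (rule measure_eqI_generator_eq[OF Int_stable_pair_measure_generator, of A B])
  show "range (\<lambda>_::nat. space A \<times> space B) \<subseteq> {a \<times> b |a b. a \<in> sets A \<and> b \<in> sets B}"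
    by auto
  show "emeasure \<mu> (space A \<times> space B) \<noteq> \<infinity>"
    using finite_measure.emeasure_finite[OF fin] by simp
qed (use sets in \<open>auto simp: sets_pair_measure eq intro!: pair_measure_closed\<close>)

lemma space_generated [simp]: "space (generated M S I X) = space M"
  by (simp add: generated_def space_measure_of_conv)

lemma sets_generated:
  "sets (generated M S I X) = sigma_sets (space M) {X i -` A \<inter> space M | i A. i \<in> I \<and> A \<in> sets S}"
  unfolding generated_def by (rule sets_measure_of) auto

lemma measurable_generated:
  assumes "i \<in> I" "X i \<in> measurable M S"
  shows "X i \<in> measurable (generated M S I X) S"
proof (rule measurableI)
  fix A assume "A \<in> sets S"
  then show "X i -` A \<inter> space (generated M S I X) \<in> sets (generated M S I X)"
    using assms(1) unfolding sets_generated space_generated by (intro sigma_sets.Basic) blast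
qed (use measurable_space[OF assms(2)] in simp)

lemma sets_generated_subset:
  assumes "space N = space M" "\<And>i. i \<in> I \<Longrightarrow> X i \<in> measurable N S"
  shows "sets (generated M S I X) \<subseteq> sets N"
  unfolding sets_generated assms(1)[symmetric]
  using measurable_sets[OF assms(2)] by (intro sets.sigma_sets_subset) blast

lemma sets_event_history:
  "sets (event_history M S Z \<tau> n) =
     sigma_sets (space M) (sets (generated M S {0..n} Z) \<union> sets (generated M borel {1..n} \<tau>))"
  unfolding event_history_def
  using sets.space_closed[of "generated M S {0..n} Z"] sets.space_closed[of "generated M borel {1..n} \<tau>"]
  by (intro sets_measure_of) simp

lemma sets_event_history_subset:
  assumes "space N = space M" "\<And>m. m \<le> n \<Longrightarrow> Z m \<in> measurable N S"
    "\<And>m. m < n \<Longrightarrow> \<tau> (Suc m) \<in> borel_measurable N"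
  shows "sets (event_history M S Z \<tau> n) \<subseteq> sets N"
proof -
  have "sets (generated M S {0..n} Z) \<subseteq> sets N"
    using assms by (intro sets_generated_subset) auto
  moreover have "sets (generated M borel {1..n} \<tau>) \<subseteq> sets N"
  proof (intro sets_generated_subset assms(1))
    fix i assume "i \<in> {1..n}"
    then have "i - 1 < n" "i = Suc (i - 1)" by auto
    then show "\<tau> i \<in> borel_measurable N" using assms(3) by metis
  qed
  ultimately show ?thesis
    unfolding sets_event_history assms(1)[symmetric] by (intro sets.sigma_sets_subset) auto
qed

section \<open>Epochs and the event filtration\<close>

locale markov_renewal_process =
  fixes M :: "'w measure" and S :: "'z measure" and Q :: "'z \<Rightarrow> ('z \<times> real) measure"
    and Z :: "nat \<Rightarrow> 'w \<Rightarrow> 'z" and \<tau> :: "nat \<Rightarrow> 'w \<Rightarrow> real"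
  assumes mr: "markov_renewal M S Q Z \<tau>"
    and ne: "non_explosive M \<tau>"
begin

sublocale prob_space M
  using mr by (simp add: markov_renewal_def)

sublocale semi_markov_kernel S Q
  using mr by unfold_locales (simp add: markov_renewal_def)

lemma Z_measurable [measurable]: "Z n \<in> measurable M S"
  and \<tau>_measurable [measurable]: "\<tau> (Suc n) \<in> borel_measurable M"
  and \<tau>_pos: "\<omega> \<in> space M \<Longrightarrow> 0 < \<tau> (Suc n) \<omega>"
  using mr by (auto simp: markov_renewal_def)

abbreviation F :: "nat \<Rightarrow> 'w measure" where
  "F \<equiv> event_history M S Z \<tau>"

abbreviation T :: "nat \<Rightarrow> 'w \<Rightarrow> real" where
  "T \<equiv> epoch \<tau>"

lemma T_0 [simp]: "T 0 \<omega> = 0"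
  and T_Suc: "T (Suc n) \<omega> = T n \<omega> + \<tau> (Suc n) \<omega>"
  by (simp_all add: epoch_def)

lemma T_less: "\<omega> \<in> space M \<Longrightarrow> T n \<omega> < T (Suc n) \<omega>"
  by (simp add: T_Suc \<tau>_pos)

lemma T_mono: "\<omega> \<in> space M \<Longrightarrow> m \<le> n \<Longrightarrow> T m \<omega> \<le> T n \<omega>"
  by (rule lift_Suc_mono_le[of "\<lambda>n. T n \<omega>"]) (auto intro: less_imp_le T_less)

lemma T_measurable [measurable]: "T n \<in> borel_measurable M"
proof (induction n)
  case 0
  have "T 0 = (\<lambda>_. 0)" by (simp add: fun_eq_iff)
  then show ?case by simp
next
  case (Suc n)
  have "T (Suc n) = (\<lambda>\<omega>. T n \<omega> + \<tau> (Suc n) \<omega>)" by (simp add: T_Suc fun_eq_iff)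
  then show ?case using Suc by simp
qed

lemma space_F [simp]: "space (F n) = space M"
  by (simp add: event_history_def space_measure_of_conv)

lemma Z_measurable_F [measurable]:
  assumes "m \<le> n" shows "Z m \<in> measurable (F n) S"
proof (rule measurableI)
  fix A assume "A \<in> sets S"
  then have "Z m -` A \<inter> space M \<in> sets (generated M S {0..n} Z)"
    using measurable_sets[OF measurable_generated[of m "{0..n}" Z M S]] assms by simp
  then show "Z m -` A \<inter> space (F n) \<in> sets (F n)"
    by (auto simp: sets_event_history)
qed (use measurable_space[OF Z_measurable] in auto)

lemma \<tau>_measurable_F:
  assumes "m < n" shows "\<tau> (Suc m) \<in> borel_measurable (F n)"
proof (rule measurableI)
  fix A :: "real set" assume "A \<in> sets borel"
  then have "\<tau> (Suc m) -` A \<inter> space M \<in> sets (generated M borel {1..n} \<tau>)"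
    using measurable_sets[OF measurable_generated[of "Suc m" "{1..n}" \<tau> M borel]] assms by simp
  then show "\<tau> (Suc m) -` A \<inter> space (F n) \<in> sets (F n)"
    by (auto simp: sets_event_history)
qed auto

lemma T_measurable_F [measurable]: "m \<le> n \<Longrightarrow> T m \<in> borel_measurable (F n)"
proof (induction m)
  case 0
  have "T 0 = (\<lambda>_. 0)" by (simp add: fun_eq_iff)
  then show ?case by simp
next
  case (Suc m)
  then have [measurable]: "T m \<in> borel_measurable (F n)" "\<tau> (Suc m) \<in> borel_measurable (F n)"
    by (auto intro: \<tau>_measurable_F)
  have "T (Suc m) = (\<lambda>\<omega>. T m \<omega> + \<tau> (Suc m) \<omega>)" by (simp add: T_Suc fun_eq_iff)
  then show ?case by simp
qed

lemma subalgebra_F: "subalgebra M (F n)"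
  unfolding subalgebra_def using sets_event_history_subset[of M M n Z S \<tau>] by simp

lemma F_Suc: "f \<in> measurable (F n) N \<Longrightarrow> f \<in> measurable (F (Suc n)) N"
proof (rule measurable_from_subalg)
  have "sets (F n) \<subseteq> sets (F (Suc n))"
    by (intro sets_event_history_subset Z_measurable_F \<tau>_measurable_F) auto
  then show "subalgebra (F (Suc n)) (F n)" by (simp add: subalgebra_def)
qed

lemma F_M: "f \<in> measurable (F n) N \<Longrightarrow> f \<in> measurable M N"
  using measurable_from_subalg[OF subalgebra_F] .

section \<open>One step of the kernel given the history\<close>

lemma kernel_step_rect:
  assumes "G \<in> sets (F n)" "E \<in> sets S" "I \<in> sets borel"
  shows "emeasure M (G \<inter> {\<omega> \<in> space M. Z (Suc n) \<omega> \<in> E \<and> \<tau> (Suc n) \<omega> \<in> I}) =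
    (\<integral>\<^sup>+\<omega>. indicator G \<omega> * emeasure (Q (Z n \<omega>)) (E \<times> I) \<partial>M)"
proof -
  interpret finite_measure_subalgebra M "F n"
    by unfold_locales (rule subalgebra_F)
  note [measurable] = assms(2,3)
  have [measurable]: "G \<in> sets M"
    using assms(1) subalgebra_F by (auto simp: subalgebra_def)
  \<comment> \<open>The specification covers only sets of positive times. The waiting time, and
    almost surely the second coordinate under \<open>Q\<close>, are positive, so cutting
    \<open>I\<close> down to \<open>J\<close> changes neither side.\<close>
  define J where "J = I \<inter> {0<..}"
  have [measurable]: "J \<in> sets borel" by (simp add: J_def)
  define D where "D = {\<omega> \<in> space M. Z (Suc n) \<omega> \<in> E \<and> \<tau> (Suc n) \<omega> \<in> J}"
  have [measurable]: "D \<in> sets M" unfolding D_def by measurable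
  have m [measurable]: "(\<lambda>\<omega>. measure (Q (Z n \<omega>)) (E \<times> J)) \<in> borel_measurable M"
    using measurable_compose[OF Q_measurable measurable_measure_prob_algebra, of "E \<times> J"] by measurable
  have AE: "AE \<omega> in M. real_cond_exp M (F n) (indicator D) \<omega> = measure (Q (Z n \<omega>)) (E \<times> J)"
  proof -
    have "J \<subseteq> {0<..}" by (simp add: J_def)
    then show ?thesis
      using mr assms(2) \<open>J \<in> sets borel\<close> unfolding markov_renewal_def cprob_def D_def by blast
  qed
  have le1: "measure (Q (Z n \<omega>)) (E \<times> J) \<le> 1" if "\<omega> \<in> space M" for \<omega>
    using prob_space.prob_le_1[OF Q_prob] measurable_space[OF Z_measurable that] by simp
  have "measure M (G \<inter> D) = (\<integral>\<omega>\<in>G. indicator D \<omega> \<partial>M)"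
    by (simp add: set_lebesgue_integral_def indicator_inter_arith[symmetric])
  also have "\<dots> = (\<integral>\<omega>\<in>G. real_cond_exp M (F n) (indicator D) \<omega> \<partial>M)"
    using assms(1) by (intro real_cond_exp_intA) (auto simp: integrable_indicator_iff emeasure_eq_measure)
  also have "\<dots> = (\<integral>\<omega>\<in>G. measure (Q (Z n \<omega>)) (E \<times> J) \<partial>M)"
    unfolding set_lebesgue_integral_def
    by (intro integral_cong_AE) (use AE in \<open>auto elim!: AE_mp\<close>)
  finally have "emeasure M (G \<inter> D) = ennreal (\<integral>\<omega>. indicator G \<omega> * measure (Q (Z n \<omega>)) (E \<times> J) \<partial>M)"
    by (simp add: emeasure_eq_measure set_lebesgue_integral_def)
  also have "\<dots> = (\<integral>\<^sup>+\<omega>. ennreal (indicator G \<omega> * measure (Q (Z n \<omega>)) (E \<times> J)) \<partial>M)"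
    by (rule nn_integral_eq_integral[symmetric])
       (use le1 in \<open>auto intro!: integrable_const_bound[of _ 1] AE_I2 simp: indicator_def\<close>)
  also have "\<dots> = (\<integral>\<^sup>+\<omega>. indicator G \<omega> * emeasure (Q (Z n \<omega>)) (E \<times> I) \<partial>M)"
  proof (rule nn_integral_cong)
    fix \<omega> assume \<omega>: "\<omega> \<in> space M"
    then have z: "Z n \<omega> \<in> space S" using measurable_space[OF Z_measurable] by auto
    interpret Q: prob_space "Q (Z n \<omega>)" by (rule Q_prob[OF z])
    have "emeasure (Q (Z n \<omega>)) (E \<times> J) = emeasure (Q (Z n \<omega>)) (E \<times> I)"
      using Q_pos[OF z] by (intro emeasure_eq_AE) (auto simp: Q_sets[OF z] J_def elim!: AE_mp)
    then show "ennreal (indicator G \<omega> * measure (Q (Z n \<omega>)) (E \<times> J)) = indicator G \<omega> * emeasure (Q (Z n \<omega>)) (E \<times> I)"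
      by (simp add: Q.emeasure_eq_measure indicator_def)
  qed
  also have "G \<inter> D = G \<inter> {\<omega> \<in> space M. Z (Suc n) \<omega> \<in> E \<and> \<tau> (Suc n) \<omega> \<in> I}"
    using \<tau>_pos by (auto simp: D_def J_def)
  finally show ?thesis .
qed

text \<open>Weighting \<open>M\<close> by the indicator of \<open>G\<close> turns both sides into
  measures in \<open>Y\<close> that agree on rectangles.\<close>

lemma kernel_step_set:
  assumes "G \<in> sets (F n)" and [measurable]: "Y \<in> sets SA"
  shows "emeasure M (G \<inter> {\<omega> \<in> space M. (Z (Suc n) \<omega>, \<tau> (Suc n) \<omega>) \<in> Y}) =
    (\<integral>\<^sup>+\<omega>. indicator G \<omega> * emeasure (Q (Z n \<omega>)) Y \<partial>M)"
proof -
  have G [measurable]: "G \<in> sets M"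
    using assms(1) subalgebra_F by (auto simp: subalgebra_def)
  define N where "N = density M (indicator G)"
  have [measurable_cong]: "sets N = sets M" and N_space [simp]: "space N = space M"
    by (simp_all add: N_def)
  define \<mu> where "\<mu> = distr N SA (\<lambda>\<omega>. (Z (Suc n) \<omega>, \<tau> (Suc n) \<omega>))"
  define \<nu> where "\<nu> = bind N (\<lambda>\<omega>. Q (Z n \<omega>))"
  have e\<mu>: "emeasure \<mu> A = emeasure M (G \<inter> {\<omega> \<in> space M. (Z (Suc n) \<omega>, \<tau> (Suc n) \<omega>) \<in> A})"
    if [measurable]: "A \<in> sets SA" for A
  proof -
    have "emeasure \<mu> A = emeasure N {\<omega> \<in> space M. (Z (Suc n) \<omega>, \<tau> (Suc n) \<omega>) \<in> A}"
      unfolding \<mu>_def by (subst emeasure_distr) (auto simp: vimage_def Int_def conj_commute)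
    then show ?thesis
      unfolding N_def by (simp add: emeasure_density indicator_inter_arith[symmetric])
  qed
  have e\<nu>: "emeasure \<nu> A = (\<integral>\<^sup>+\<omega>. indicator G \<omega> * emeasure (Q (Z n \<omega>)) A \<partial>M)"
    if [measurable]: "A \<in> sets SA" for A
  proof -
    have "emeasure \<nu> A = (\<integral>\<^sup>+\<omega>. emeasure (Q (Z n \<omega>)) A \<partial>N)"
      unfolding \<nu>_def by (rule emeasure_bind[where N = SA]) (auto simp: not_empty)
    then show ?thesis
      unfolding N_def by (subst (asm) nn_integral_density) auto
  qed
  have "\<mu> = \<nu>"
  proof (rule measure_eqI_rectangles[of _ S borel])
    show "sets \<nu> = sets SA"
      unfolding \<nu>_def by (rule sets_bind) (auto simp: Q_sets measurable_space[OF Z_measurable] not_empty)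
    show "finite_measure \<mu>"
      by (rule finite_measureI)
         (use emeasure_finite e\<mu>[of "space SA"] in \<open>simp add: \<mu>_def\<close>)
  next
    fix a b assume *: "a \<in> sets S" "b \<in> sets (borel :: real measure)"
    then show "emeasure \<mu> (a \<times> b) = emeasure \<nu> (a \<times> b)"
      using kernel_step_rect[OF assms(1) *] by (simp add: e\<mu> e\<nu>)
  qed (simp add: \<mu>_def)
  then show ?thesis using e\<mu>[of Y] e\<nu>[of Y] by simp
qed

text \<open>Later integrands couple the past with the next waiting time, as in
  \<open>T n \<omega> + snd y \<le> r\<close>. The joint law of the sample point, seen through
  \<open>F n\<close>, and the next pair is the mixture of the kernels \<open>K\<close>, again by
  comparison on rectangles.\<close>

lemma kernel_step:
  assumes h: "h \<in> borel_measurable (F n \<Otimes>\<^sub>M SA)"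
  shows "(\<integral>\<^sup>+\<omega>. h (\<omega>, (Z (Suc n) \<omega>, \<tau> (Suc n) \<omega>)) \<partial>M) = (\<integral>\<^sup>+\<omega>. \<integral>\<^sup>+y. h (\<omega>, y) \<partial>Q (Z n \<omega>) \<partial>M)"
proof -
  have [measurable]: "id \<in> measurable M (F n)"
    by (rule F_M[of _ n]) simp
  then have [measurable]: "(\<lambda>\<omega>. \<omega>) \<in> measurable M (F n)"
    by (simp add: id_def)
  define \<mu> where "\<mu> = distr M (F n \<Otimes>\<^sub>M SA) (\<lambda>\<omega>. (\<omega>, (Z (Suc n) \<omega>, \<tau> (Suc n) \<omega>)))"
  define K where "K = (\<lambda>\<omega>. distr (Q (Z n \<omega>)) (F n \<Otimes>\<^sub>M SA) (Pair \<omega>))"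
  have [measurable]: "(\<lambda>x. x) \<in> measurable (M \<Otimes>\<^sub>M SA) (F n \<Otimes>\<^sub>M SA)"
  proof -
    have "(\<lambda>x. (fst x, snd x)) \<in> measurable (M \<Otimes>\<^sub>M SA) (F n \<Otimes>\<^sub>M SA)"
      by (intro measurable_Pair measurable_compose[OF measurable_fst \<open>(\<lambda>\<omega>. \<omega>) \<in> measurable M (F n)\<close>] measurable_snd)
    then show ?thesis by simp
  qed
  have K [measurable]: "K \<in> measurable M (subprob_algebra (F n \<Otimes>\<^sub>M SA))"
    unfolding K_def
    by (rule measurable_distr2[where M = SA]) (simp_all add: split_beta')
  have Pair_m: "Pair \<omega> \<in> measurable (Q (Z n \<omega>)) (F n \<Otimes>\<^sub>M SA)" if "\<omega> \<in> space M" for \<omega>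
    using that measurable_space[OF Z_measurable that]
    by (subst measurable_cong_sets[OF Q_sets refl]) auto
  have "\<mu> = bind M K"
  proof (rule measure_eqI_rectangles[of _ "F n" SA])
    show "sets (M \<bind> K) = sets (F n \<Otimes>\<^sub>M SA)"
      by (rule sets_bind) (auto simp: K_def not_empty)
    show "finite_measure \<mu>"
      unfolding \<mu>_def by (intro finite_measure_distr) measurable
  next
    fix a b assume a: "a \<in> sets (F n)" and b [measurable]: "b \<in> sets SA"
    have ab: "a \<times> b \<in> sets (F n \<Otimes>\<^sub>M SA)" using a b by simp
    have aM: "a \<subseteq> space M" using sets.sets_into_space[OF a] by simp
    have "emeasure \<mu> (a \<times> b) = emeasure M (a \<inter> {\<omega> \<in> space M. (Z (Suc n) \<omega>, \<tau> (Suc n) \<omega>) \<in> b})"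
      unfolding \<mu>_def using ab aM
      by (subst emeasure_distr) (auto intro!: arg_cong[where f = "emeasure M"])
    also have "\<dots> = (\<integral>\<^sup>+\<omega>. indicator a \<omega> * emeasure (Q (Z n \<omega>)) b \<partial>M)"
      by (rule kernel_step_set[OF a b])
    also have "\<dots> = (\<integral>\<^sup>+\<omega>. emeasure (K \<omega>) (a \<times> b) \<partial>M)"
    proof (rule nn_integral_cong)
      fix \<omega> assume \<omega>: "\<omega> \<in> space M"
      have z: "Z n \<omega> \<in> space S" using measurable_space[OF Z_measurable \<omega>] .
      have "Pair \<omega> -` (a \<times> b) \<inter> space (Q (Z n \<omega>)) = (if \<omega> \<in> a then b else {})"
        using sets.sets_into_space[OF b] sets_eq_imp_space_eq[OF Q_sets[OF z]] by auto
      then show "indicator a \<omega> * emeasure (Q (Z n \<omega>)) b = emeasure (K \<omega>) (a \<times> b)"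
        unfolding K_def by (subst emeasure_distr[OF Pair_m[OF \<omega>] ab]) simp
    qed
    also have "\<dots> = emeasure (M \<bind> K) (a \<times> b)"
      by (rule emeasure_bind[symmetric, OF _ K ab]) (simp add: not_empty)
    finally show "emeasure \<mu> (a \<times> b) = emeasure (M \<bind> K) (a \<times> b)" .
  qed (simp add: \<mu>_def)
  then have "(\<integral>\<^sup>+x. h x \<partial>\<mu>) = (\<integral>\<^sup>+\<omega>. \<integral>\<^sup>+x. h x \<partial>K \<omega> \<partial>M)"
    using nn_integral_bind[OF h K] by simp
  moreover have "(\<integral>\<^sup>+x. h x \<partial>\<mu>) = (\<integral>\<^sup>+\<omega>. h (\<omega>, (Z (Suc n) \<omega>, \<tau> (Suc n) \<omega>)) \<partial>M)"
    unfolding \<mu>_def by (rule nn_integral_distr) (use h in simp_all)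
  moreover have "(\<integral>\<^sup>+\<omega>. \<integral>\<^sup>+x. h x \<partial>K \<omega> \<partial>M) = (\<integral>\<^sup>+\<omega>. \<integral>\<^sup>+y. h (\<omega>, y) \<partial>Q (Z n \<omega>) \<partial>M)"
    unfolding K_def by (intro nn_integral_cong nn_integral_distr Pair_m) (use h in simp_all)
  ultimately show ?thesis by simp
qed

end

section \<open>The Markov property of state and age\<close>

context markov_renewal_process
begin

text \<open>The random time \<open>\<sigma>\<close> lets the induction restart at the next epoch.\<close>

lemma jump_expectation:
  assumes \<phi> [measurable]: "\<phi> \<in> borel_measurable SA"
    and H: "H \<in> borel_measurable (F n)" and \<sigma>: "\<sigma> \<in> borel_measurable (F n)"
  shows "(\<integral>\<^sup>+\<omega>. H \<omega> * of_bool (T n \<omega> \<le> \<sigma> \<omega> \<and> \<sigma> \<omega> \<le> r \<and> \<sigma> \<omega> < T (Suc n) \<omega> \<and>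
             T (n + k) \<omega> \<le> r \<and> r < T (Suc (n + k)) \<omega>) * \<phi> (Z (n + k) \<omega>, r - T (n + k) \<omega>) \<partial>M) =
         (\<integral>\<^sup>+\<omega>. H \<omega> * of_bool (T n \<omega> \<le> \<sigma> \<omega> \<and> \<sigma> \<omega> \<le> r) *
             jump_op k \<phi> (r - \<sigma> \<omega>) (Z n \<omega>) (\<sigma> \<omega> - T n \<omega>) \<partial>M)"
  using H \<sigma>
proof (induction k arbitrary: n H \<sigma>)
  case 0
  note [measurable] = 0 Z_measurable_F[OF order_refl, of n] T_measurable_F[OF order_refl, of n]
  define h where "h = (\<lambda>(\<omega>, y::'z \<times> real). H \<omega> * of_bool (T n \<omega> \<le> \<sigma> \<omega> \<and> \<sigma> \<omega> \<le> r) *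
      \<phi> (Z n \<omega>, r - T n \<omega>) * of_bool (r - T n \<omega> < snd y))"
  have [measurable]: "h \<in> borel_measurable (F n \<Otimes>\<^sub>M SA)"
    unfolding h_def split_beta' by measurable
  have "(\<integral>\<^sup>+\<omega>. H \<omega> * of_bool (T n \<omega> \<le> \<sigma> \<omega> \<and> \<sigma> \<omega> \<le> r \<and> \<sigma> \<omega> < T (Suc n) \<omega> \<and>
             T (n + 0) \<omega> \<le> r \<and> r < T (Suc (n + 0)) \<omega>) * \<phi> (Z (n + 0) \<omega>, r - T (n + 0) \<omega>) \<partial>M) =
     (\<integral>\<^sup>+\<omega>. h (\<omega>, (Z (Suc n) \<omega>, \<tau> (Suc n) \<omega>)) \<partial>M)"
    by (intro nn_integral_cong) (auto simp: h_def T_Suc mult.assoc)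
  also have "\<dots> = (\<integral>\<^sup>+\<omega>. \<integral>\<^sup>+y. h (\<omega>, y) \<partial>Q (Z n \<omega>) \<partial>M)"
    by (rule kernel_step) measurable
  also have "\<dots> = (\<integral>\<^sup>+\<omega>. H \<omega> * of_bool (T n \<omega> \<le> \<sigma> \<omega> \<and> \<sigma> \<omega> \<le> r) *
             jump_op 0 \<phi> (r - \<sigma> \<omega>) (Z n \<omega>) (\<sigma> \<omega> - T n \<omega>) \<partial>M)"
  proof (rule nn_integral_cong)
    fix \<omega> assume "\<omega> \<in> space M"
    then have z: "Z n \<omega> \<in> space S" using measurable_space[OF Z_measurable] by auto
    have "(\<integral>\<^sup>+y. of_bool (r - T n \<omega> < snd y) \<partial>Q (Z n \<omega>)) = surv (Z n \<omega>) (r - T n \<omega>)"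
      unfolding surv_nn_integral[OF z] by (intro nn_integral_cong) (auto simp: indicator_def)
    then show "(\<integral>\<^sup>+y. h (\<omega>, y) \<partial>Q (Z n \<omega>)) = H \<omega> * of_bool (T n \<omega> \<le> \<sigma> \<omega> \<and> \<sigma> \<omega> \<le> r) *
             jump_op 0 \<phi> (r - \<sigma> \<omega>) (Z n \<omega>) (\<sigma> \<omega> - T n \<omega>)"
      unfolding h_def prod.case
      by (subst nn_integral_cmult[OF Q_borel_measurable[OF z]]) (simp_all add: mult.assoc)
  qed
  finally show ?case .
next
  case (Suc k)
  note m [measurable] = Suc.prems Z_measurable_F[OF order_refl, of n] T_measurable_F[OF order_refl, of n]
    T_measurable_F[OF order_refl, of "Suc n"]
  \<comment> \<open>Everything known at the next epoch, including that it lies beyond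
    \<open>\<sigma>\<close>, goes into the new weight; the induction hypothesis then starts at
    \<open>T (Suc n)\<close> with age 0.\<close>
  define H' where "H' = (\<lambda>\<omega>. H \<omega> * of_bool (T n \<omega> \<le> \<sigma> \<omega> \<and> \<sigma> \<omega> \<le> r \<and> \<sigma> \<omega> < T (Suc n) \<omega>))"
  have H' [measurable]: "H' \<in> borel_measurable (F (Suc n))"
  proof -
    note [measurable] = m(1-4)[THEN F_Suc]
    show ?thesis unfolding H'_def by measurable
  qed
  define h where "h = (\<lambda>(\<omega>, y). H \<omega> * of_bool (T n \<omega> \<le> \<sigma> \<omega> \<and> \<sigma> \<omega> \<le> r) *
      (of_bool (\<sigma> \<omega> < T n \<omega> + snd y \<and> T n \<omega> + snd y \<le> r) * jump_op k \<phi> (r - (T n \<omega> + snd y)) (fst y) 0))"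
  have [measurable]: "h \<in> borel_measurable (F n \<Otimes>\<^sub>M SA)"
    unfolding h_def split_beta' by measurable
  have "(\<integral>\<^sup>+\<omega>. H \<omega> * of_bool (T n \<omega> \<le> \<sigma> \<omega> \<and> \<sigma> \<omega> \<le> r \<and> \<sigma> \<omega> < T (Suc n) \<omega> \<and>
             T (n + Suc k) \<omega> \<le> r \<and> r < T (Suc (n + Suc k)) \<omega>) * \<phi> (Z (n + Suc k) \<omega>, r - T (n + Suc k) \<omega>) \<partial>M) =
    (\<integral>\<^sup>+\<omega>. H' \<omega> * of_bool (T (Suc n) \<omega> \<le> T (Suc n) \<omega> \<and> T (Suc n) \<omega> \<le> r \<and> T (Suc n) \<omega> < T (Suc (Suc n)) \<omega> \<and>
             T (Suc n + k) \<omega> \<le> r \<and> r < T (Suc (Suc n + k)) \<omega>) * \<phi> (Z (Suc n + k) \<omega>, r - T (Suc n + k) \<omega>) \<partial>M)"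
  proof (rule nn_integral_cong)
    fix \<omega> assume \<omega>: "\<omega> \<in> space M"
    have "T (Suc n) \<omega> \<le> r" if "T (Suc (n + k)) \<omega> \<le> r"
      using T_mono[OF \<omega>, of "Suc n" "Suc (n + k)"] that by simp
    then show "H \<omega> * of_bool (T n \<omega> \<le> \<sigma> \<omega> \<and> \<sigma> \<omega> \<le> r \<and> \<sigma> \<omega> < T (Suc n) \<omega> \<and>
             T (n + Suc k) \<omega> \<le> r \<and> r < T (Suc (n + Suc k)) \<omega>) * \<phi> (Z (n + Suc k) \<omega>, r - T (n + Suc k) \<omega>) =
       H' \<omega> * of_bool (T (Suc n) \<omega> \<le> T (Suc n) \<omega> \<and> T (Suc n) \<omega> \<le> r \<and> T (Suc n) \<omega> < T (Suc (Suc n)) \<omega> \<and>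
             T (Suc n + k) \<omega> \<le> r \<and> r < T (Suc (Suc n + k)) \<omega>) * \<phi> (Z (Suc n + k) \<omega>, r - T (Suc n + k) \<omega>)"
      using T_less[OF \<omega>, of "Suc n"] by (auto simp: H'_def)
  qed
  also have "\<dots> = (\<integral>\<^sup>+\<omega>. H' \<omega> * of_bool (T (Suc n) \<omega> \<le> T (Suc n) \<omega> \<and> T (Suc n) \<omega> \<le> r) *
             jump_op k \<phi> (r - T (Suc n) \<omega>) (Z (Suc n) \<omega>) (T (Suc n) \<omega> - T (Suc n) \<omega>) \<partial>M)"
    by (rule Suc.IH) (simp_all add: H' m(5))
  also have "\<dots> = (\<integral>\<^sup>+\<omega>. h (\<omega>, (Z (Suc n) \<omega>, \<tau> (Suc n) \<omega>)) \<partial>M)"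
    by (intro nn_integral_cong) (auto simp: h_def H'_def T_Suc)
  also have "\<dots> = (\<integral>\<^sup>+\<omega>. \<integral>\<^sup>+y. h (\<omega>, y) \<partial>Q (Z n \<omega>) \<partial>M)"
    by (rule kernel_step) measurable
  also have "\<dots> = (\<integral>\<^sup>+\<omega>. H \<omega> * of_bool (T n \<omega> \<le> \<sigma> \<omega> \<and> \<sigma> \<omega> \<le> r) *
             jump_op (Suc k) \<phi> (r - \<sigma> \<omega>) (Z n \<omega>) (\<sigma> \<omega> - T n \<omega>) \<partial>M)"
  proof (rule nn_integral_cong)
    fix \<omega> assume "\<omega> \<in> space M"
    then have z: "Z n \<omega> \<in> space S" using measurable_space[OF Z_measurable] by auto
    have meas: "(\<lambda>y. of_bool (\<sigma> \<omega> < T n \<omega> + snd y \<and> T n \<omega> + snd y \<le> r) *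
        jump_op k \<phi> (r - (T n \<omega> + snd y)) (fst y) 0) \<in> borel_measurable (Q (Z n \<omega>))"
      by (rule Q_borel_measurable[OF z]) measurable
    have eq: "(\<integral>\<^sup>+y. of_bool (\<sigma> \<omega> < T n \<omega> + snd y \<and> T n \<omega> + snd y \<le> r) *
        jump_op k \<phi> (r - (T n \<omega> + snd y)) (fst y) 0 \<partial>Q (Z n \<omega>)) =
       jump_op (Suc k) \<phi> (r - \<sigma> \<omega>) (Z n \<omega>) (\<sigma> \<omega> - T n \<omega>)"
      unfolding jump_op.simps split_beta'
    proof (rule nn_integral_cong)
      fix y :: "'z \<times> real"
      have "r - (T n \<omega> + snd y) = \<sigma> \<omega> - T n \<omega> + (r - \<sigma> \<omega>) - snd y" by simp
      moreover have "of_bool (\<sigma> \<omega> < T n \<omega> + snd y \<and> T n \<omega> + snd y \<le> r) =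
          (indicator {\<sigma> \<omega> - T n \<omega><..\<sigma> \<omega> - T n \<omega> + (r - \<sigma> \<omega>)} (snd y) :: ennreal)"
        by (auto simp: indicator_def)
      ultimately show "of_bool (\<sigma> \<omega> < T n \<omega> + snd y \<and> T n \<omega> + snd y \<le> r) *
          jump_op k \<phi> (r - (T n \<omega> + snd y)) (fst y) 0 =
         indicator {\<sigma> \<omega> - T n \<omega><..\<sigma> \<omega> - T n \<omega> + (r - \<sigma> \<omega>)} (snd y) *
          jump_op k \<phi> (\<sigma> \<omega> - T n \<omega> + (r - \<sigma> \<omega>) - snd y) (fst y) 0"
        by (simp only:)
    qed
    show "(\<integral>\<^sup>+y. h (\<omega>, y) \<partial>Q (Z n \<omega>)) = H \<omega> * of_bool (T n \<omega> \<le> \<sigma> \<omega> \<and> \<sigma> \<omega> \<le> r) *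
             jump_op (Suc k) \<phi> (r - \<sigma> \<omega>) (Z n \<omega>) (\<sigma> \<omega> - T n \<omega>)"
      unfolding h_def prod.case nn_integral_cmult[OF meas] eq ..
  qed
  finally show ?case .
qed

section \<open>The state read off from the epochs\<close>

abbreviation X :: "real \<Rightarrow> 'w \<Rightarrow> 'z \<times> real" where
  "X \<equiv> calendar_age Z \<tau>"

lemma event_count_eq:
  assumes "\<omega> \<in> space M" "T m \<omega> \<le> u" "u < T (Suc m) \<omega>"
  shows "event_count \<tau> u \<omega> = m"
proof -
  have "{n. T n \<omega> \<le> u} = {..m}"
  proof (intro antisym subsetI; clarsimp)
    fix n assume n: "T n \<omega> \<le> u"
    show "n \<le> m"
    proof (rule ccontr)
      assume "\<not> n \<le> m"
      then have "T (Suc m) \<omega> \<le> T n \<omega>" by (intro T_mono assms) simp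
      then show False using n assms(3) by simp
    qed
  next
    fix n assume "n \<le> m"
    then show "T n \<omega> \<le> u" using T_mono[OF assms(1), of n m] assms(2) by simp
  qed
  then have "event_count \<tau> u \<omega> = Max {..m}" by (simp only: event_count_def)
  also have "\<dots> = m" by (rule Max_eqI) simp_all
  finally show ?thesis .
qed

lemma X_eq:
  assumes "\<omega> \<in> space M" "T m \<omega> \<le> u" "u < T (Suc m) \<omega>"
  shows "X u \<omega> = (Z m \<omega>, u - T m \<omega>)" "calendar Z \<tau> u \<omega> = Z m \<omega>"
  using event_count_eq[OF assms] by (simp_all add: calendar_age_def calendar_def age_def)

lemma ex_epoch:
  assumes "0 \<le> u" "u < T n \<omega>"
  shows "\<exists>m<n. T m \<omega> \<le> u \<and> u < T (Suc m) \<omega>"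
  using assms
proof (induction n)
  case (Suc n)
  then show ?case by (cases "u < T n \<omega>") (auto intro: less_SucI)
qed simp

lemma epoch_cases:
  assumes "0 \<le> u"
  obtains m where "T m \<omega> \<le> u" "u < T (Suc m) \<omega>" | "\<forall>n. T n \<omega> \<le> u"
  using ex_epoch[OF assms] by (meson not_le)

lemma event_count_measurable [measurable]:
  assumes "0 \<le> u"
  shows "event_count \<tau> u \<in> measurable M (count_space UNIV)"
proof (subst measurable_count_space_eq2_countable, safe)
  fix m :: nat
  \<comment> \<open>On a path whose epochs never exceed \<open>u\<close>, the count is the
    unspecified \<open>Max UNIV\<close>. Measurability concerns every sample point, so the level set
    of that one value gains all such paths.\<close>
  have "event_count \<tau> u \<omega> = m \<longleftrightarrow> T m \<omega> \<le> u \<and> u < T (Suc m) \<omega> \<or> (\<forall>n. T n \<omega> \<le> u) \<and> m = Max UNIV"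
    if "\<omega> \<in> space M" for \<omega>
  proof (cases rule: epoch_cases[OF assms, of \<omega>])
    case (1 l)
    then show ?thesis using that event_count_eq[OF that] by (metis not_le)
  next
    case 2
    then have "{n. T n \<omega> \<le> u} = UNIV" by simp
    then have "event_count \<tau> u \<omega> = Max UNIV" by (simp only: event_count_def)
    moreover have "\<not> u < T (Suc m) \<omega>" using 2 by (simp only: not_less)
    ultimately show ?thesis using 2 by metis
  qed
  then have "event_count \<tau> u -` {m} \<inter> space M =
      {\<omega> \<in> space M. T m \<omega> \<le> u \<and> u < T (Suc m) \<omega> \<or> (\<forall>n. T n \<omega> \<le> u) \<and> m = Max UNIV}"
    by auto
  also have "\<dots> \<in> sets M" by measurable
  finally show "event_count \<tau> u -` {m} \<inter> space M \<in> sets M" .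
qed simp_all

lemma calendar_measurable [measurable]:
  assumes "0 \<le> u" shows "calendar Z \<tau> u \<in> measurable M S"
  unfolding calendar_def
  by (rule measurable_compose_countable[OF Z_measurable event_count_measurable[OF assms]])

lemma age_measurable [measurable]:
  assumes "0 \<le> u" shows "age \<tau> u \<in> borel_measurable M"
proof -
  have "(\<lambda>\<omega>. T (event_count \<tau> u \<omega>) \<omega>) \<in> borel_measurable M"
    by (rule measurable_compose_countable[OF T_measurable event_count_measurable[OF assms]])
  then show ?thesis unfolding age_def by measurable
qed

lemma X_measurable [measurable]: "0 \<le> u \<Longrightarrow> X u \<in> measurable M SA"
  unfolding calendar_age_def by measurable

lemma AE_epoch:
  assumes "0 \<le> u"
  shows "AE \<omega> in M. \<exists>m. T m \<omega> \<le> u \<and> u < T (Suc m) \<omega>"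
  using ne unfolding non_explosive_def
proof (rule AE_mp, intro AE_I2 impI)
  fix \<omega> assume "filterlim (\<lambda>n. T n \<omega>) at_top sequentially"
  then obtain n where "u < T n \<omega>"
    by (auto simp: filterlim_at_top_dense eventually_sequentially)
  then show "\<exists>m. T m \<omega> \<le> u \<and> u < T (Suc m) \<omega>"
    using ex_epoch[OF assms] by blast
qed

text \<open>At a time \<open>u \<le> s < T (Suc n) \<omega>\<close> the current event has index at
  most \<open>n\<close>, so its state and epoch are known from the first \<open>n\<close> events.
  Agreement with a set of \<open>F n\<close> on this event passes to complements and countable
  unions, which leaves the generators.\<close>

lemma history_before_event:
  assumes "G \<in> sets (generated M SA {0..s} X)"
  shows "\<exists>G'\<in>sets (F n). \<forall>\<omega>\<in>space M. T n \<omega> \<le> s \<and> s < T (Suc n) \<omega> \<longrightarrow> (\<omega> \<in> G \<longleftrightarrow> \<omega> \<in> G')"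
  using assms unfolding sets_generated
proof (induction rule: sigma_sets.induct)
  case (Basic G)
  then obtain u A where G: "G = X u -` A \<inter> space M" and u: "0 \<le> u" "u \<le> s" and A [measurable]: "A \<in> sets SA"
    by auto
  \<comment> \<open>The set for \<open>m\<close> says that event \<open>m\<close> is the current one
    at time \<open>u\<close>. For \<open>m = n\<close> the condition
    \<open>u < T (Suc n) \<omega>\<close> is left out: it is not visible in \<open>F n\<close>, but
    it follows from \<open>u \<le> s\<close> on the event considered.\<close>
  define G' where "G' = (\<Union>m\<in>{..n}. {\<omega> \<in> space M. T m \<omega> \<le> u \<and> (Z m \<omega>, u - T m \<omega>) \<in> A} -
      (if m < n then {\<omega> \<in> space M. T (Suc m) \<omega> \<le> u} else {}))"
  have "G' \<in> sets (F n)"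
    unfolding G'_def
  proof (intro sets.finite_UN sets.Diff)
    fix m assume "m \<in> {..n}"
    then have [measurable]: "Z m \<in> measurable (F n) S" "T m \<in> borel_measurable (F n)"
      by auto
    have "{\<omega> \<in> space (F n). T m \<omega> \<le> u \<and> (Z m \<omega>, u - T m \<omega>) \<in> A} \<in> sets (F n)"
      by measurable
    then show "{\<omega> \<in> space M. T m \<omega> \<le> u \<and> (Z m \<omega>, u - T m \<omega>) \<in> A} \<in> sets (F n)" by simp
    have "{\<omega> \<in> space (F n). T (Suc m) \<omega> \<le> u} \<in> sets (F n)" if "m < n"
    proof -
      have [measurable]: "T (Suc m) \<in> borel_measurable (F n)" using that by auto
      show ?thesis by measurable
    qed
    then show "(if m < n then {\<omega> \<in> space M. T (Suc m) \<omega> \<le> u} else {}) \<in> sets (F n)" by simp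
  qed simp
  moreover have "\<omega> \<in> G \<longleftrightarrow> \<omega> \<in> G'" if \<omega>: "\<omega> \<in> space M" and n: "T n \<omega> \<le> s" "s < T (Suc n) \<omega>" for \<omega>
  proof -
    have "u < T (Suc n) \<omega>" using u n by simp
    then obtain m where "m < Suc n" and m': "T m \<omega> \<le> u" "u < T (Suc m) \<omega>"
      using ex_epoch[OF u(1)] by blast
    then have m: "m \<le> n" "T m \<omega> \<le> u" "u < T (Suc m) \<omega>" by auto
    have unique: "m' = m" if "m' \<le> n" "T m' \<omega> \<le> u" "m' < n \<longrightarrow> u < T (Suc m') \<omega>" for m'
    proof -
      have "u < T (Suc m') \<omega>" using that \<open>u < T (Suc n) \<omega>\<close> by (cases "m' = n") auto
      then show ?thesis using event_count_eq[OF \<omega> that(2)] event_count_eq[OF \<omega> m(2,3)] by simp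
    qed
    have "\<omega> \<in> G' \<longleftrightarrow> (\<exists>m'\<le>n. T m' \<omega> \<le> u \<and> (Z m' \<omega>, u - T m' \<omega>) \<in> A \<and> (m' < n \<longrightarrow> u < T (Suc m') \<omega>))"
    proof -
      have "\<omega> \<in> (if m' < n then {\<omega> \<in> space M. T (Suc m') \<omega> \<le> u} else {}) \<longleftrightarrow> \<not> (m' < n \<longrightarrow> u < T (Suc m') \<omega>)" for m'
        using \<omega> by (simp add: not_less)
      then show ?thesis
        using \<omega> unfolding G'_def UN_iff Diff_iff mem_Collect_eq atMost_iff Bex_def by blast
    qed
    also have "\<dots> \<longleftrightarrow> (Z m \<omega>, u - T m \<omega>) \<in> A"
    proof
      assume "\<exists>m'\<le>n. T m' \<omega> \<le> u \<and> (Z m' \<omega>, u - T m' \<omega>) \<in> A \<and> (m' < n \<longrightarrow> u < T (Suc m') \<omega>)"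
      then obtain m' where "m' \<le> n" "T m' \<omega> \<le> u" "(Z m' \<omega>, u - T m' \<omega>) \<in> A" "m' < n \<longrightarrow> u < T (Suc m') \<omega>"
        by blast
      then show "(Z m \<omega>, u - T m \<omega>) \<in> A" using unique[of m'] by simp
    next
      assume "(Z m \<omega>, u - T m \<omega>) \<in> A"
      then show "\<exists>m'\<le>n. T m' \<omega> \<le> u \<and> (Z m' \<omega>, u - T m' \<omega>) \<in> A \<and> (m' < n \<longrightarrow> u < T (Suc m') \<omega>)"
        using m by blast
    qed
    finally have "\<omega> \<in> G' \<longleftrightarrow> (Z m \<omega>, u - T m \<omega>) \<in> A" .
    then show ?thesis using X_eq[OF \<omega> m(2,3)] \<omega> by (simp add: G)
  qed
  ultimately show ?case by blast
next
  case Empty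
  show ?case by (intro bexI[of _ "{}"]) auto
next
  case (Compl G)
  then obtain G' where "G' \<in> sets (F n)" "\<forall>\<omega>\<in>space M. T n \<omega> \<le> s \<and> s < T (Suc n) \<omega> \<longrightarrow> (\<omega> \<in> G \<longleftrightarrow> \<omega> \<in> G')"
    by blast
  moreover have "space M - G' \<in> sets (F n)"
    using sets.compl_sets[OF calculation(1)] by simp
  ultimately show ?case by (intro bexI[of _ "space M - G'"]) auto
next
  case (Union G)
  have "\<forall>i. \<exists>G'. G' \<in> sets (F n) \<and> (\<forall>\<omega>\<in>space M. T n \<omega> \<le> s \<and> s < T (Suc n) \<omega> \<longrightarrow> (\<omega> \<in> G i \<longleftrightarrow> \<omega> \<in> G'))"
    using Union.IH by blast
  from choice[OF this] obtain G' where G': "\<forall>i. G' i \<in> sets (F n) \<and>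
      (\<forall>\<omega>\<in>space M. T n \<omega> \<le> s \<and> s < T (Suc n) \<omega> \<longrightarrow> (\<omega> \<in> G i \<longleftrightarrow> \<omega> \<in> G' i))"
    by blast
  show ?case
  proof (intro bexI ballI impI)
    show "(\<Union>i. G' i) \<in> sets (F n)" using G' by auto
    fix \<omega> assume "\<omega> \<in> space M" "T n \<omega> \<le> s \<and> s < T (Suc n) \<omega>"
    then show "\<omega> \<in> (\<Union>i. G i) \<longleftrightarrow> \<omega> \<in> (\<Union>i. G' i)" using G' by blast
  qed
qed

section \<open>The Markov identity at a fixed time\<close>

lemma suminf_of_bool_epoch:
  assumes "\<omega> \<in> space M" "T m \<omega> \<le> u" "u < T (Suc m) \<omega>"
  shows "(\<Sum>n. of_bool (T n \<omega> \<le> u \<and> u < T (Suc n) \<omega>) * c n) = (c m :: ennreal)"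
proof -
  have "n = m" if "T n \<omega> \<le> u \<and> u < T (Suc n) \<omega>" for n
    using event_count_eq[OF assms] event_count_eq[OF assms(1), of n u] that by simp
  then have "(\<Sum>n. of_bool (T n \<omega> \<le> u \<and> u < T (Suc n) \<omega>) * c n) = (\<Sum>n\<in>{m}. of_bool (T n \<omega> \<le> u \<and> u < T (Suc n) \<omega>) * c n)"
    by (intro suminf_finite) (auto simp del: ennreal_suminf_multc)
  then show ?thesis using assms by simp
qed

text \<open>Both sides are instances of \<open>jump_expectation\<close> started at the fixed time
  \<open>s\<close>: the left with \<open>k\<close> jumps for \<open>\<phi>\<close>, the right with
  no jump over no time for \<open>jump_exp k \<phi> t\<close>. The second produces a factor
  \<open>surv\<close>, exactly the divisor in \<open>jump_exp\<close>.\<close>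

lemma markov_nn_integral_event:
  assumes s: "0 \<le> s" and t: "0 \<le> t" and [measurable]: "\<phi> \<in> borel_measurable SA"
    and G: "G \<in> sets (generated M SA {0..s} X)"
  shows "(\<integral>\<^sup>+\<omega>. of_bool (T n \<omega> \<le> s \<and> s < T (Suc n) \<omega>) * of_bool (T (n + k) \<omega> \<le> s + t \<and> s + t < T (Suc (n + k)) \<omega>) *
           (indicator G \<omega> * \<phi> (X (s + t) \<omega>)) \<partial>M) =
         (\<integral>\<^sup>+\<omega>. of_bool (T n \<omega> \<le> s \<and> s < T (Suc n) \<omega>) * (indicator G \<omega> * jump_exp k \<phi> t (X s \<omega>)) \<partial>M)"
proof -
  obtain G' where G': "G' \<in> sets (F n)"
    "\<And>\<omega>. \<omega> \<in> space M \<Longrightarrow> T n \<omega> \<le> s \<Longrightarrow> s < T (Suc n) \<omega> \<Longrightarrow> \<omega> \<in> G \<longleftrightarrow> \<omega> \<in> G'"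
    using history_before_event[OF G, of n] by blast
  have H: "(indicator G' :: _ \<Rightarrow> ennreal) \<in> borel_measurable (F n)"
    using G'(1) by simp
  have "(\<integral>\<^sup>+\<omega>. of_bool (T n \<omega> \<le> s \<and> s < T (Suc n) \<omega>) * of_bool (T (n + k) \<omega> \<le> s + t \<and> s + t < T (Suc (n + k)) \<omega>) *
           (indicator G \<omega> * \<phi> (X (s + t) \<omega>)) \<partial>M) =
    (\<integral>\<^sup>+\<omega>. indicator G' \<omega> * of_bool (T n \<omega> \<le> s \<and> s \<le> s + t \<and> s < T (Suc n) \<omega> \<and>
             T (n + k) \<omega> \<le> s + t \<and> s + t < T (Suc (n + k)) \<omega>) * \<phi> (Z (n + k) \<omega>, s + t - T (n + k) \<omega>) \<partial>M)"
  proof (rule nn_integral_cong)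
    fix \<omega> assume \<omega>: "\<omega> \<in> space M"
    show "of_bool (T n \<omega> \<le> s \<and> s < T (Suc n) \<omega>) * of_bool (T (n + k) \<omega> \<le> s + t \<and> s + t < T (Suc (n + k)) \<omega>) *
           (indicator G \<omega> * \<phi> (X (s + t) \<omega>)) =
      indicator G' \<omega> * of_bool (T n \<omega> \<le> s \<and> s \<le> s + t \<and> s < T (Suc n) \<omega> \<and>
             T (n + k) \<omega> \<le> s + t \<and> s + t < T (Suc (n + k)) \<omega>) * \<phi> (Z (n + k) \<omega>, s + t - T (n + k) \<omega>)"
      using X_eq(1)[OF \<omega>, of "n + k" "s + t"] G'(2)[OF \<omega>] t by (auto simp: indicator_def)
  qed
  also have "\<dots> = (\<integral>\<^sup>+\<omega>. indicator G' \<omega> * of_bool (T n \<omega> \<le> s \<and> s \<le> s + t) *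
       jump_op k \<phi> (s + t - s) (Z n \<omega>) (s - T n \<omega>) \<partial>M)"
    using jump_expectation[OF _ H, of \<phi> "\<lambda>_. s" "s + t" k] by simp
  also have "\<dots> = (\<integral>\<^sup>+\<omega>. indicator G' \<omega> * of_bool (T n \<omega> \<le> s \<and> s \<le> s) *
       jump_op 0 (jump_exp k \<phi> t) (s - s) (Z n \<omega>) (s - T n \<omega>) \<partial>M)"
  proof (rule nn_integral_cong)
    fix \<omega> assume "\<omega> \<in> space M"
    then have z: "Z n \<omega> \<in> space S" using measurable_space[OF Z_measurable] by auto
    show "indicator G' \<omega> * of_bool (T n \<omega> \<le> s \<and> s \<le> s + t) * jump_op k \<phi> (s + t - s) (Z n \<omega>) (s - T n \<omega>) =
      indicator G' \<omega> * of_bool (T n \<omega> \<le> s \<and> s \<le> s) * jump_op 0 (jump_exp k \<phi> t) (s - s) (Z n \<omega>) (s - T n \<omega>)"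
      using jump_exp_surv[OF z t, of k \<phi> "s - T n \<omega>"] t by simp
  qed
  also have "\<dots> = (\<integral>\<^sup>+\<omega>. indicator G' \<omega> * of_bool (T n \<omega> \<le> s \<and> s \<le> s \<and> s < T (Suc n) \<omega> \<and>
             T (n + 0) \<omega> \<le> s \<and> s < T (Suc (n + 0)) \<omega>) * jump_exp k \<phi> t (Z (n + 0) \<omega>, s - T (n + 0) \<omega>) \<partial>M)"
    using jump_expectation[OF _ H, of "jump_exp k \<phi> t" "\<lambda>_. s" s 0] by simp
  also have "\<dots> = (\<integral>\<^sup>+\<omega>. of_bool (T n \<omega> \<le> s \<and> s < T (Suc n) \<omega>) * (indicator G \<omega> * jump_exp k \<phi> t (X s \<omega>)) \<partial>M)"
  proof (rule nn_integral_cong)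
    fix \<omega> assume \<omega>: "\<omega> \<in> space M"
    show "indicator G' \<omega> * of_bool (T n \<omega> \<le> s \<and> s \<le> s \<and> s < T (Suc n) \<omega> \<and>
             T (n + 0) \<omega> \<le> s \<and> s < T (Suc (n + 0)) \<omega>) * jump_exp k \<phi> t (Z (n + 0) \<omega>, s - T (n + 0) \<omega>) =
       of_bool (T n \<omega> \<le> s \<and> s < T (Suc n) \<omega>) * (indicator G \<omega> * jump_exp k \<phi> t (X s \<omega>))"
      using X_eq(1)[OF \<omega>, of n s] G'(2)[OF \<omega>] by (auto simp: indicator_def)
  qed
  finally show ?thesis .
qed

lemma nn_integral_split_epoch:
  assumes "0 \<le> s" and [measurable]: "f \<in> borel_measurable M"
  shows "(\<integral>\<^sup>+\<omega>. f \<omega> \<partial>M) = (\<Sum>n. \<integral>\<^sup>+\<omega>. of_bool (T n \<omega> \<le> s \<and> s < T (Suc n) \<omega>) * f \<omega> \<partial>M)"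
proof -
  have "(\<integral>\<^sup>+\<omega>. f \<omega> \<partial>M) = (\<integral>\<^sup>+\<omega>. (\<Sum>n. of_bool (T n \<omega> \<le> s \<and> s < T (Suc n) \<omega>) * f \<omega>) \<partial>M)"
    using AE_epoch[OF assms(1)]
    by (intro nn_integral_cong_AE) (auto simp: suminf_of_bool_epoch simp del: ennreal_suminf_multc)
  also have "\<dots> = (\<Sum>n. \<integral>\<^sup>+\<omega>. of_bool (T n \<omega> \<le> s \<and> s < T (Suc n) \<omega>) * f \<omega> \<partial>M)"
    by (rule nn_integral_suminf) measurable
  finally show ?thesis .
qed

lemma sets_generated_X: "0 \<le> s \<Longrightarrow> sets (generated M SA {0..s} X) \<subseteq> sets M"
  by (intro sets_generated_subset) auto

text \<open>Summation over the number \<open>n\<close> of events by time \<open>s\<close> and the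
  number \<open>k\<close> of events in \<open>(s, s + t]\<close>; almost surely exactly one pair
  contributes.\<close>

lemma markov_nn_integral:
  assumes s: "0 \<le> s" and t: "0 \<le> t" and \<phi> [measurable]: "\<phi> \<in> borel_measurable SA"
    and G: "G \<in> sets (generated M SA {0..s} X)"
  shows "(\<integral>\<^sup>+\<omega>. indicator G \<omega> * \<phi> (X (s + t) \<omega>) \<partial>M) = (\<integral>\<^sup>+\<omega>. indicator G \<omega> * trans_op \<phi> t (X s \<omega>) \<partial>M)"
proof -
  have [measurable]: "G \<in> sets M" using G sets_generated_X[OF s] by blast
  have [measurable]: "X s \<in> measurable M SA" "X (s + t) \<in> measurable M SA"
    using s t by auto
  have "(\<integral>\<^sup>+\<omega>. of_bool (T n \<omega> \<le> s \<and> s < T (Suc n) \<omega>) * (indicator G \<omega> * \<phi> (X (s + t) \<omega>)) \<partial>M) =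
        (\<integral>\<^sup>+\<omega>. of_bool (T n \<omega> \<le> s \<and> s < T (Suc n) \<omega>) * (indicator G \<omega> * trans_op \<phi> t (X s \<omega>)) \<partial>M)" for n
  proof -
    have "(\<integral>\<^sup>+\<omega>. of_bool (T n \<omega> \<le> s \<and> s < T (Suc n) \<omega>) * (indicator G \<omega> * \<phi> (X (s + t) \<omega>)) \<partial>M) =
       (\<integral>\<^sup>+\<omega>. (\<Sum>k. of_bool (T n \<omega> \<le> s \<and> s < T (Suc n) \<omega>) * of_bool (T (n + k) \<omega> \<le> s + t \<and> s + t < T (Suc (n + k)) \<omega>) *
           (indicator G \<omega> * \<phi> (X (s + t) \<omega>))) \<partial>M)"
    proof (rule nn_integral_cong_AE)
      have st: "0 \<le> s + t" using s t by simp
      show "AE \<omega> in M. of_bool (T n \<omega> \<le> s \<and> s < T (Suc n) \<omega>) * (indicator G \<omega> * \<phi> (X (s + t) \<omega>)) =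
        (\<Sum>k. of_bool (T n \<omega> \<le> s \<and> s < T (Suc n) \<omega>) * of_bool (T (n + k) \<omega> \<le> s + t \<and> s + t < T (Suc (n + k)) \<omega>) *
           (indicator G \<omega> * \<phi> (X (s + t) \<omega>)))"
        using AE_epoch[OF st]
      proof (rule AE_mp, intro AE_I2 impI)
        fix \<omega> assume \<omega>: "\<omega> \<in> space M" and "\<exists>m. T m \<omega> \<le> s + t \<and> s + t < T (Suc m) \<omega>"
        then obtain m where m: "T m \<omega> \<le> s + t" "s + t < T (Suc m) \<omega>" by blast
        show "of_bool (T n \<omega> \<le> s \<and> s < T (Suc n) \<omega>) * (indicator G \<omega> * \<phi> (X (s + t) \<omega>)) =
        (\<Sum>k. of_bool (T n \<omega> \<le> s \<and> s < T (Suc n) \<omega>) * of_bool (T (n + k) \<omega> \<le> s + t \<and> s + t < T (Suc (n + k)) \<omega>) *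
           (indicator G \<omega> * \<phi> (X (s + t) \<omega>)))"
        proof (cases "T n \<omega> \<le> s \<and> s < T (Suc n) \<omega>")
          case True
          have "n \<le> m"
          proof (rule ccontr)
            assume "\<not> n \<le> m"
            then have "T (Suc m) \<omega> \<le> T n \<omega>" by (intro T_mono \<omega>) simp
            then show False using m True t by simp
          qed
          have "k = m - n" if "T (n + k) \<omega> \<le> s + t \<and> s + t < T (Suc (n + k)) \<omega>" for k
            using event_count_eq[OF \<omega> m] event_count_eq[OF \<omega>, of "n + k" "s + t"] that by simp
          then have "(\<Sum>k. of_bool (T n \<omega> \<le> s \<and> s < T (Suc n) \<omega>) * of_bool (T (n + k) \<omega> \<le> s + t \<and> s + t < T (Suc (n + k)) \<omega>) *
             (indicator G \<omega> * \<phi> (X (s + t) \<omega>))) = (\<Sum>k\<in>{m - n}. of_bool (T n \<omega> \<le> s \<and> s < T (Suc n) \<omega>) *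
               of_bool (T (n + k) \<omega> \<le> s + t \<and> s + t < T (Suc (n + k)) \<omega>) * (indicator G \<omega> * \<phi> (X (s + t) \<omega>)))"
            by (intro suminf_finite) (auto simp del: ennreal_suminf_multc)
          then show ?thesis using True m \<open>n \<le> m\<close> by simp
        qed auto
      qed
    qed
    also have "\<dots> = (\<Sum>k. \<integral>\<^sup>+\<omega>. of_bool (T n \<omega> \<le> s \<and> s < T (Suc n) \<omega>) * of_bool (T (n + k) \<omega> \<le> s + t \<and> s + t < T (Suc (n + k)) \<omega>) *
           (indicator G \<omega> * \<phi> (X (s + t) \<omega>)) \<partial>M)"
      by (rule nn_integral_suminf) measurable
    also have "\<dots> = (\<Sum>k. \<integral>\<^sup>+\<omega>. of_bool (T n \<omega> \<le> s \<and> s < T (Suc n) \<omega>) * (indicator G \<omega> * jump_exp k \<phi> t (X s \<omega>)) \<partial>M)"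
      by (simp only: markov_nn_integral_event[OF s t \<phi> G])
    also have "\<dots> = (\<integral>\<^sup>+\<omega>. (\<Sum>k. of_bool (T n \<omega> \<le> s \<and> s < T (Suc n) \<omega>) * (indicator G \<omega> * jump_exp k \<phi> t (X s \<omega>))) \<partial>M)"
      by (rule nn_integral_suminf[symmetric]) measurable
    finally show ?thesis by (simp add: trans_op_def)
  qed
  moreover have "(\<lambda>\<omega>. indicator G \<omega> * \<phi> (X (s + t) \<omega>)) \<in> borel_measurable M"
    "(\<lambda>\<omega>. indicator G \<omega> * trans_op \<phi> t (X s \<omega>)) \<in> borel_measurable M"
    by measurable
  ultimately show ?thesis
    by (simp only: nn_integral_split_epoch[OF s, of "\<lambda>\<omega>. indicator G \<omega> * \<phi> (X (s + t) \<omega>)"]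
        nn_integral_split_epoch[OF s, of "\<lambda>\<omega>. indicator G \<omega> * trans_op \<phi> t (X s \<omega>)"])
qed

text \<open>The indicator of vanishing survival is integrated against the survival factor itself,
  which gives 0. Full mass comes from the Markov identity for the constant 1 on the whole space,
  where non-explosion enters; a function at most 1 with mean 1 is 1 almost surely.\<close>

lemma AE_regular:
  assumes s: "0 \<le> s"
  shows "AE \<omega> in M. X s \<omega> \<in> regular"
proof -
  have [measurable]: "X s \<in> measurable M SA" using s by simp
  have "AE \<omega> in M. surv (fst (X s \<omega>)) (snd (X s \<omega>)) \<noteq> 0"
  proof -
    define \<phi> :: "'z \<times> real \<Rightarrow> ennreal" where "\<phi> = (\<lambda>x. of_bool (surv (fst x) (snd x) = 0))"
    have [measurable]: "\<phi> \<in> borel_measurable SA" unfolding \<phi>_def by measurable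
    have "(\<integral>\<^sup>+\<omega>. of_bool (T n \<omega> \<le> s \<and> s < T (Suc n) \<omega>) * \<phi> (X s \<omega>) \<partial>M) = 0" for n
    proof -
      have "(\<integral>\<^sup>+\<omega>. of_bool (T n \<omega> \<le> s \<and> s < T (Suc n) \<omega>) * \<phi> (X s \<omega>) \<partial>M) =
        (\<integral>\<^sup>+\<omega>. 1 * of_bool (T n \<omega> \<le> s \<and> s \<le> s \<and> s < T (Suc n) \<omega> \<and>
             T (n + 0) \<omega> \<le> s \<and> s < T (Suc (n + 0)) \<omega>) * \<phi> (Z (n + 0) \<omega>, s - T (n + 0) \<omega>) \<partial>M)"
        using X_eq(1)[of _ n s] by (intro nn_integral_cong) auto
      also have "\<dots> = (\<integral>\<^sup>+\<omega>. 1 * of_bool (T n \<omega> \<le> s \<and> s \<le> s) * jump_op 0 \<phi> (s - s) (Z n \<omega>) (s - T n \<omega>) \<partial>M)"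
        by (rule jump_expectation[of \<phi> "\<lambda>_. 1" n "\<lambda>_. s" s 0]) measurable
      also have "\<dots> = (\<integral>\<^sup>+\<omega>. 0 \<partial>M)"
        by (intro nn_integral_cong) (auto simp: \<phi>_def)
      finally show ?thesis by simp
    qed
    then have "(\<integral>\<^sup>+\<omega>. \<phi> (X s \<omega>) \<partial>M) = 0"
      by (subst nn_integral_split_epoch[OF s]) simp_all
    then have "AE \<omega> in M. \<phi> (X s \<omega>) = 0"
      by (subst (asm) nn_integral_0_iff_AE) auto
    then show ?thesis by (rule AE_mp) (auto simp: \<phi>_def)
  qed
  moreover have "AE \<omega> in M. trans_op (\<lambda>_. 1) (real m) (X s \<omega>) = 1" for m :: nat
  proof -
    have le: "trans_op (\<lambda>_. 1) (real m) (X s \<omega>) \<le> 1" if "\<omega> \<in> space M" for \<omega>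
      using measurable_space[OF \<open>X s \<in> measurable M SA\<close> that] trans_op_1_le[of "real m" "fst (X s \<omega>)" "snd (X s \<omega>)"]
      by (auto simp: space_pair_measure)
    have "space M \<in> sets (generated M SA {0..s} X)"
      using sets.top[of "generated M SA {0..s} X"] by simp
    from markov_nn_integral[OF s _ _ this, of "real m" "\<lambda>_. 1"]
    have "(\<integral>\<^sup>+\<omega>. trans_op (\<lambda>_. 1) (real m) (X s \<omega>) \<partial>M) = (\<integral>\<^sup>+\<omega>. 1 \<partial>M)"
      by (simp cong: nn_integral_cong)
    then have "(\<integral>\<^sup>+\<omega>. trans_op (\<lambda>_. 1) (real m) (X s \<omega>) \<partial>M) = 1"
      by (simp add: emeasure_space_1)
    then have "(\<integral>\<^sup>+\<omega>. 1 - trans_op (\<lambda>_. 1) (real m) (X s \<omega>) \<partial>M) = 0"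
      using le emeasure_space_1 by (subst nn_integral_diff) (auto intro!: AE_I2)
    then have "AE \<omega> in M. 1 - trans_op (\<lambda>_. 1) (real m) (X s \<omega>) = 0"
      by (subst (asm) nn_integral_0_iff_AE) auto
    then show ?thesis
      by (rule AE_mp) (auto intro!: AE_I2 antisym le simp: diff_eq_0_iff_ennreal less_top_ennreal)
  qed
  moreover have "AE \<omega> in M. 0 \<le> snd (X s \<omega>)"
    using AE_epoch[OF s] by (rule AE_mp) (auto intro!: AE_I2 simp: X_eq)
  ultimately have "AE \<omega> in M. surv (fst (X s \<omega>)) (snd (X s \<omega>)) \<noteq> 0 \<and>
      (\<forall>m::nat. trans_op (\<lambda>_. 1) (real m) (X s \<omega>) = 1) \<and> 0 \<le> snd (X s \<omega>)"
    by (simp add: AE_all_countable)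
  then show ?thesis
    by (rule AE_mp) (use measurable_space[OF \<open>X s \<in> measurable M SA\<close>] in \<open>auto intro!: AE_I2 simp: regular_def\<close>)
qed

lemma markov_set_integral:
  assumes s: "0 \<le> s" and t: "0 \<le> t" and A [measurable]: "A \<in> sets SA"
    and G: "G \<in> sets (generated M SA {0..s} X)"
  shows "(\<integral>\<omega>\<in>G. indicator {\<omega> \<in> space M. X (s + t) \<omega> \<in> A} \<omega> \<partial>M) = (\<integral>\<omega>\<in>G. measure (trans_kernel t (X s \<omega>)) A \<partial>M)"
proof -
  have [measurable]: "G \<in> sets M" using G sets_generated_X[OF s] by blast
  have [measurable]: "X s \<in> measurable M SA" "X (s + t) \<in> measurable M SA"
    using s t by auto
  note [measurable] = trans_kernel_measurable[OF t]
  have meas: "(\<lambda>\<omega>. measure (trans_kernel t (X s \<omega>)) A) \<in> borel_measurable M"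
    using measurable_compose[OF trans_kernel_measurable[OF t] measurable_measure_prob_algebra[OF A]] by measurable
  have fin: "measure (trans_kernel t (X s \<omega>)) A \<le> 1" "emeasure (trans_kernel t (X s \<omega>)) A = ennreal (measure (trans_kernel t (X s \<omega>)) A)"
    if "\<omega> \<in> space M" for \<omega>
  proof -
    interpret P: prob_space "trans_kernel t (X s \<omega>)"
      using measurable_space[OF \<open>X s \<in> measurable M SA\<close> that] t by (rule trans_kernel_prob)
    show "measure (trans_kernel t (X s \<omega>)) A \<le> 1" "emeasure (trans_kernel t (X s \<omega>)) A = ennreal (measure (trans_kernel t (X s \<omega>)) A)"
      by (auto simp: P.emeasure_eq_measure)
  qed
  have "ennreal (\<integral>\<omega>. indicator G \<omega> * indicator {\<omega> \<in> space M. X (s + t) \<omega> \<in> A} \<omega> \<partial>M) =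
      (\<integral>\<^sup>+\<omega>. ennreal (indicator G \<omega> * indicator {\<omega> \<in> space M. X (s + t) \<omega> \<in> A} \<omega>) \<partial>M)"
    by (rule nn_integral_eq_integral[symmetric])
       (auto intro!: integrable_const_bound[of _ 1] AE_I2 simp: indicator_def)
  also have "\<dots> = (\<integral>\<^sup>+\<omega>. indicator G \<omega> * indicator A (X (s + t) \<omega>) \<partial>M)"
    by (intro nn_integral_cong) (auto simp: indicator_def)
  also have "\<dots> = (\<integral>\<^sup>+\<omega>. indicator G \<omega> * trans_op (indicator A) t (X s \<omega>) \<partial>M)"
    by (rule markov_nn_integral[OF s t _ G]) measurable
  also have "\<dots> = (\<integral>\<^sup>+\<omega>. ennreal (indicator G \<omega> * measure (trans_kernel t (X s \<omega>)) A) \<partial>M)"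
    using AE_regular[OF s]
    by (intro nn_integral_cong_AE, elim AE_mp, intro AE_I2)
       (auto simp: emeasure_trans_kernel[symmetric] fin indicator_def)
  also have "\<dots> = ennreal (\<integral>\<omega>. indicator G \<omega> * measure (trans_kernel t (X s \<omega>)) A \<partial>M)"
    by (rule nn_integral_eq_integral)
       (use fin meas in \<open>auto intro!: integrable_const_bound[of _ 1] AE_I2 simp: indicator_def\<close>)
  finally show ?thesis
    by (subst (asm) ennreal_inj) (auto simp: set_lebesgue_integral_def intro!: integral_nonneg_AE)
qed

end

section \<open>Calendar process and projections\<close>

lemma subalgebra_generated:
  assumes "\<And>i. i \<in> I \<Longrightarrow> X i \<in> measurable M S"
  shows "subalgebra M (generated M S I X)"
  unfolding subalgebra_def using sets_generated_subset[of M M I X S] assms by simp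

lemma finite_measure_subalgebraI:
  "prob_space M \<Longrightarrow> subalgebra M F \<Longrightarrow> finite_measure_subalgebra M F"
  by (simp add: finite_measure_subalgebra_def finite_measure_subalgebra_axioms_def prob_space.finite_measure)

section \<open>Criteria for the Markov property and for its failure\<close>

lemma cprob_eqI:
  assumes "prob_space M" "subalgebra M F" "{\<omega> \<in> space M. E \<omega>} \<in> sets M"
    and g: "g \<in> borel_measurable F" "\<And>\<omega>. \<omega> \<in> space M \<Longrightarrow> 0 \<le> g \<omega> \<and> g \<omega> \<le> 1"
    and eq: "\<And>G. G \<in> sets F \<Longrightarrow> (\<integral>\<omega>\<in>G. indicator {\<omega> \<in> space M. E \<omega>} \<omega> \<partial>M) = (\<integral>\<omega>\<in>G. g \<omega> \<partial>M)"
  shows "AE \<omega> in M. cprob M F E \<omega> = g \<omega>"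
proof -
  interpret finite_measure_subalgebra M F
    using assms(1,2) by (rule finite_measure_subalgebraI)
  have "g \<in> borel_measurable M"
    using measurable_from_subalg[OF assms(2) g(1)] .
  then have "integrable M g"
    using g(2) by (intro integrable_const_bound[of _ 1]) auto
  moreover have "integrable M (indicator {\<omega> \<in> space M. E \<omega>} :: _ \<Rightarrow> real)"
    using assms(3) by (simp add: integrable_indicator_iff emeasure_eq_measure)
  ultimately show ?thesis
    unfolding cprob_def using eq g(1) by (intro real_cond_exp_charact)
qed

lemma homogeneous_markovI:
  assumes M: "prob_space M" and X: "\<And>t. 0 \<le> t \<Longrightarrow> X t \<in> measurable M S"
    and P: "transition_semigroup S P"
    and eq: "\<And>s t A G. 0 \<le> s \<Longrightarrow> 0 \<le> t \<Longrightarrow> A \<in> sets S \<Longrightarrow> G \<in> sets (generated M S {0..s} X) \<Longrightarrow>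
      (\<integral>\<omega>\<in>G. indicator {\<omega> \<in> space M. X (s + t) \<omega> \<in> A} \<omega> \<partial>M) = (\<integral>\<omega>\<in>G. measure (P t (X s \<omega>)) A \<partial>M)"
  shows "homogeneous_markov_process M S X"
proof -
  \<comment> \<open>Stated for every index set between \<open>{s}\<close> and \<open>{0..s}\<close>:
    one version then represents the conditional probability given the present and given the past,
    and their equality is the Markov property.\<close>
  have key: "AE \<omega> in M. cprob M (generated M S I X) (\<lambda>\<omega>. X (s + t) \<omega> \<in> A) \<omega> = measure (P t (X s \<omega>)) A"
    if "0 \<le> s" "0 \<le> t" "A \<in> sets S" "s \<in> I" "I \<subseteq> {0..s}" for s t A I
  proof (rule cprob_eqI[OF M])
    note [measurable] = X[OF that(1)] X[of "s + t"] that(3)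
    have Pm: "P t \<in> measurable S (prob_algebra S)"
      using P that(2) by (simp add: transition_semigroup_def)
    show "subalgebra M (generated M S I X)"
      using X that by (intro subalgebra_generated) auto
    have "X (s + t) \<in> measurable M S" using that by (intro X) simp
    then show "{\<omega> \<in> space M. X (s + t) \<omega> \<in> A} \<in> sets M"
      by measurable
    have "X s \<in> measurable (generated M S I X) S"
      using X that by (intro measurable_generated) auto
    from measurable_compose[OF this measurable_compose[OF Pm measurable_measure_prob_algebra[OF that(3)]]]
    show "(\<lambda>\<omega>. measure (P t (X s \<omega>)) A) \<in> borel_measurable (generated M S I X)" .
    show "0 \<le> measure (P t (X s \<omega>)) A \<and> measure (P t (X s \<omega>)) A \<le> 1" if "\<omega> \<in> space M" for \<omega>
      using measurable_space[OF Pm measurable_space[OF X[OF \<open>0 \<le> s\<close>] that]]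
      by (auto simp: space_prob_algebra intro: prob_space.prob_le_1)
  next
    fix G assume "G \<in> sets (generated M S I X)"
    moreover have "sets (generated M S I X) \<subseteq> sets (generated M S {0..s} X)"
      using X that by (intro sets_generated_subset) (auto intro!: measurable_generated)
    ultimately show "(\<integral>\<omega>\<in>G. indicator {\<omega> \<in> space M. X (s + t) \<omega> \<in> A} \<omega> \<partial>M) = (\<integral>\<omega>\<in>G. measure (P t (X s \<omega>)) A \<partial>M)"
      using eq that by blast
  qed
  have "markov_process M S X"
    unfolding markov_process_def
  proof (intro conjI allI impI X)
    fix s t :: real and A assume *: "0 \<le> s" "s \<le> t" "A \<in> sets S"
    have "AE \<omega> in M. cprob M (generated M S {0..s} X) (\<lambda>\<omega>. X t \<omega> \<in> A) \<omega> = measure (P (t - s) (X s \<omega>)) A"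
      "AE \<omega> in M. cprob M (generated M S {s} X) (\<lambda>\<omega>. X t \<omega> \<in> A) \<omega> = measure (P (t - s) (X s \<omega>)) A"
      using key[of s "t - s" A "{0..s}"] key[of s "t - s" A "{s}"] * by auto
    then show "AE \<omega> in M. cprob M (generated M S {0..s} X) (\<lambda>\<omega>. X t \<omega> \<in> A) \<omega>
        = cprob M (generated M S {s} X) (\<lambda>\<omega>. X t \<omega> \<in> A) \<omega>"
      by eventually_elim simp
  qed
  then show ?thesis
    unfolding homogeneous_markov_process_def using P key by auto
qed

lemma sufficient_imp_markov:
  assumes M: "prob_space M" and W: "markov_process M S W"
    and \<pi>: "\<pi> \<in> measurable S R" and Y: "\<And>t. Y t = (\<lambda>\<omega>. \<pi> (W t \<omega>))"
    and suff: "sufficient_for_future M S W R Y"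
  shows "markov_process M R Y"
  unfolding markov_process_def
proof (intro conjI allI impI)
  have Wm: "W t \<in> measurable M S" if "0 \<le> t" for t
    using W that by (simp add: markov_process_def)
  show Ym: "Y t \<in> measurable M R" if "0 \<le> t" for t
    unfolding Y using measurable_compose[OF Wm[OF that] \<pi>] .
  fix s t :: real and A assume *: "0 \<le> s" "s \<le> t" "A \<in> sets R"
  define f :: "_ \<Rightarrow> real" where "f = indicator {\<omega> \<in> space M. Y t \<omega> \<in> A}"
  let ?FW = "generated M S {0..s} W" and ?gW = "generated M S {s} W"
  let ?FY = "generated M R {0..s} Y" and ?gY = "generated M R {s} Y"
  have subs: "subalgebra M ?FW" "subalgebra M ?FY" "subalgebra M ?gY" "subalgebra ?FW ?FY" "subalgebra ?FY ?gY"
  proof -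
    show "subalgebra M ?FW" "subalgebra M ?FY" "subalgebra M ?gY"
      using Wm Ym * by (auto intro!: subalgebra_generated)
    have "Y i \<in> measurable ?FW R" if "i \<in> {0..s}" for i
    proof -
      have "W i \<in> measurable ?FW S" using that Wm by (intro measurable_generated) auto
      then show ?thesis unfolding Y using \<pi> by (rule measurable_compose)
    qed
    then have "sets ?FY \<subseteq> sets ?FW"
      by (intro sets_generated_subset) auto
    then show "subalgebra ?FW ?FY" by (simp add: subalgebra_def)
    have "sets ?gY \<subseteq> sets ?FY"
      using Ym * by (intro sets_generated_subset) (auto intro!: measurable_generated)
    then show "subalgebra ?FY ?gY" by (simp add: subalgebra_def)
  qed
  interpret FY: finite_measure_subalgebra M ?FY using M subs(2) by (rule finite_measure_subalgebraI)
  interpret FW: finite_measure_subalgebra M ?FW using M subs(1) by (rule finite_measure_subalgebraI)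
  interpret gY: finite_measure_subalgebra M ?gY using M subs(3) by (rule finite_measure_subalgebraI)
  have "{\<omega> \<in> space M. Y t \<omega> \<in> A} \<in> sets M"
    using measurable_sets[OF Ym *(3), of t] * by (simp add: vimage_def Int_def conj_commute)
  then have f [simp]: "integrable M f"
    unfolding f_def by (simp add: integrable_indicator_iff FY.emeasure_eq_measure)
  have "AE \<omega> in M. real_cond_exp M ?FW f \<omega> = real_cond_exp M ?gW f \<omega>"
  proof -
    have "{\<omega> \<in> space M. Y t \<omega> \<in> A} = {\<omega> \<in> space M. W t \<omega> \<in> \<pi> -` A \<inter> space S}"
      using measurable_space[OF Wm, of t] * by (auto simp: Y)
    then show ?thesis
      using W measurable_sets[OF \<pi> *(3)] * unfolding markov_process_def cprob_def f_def by (simp only:)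
  qed
  moreover have "AE \<omega> in M. real_cond_exp M ?gW f \<omega> = real_cond_exp M ?gY f \<omega>"
    using suff * unfolding sufficient_for_future_def cprob_def f_def by simp
  ultimately have "AE \<omega> in M. real_cond_exp M ?FW f \<omega> = real_cond_exp M ?gY f \<omega>"
    by eventually_elim simp
  \<comment> \<open>Both sides are conditioned on the history of \<open>Y\<close>. It is coarser
    than \<open>?FW\<close>, which collapses the left side, and finer than \<open>?gY\<close>, which
    leaves the right side unchanged.\<close>
  then have "AE \<omega> in M. real_cond_exp M ?FY (real_cond_exp M ?FW f) \<omega> = real_cond_exp M ?FY (real_cond_exp M ?gY f) \<omega>"
    by (rule FY.real_cond_exp_cong) auto
  moreover have "AE \<omega> in M. real_cond_exp M ?FY (real_cond_exp M ?FW f) \<omega> = real_cond_exp M ?FY f \<omega>"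
    by (rule FY.real_cond_exp_nested_subalg[OF subs(1,4) f])
  moreover have "AE \<omega> in M. real_cond_exp M ?FY (real_cond_exp M ?gY f) \<omega> = real_cond_exp M ?gY f \<omega>"
    by (rule FY.real_cond_exp_F_meas)
       (auto intro: measurable_from_subalg[OF subs(5)] gY.real_cond_exp_int)
  ultimately show "AE \<omega> in M. cprob M ?FY (\<lambda>\<omega>. Y t \<omega> \<in> A) \<omega> = cprob M ?gY (\<lambda>\<omega>. Y t \<omega> \<in> A) \<omega>"
    unfolding cprob_def f_def by eventually_elim simp
qed

text \<open>The conditional probability given the present is constant on the atom \<open>E\<close>,
  and the constant is positive because the future event meets \<open>E\<close> with positive
  probability. Under the Markov property the same constant would be the conditional probability on
  \<open>G\<close>, where the future event is null.\<close>

lemma not_markovI: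
  fixes X :: "real \<Rightarrow> 'w \<Rightarrow> 'a"
  assumes M: "prob_space M" and r: "0 \<le> r" "r \<le> s" "s \<le> t"
    and null: "measure M {\<omega> \<in> space M. X r \<omega> \<in> B \<and> X s \<omega> = x \<and> X t \<omega> \<in> A} = 0"
    and pos1: "0 < measure M {\<omega> \<in> space M. X r \<omega> \<in> B \<and> X s \<omega> = x}"
    and pos2: "0 < measure M {\<omega> \<in> space M. X s \<omega> = x \<and> X t \<omega> \<in> A}"
  shows "\<not> markov_process M (count_space UNIV) X"
proof
  assume "markov_process M (count_space UNIV) X"
  then have Xm: "\<And>t. 0 \<le> t \<Longrightarrow> X t \<in> measurable M (count_space UNIV)"
    and markov: "AE \<omega> in M. cprob M (generated M (count_space UNIV) {0..s} X) (\<lambda>\<omega>. X t \<omega> \<in> A) \<omega>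
                = cprob M (generated M (count_space UNIV) {s} X) (\<lambda>\<omega>. X t \<omega> \<in> A) \<omega>"
    using r by (auto simp: markov_process_def)
  let ?F = "generated M (count_space UNIV) {0..s} X" and ?g = "generated M (count_space UNIV) {s} X"
  have m: "X r \<in> measurable M (count_space UNIV)" "X s \<in> measurable M (count_space UNIV)"
     "X t \<in> measurable M (count_space UNIV)"
    using r by (auto intro!: Xm)
  have subs: "subalgebra M ?F" "subalgebra M ?g"
    using Xm r by (auto intro!: subalgebra_generated)
  interpret F: finite_measure_subalgebra M ?F using M subs(1) by (rule finite_measure_subalgebraI)
  interpret g: finite_measure_subalgebra M ?g using M subs(2) by (rule finite_measure_subalgebraI)
  define D where "D = {\<omega> \<in> space M. X t \<omega> \<in> A}"
  define E where "E = {\<omega> \<in> space M. X s \<omega> = x}"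
  define G where "G = {\<omega> \<in> space M. X r \<omega> \<in> B \<and> X s \<omega> = x}"
  define h where "h = real_cond_exp M ?g (indicator D)"
  have mF: "X r \<in> measurable ?F (count_space UNIV)" "X s \<in> measurable ?F (count_space UNIV)"
    "X s \<in> measurable ?g (count_space UNIV)"
    using r m by (auto intro!: measurable_generated)
  have D: "D \<in> sets M"
    using measurable_sets[OF m(3), of A] by (simp add: D_def vimage_def Int_def conj_commute)
  have E: "E \<in> sets ?g"
    using measurable_sets[OF mF(3), of "{x}"] by (simp add: E_def vimage_def Int_def conj_commute)
  have G: "G \<in> sets ?F"
  proof -
    have "G = (X r -` B \<inter> space ?F) \<inter> (X s -` {x} \<inter> space ?F)"
      by (auto simp: G_def)
    then show ?thesis using measurable_sets[OF mF(1), of B] measurable_sets[OF mF(2), of "{x}"] by auto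
  qed
  have h_meas: "h \<in> borel_measurable ?g" by (simp add: h_def)
  have sets_g: "sets ?g = {X s -` A \<inter> space M | A. True}"
    using sets_vimage_algebra2[of "X s" "space M" "count_space UNIV"]
    by (simp add: sets_generated sets_vimage_algebra)
  \<comment> \<open>Every set of \<open>?g\<close> is a preimage under \<open>X s\<close>, so a
    level set of \<open>h\<close> that meets the fibre over \<open>x\<close> contains all of
    it.\<close>
  have h_const: "h \<omega> = h \<omega>'" if "\<omega> \<in> E" "\<omega>' \<in> E" for \<omega> \<omega>'
  proof -
    have "h -` {h \<omega>} \<inter> space ?g \<in> sets ?g"
      by (rule measurable_sets[OF h_meas]) simp
    then obtain C where "h -` {h \<omega>} \<inter> space M = X s -` C \<inter> space M"
      unfolding sets_g by auto
    moreover have "\<omega> \<in> h -` {h \<omega>} \<inter> space M" using that by (simp add: E_def)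
    ultimately have "\<omega>' \<in> h -` {h \<omega>} \<inter> space M" using that by (auto simp: E_def)
    then show ?thesis by simp
  qed
  obtain \<omega>0 where \<omega>0: "\<omega>0 \<in> E"
  proof -
    have "{\<omega> \<in> space M. X r \<omega> \<in> B \<and> X s \<omega> = x} \<noteq> {}" using pos1 by (metis less_irrefl measure_empty)
    then show ?thesis using that by (auto simp: E_def)
  qed
  define c where "c = h \<omega>0"
  have int: "integrable M (indicator D :: _ \<Rightarrow> real)"
    using D by (simp add: integrable_indicator_iff F.emeasure_eq_measure)
  have set_int: "(\<integral>\<omega>\<in>C. h \<omega> \<partial>M) = c * measure M C" if "C \<subseteq> E" "C \<in> sets M" for C
  proof -
    have "(\<integral>\<omega>\<in>C. h \<omega> \<partial>M) = (\<integral>\<omega>. c * indicator C \<omega> \<partial>M)"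
      unfolding set_lebesgue_integral_def
      using h_const[OF _ \<omega>0] that(1) by (intro Bochner_Integration.integral_cong) (auto simp: c_def indicator_def)
    then show ?thesis using that(2) by simp
  qed
  have set_ind: "(\<integral>\<omega>\<in>C. indicator D \<omega> \<partial>M) = measure M (C \<inter> D)" if "C \<in> sets M" for C
    using that D by (simp add: set_lebesgue_integral_def indicator_inter_arith[symmetric])
  have EM: "E \<in> sets M" "G \<in> sets M" using E G subs by (auto simp: subalgebra_def)
  have "c * measure M E = measure M (E \<inter> D)"
    using g.real_cond_exp_intA[OF int E] set_int[OF _ EM(1)] set_ind[OF EM(1)] by (simp add: h_def)
  also have "E \<inter> D = {\<omega> \<in> space M. X s \<omega> = x \<and> X t \<omega> \<in> A}"
    by (auto simp: E_def D_def)
  finally have "c \<noteq> 0" using pos2 by auto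
  have "(\<integral>\<omega>\<in>G. h \<omega> \<partial>M) = (\<integral>\<omega>\<in>G. real_cond_exp M ?F (indicator D) \<omega> \<partial>M)"
    unfolding set_lebesgue_integral_def
    by (intro integral_cong_AE) (use markov EM in \<open>auto simp: h_def cprob_def D_def elim!: AE_mp\<close>)
  also have "\<dots> = measure M (G \<inter> D)"
    using F.real_cond_exp_intA[OF int G] set_ind[OF EM(2)] by simp
  also have "G \<inter> D = {\<omega> \<in> space M. X r \<omega> \<in> B \<and> X s \<omega> = x \<and> X t \<omega> \<in> A}"
    by (auto simp: G_def D_def)
  finally have "c * measure M G = 0"
    using null set_int[OF _ EM(2)] by (auto simp: G_def E_def)
  then show False using \<open>c \<noteq> 0\<close> pos1 by (simp add: G_def)
qed

section \<open>The calendar process and its histories\<close>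

context markov_renewal_process
begin

text \<open>Epochs and waiting times determine each other by partial sums and differences, with
  \<open>T 0\<close> constant. This reconciles the conditioning in the semi-Markov definition with
  that of the renewal specification.\<close>

lemma sigma_epoch_history:
  "sigma (space M) (sets (generated M S {0..n} Z) \<union> sets (generated M borel {0..n} T)) = F n"
proof -
  let ?E = "sets (generated M S {0..n} Z) \<union> sets (generated M borel {0..n} T)"
  let ?F = "sigma (space M) ?E"
  have E: "?E \<subseteq> Pow (space M)"
    using sets.space_closed[of "generated M S {0..n} Z"] sets.space_closed[of "generated M borel {0..n} T"] by simp
  then have sets: "sets ?F = sigma_sets (space M) ?E" and space: "space ?F = space M"
    by (simp_all add: space_measure_of_conv)
  have Zm: "Z m \<in> measurable ?F S" if "m \<le> n" for m
  proof (rule measurableI)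
    fix A assume "A \<in> sets S"
    then show "Z m -` A \<inter> space ?F \<in> sets ?F"
      using measurable_sets[OF measurable_generated[of m "{0..n}" Z M S]] that
      unfolding sets space by (intro sigma_sets.Basic) simp
  qed (use measurable_space[OF Z_measurable] space in auto)
  have Tm: "T m \<in> borel_measurable ?F" if "m \<le> n" for m
  proof (rule measurableI)
    fix A :: "real set" assume "A \<in> sets borel"
    then show "T m -` A \<inter> space ?F \<in> sets ?F"
      using measurable_sets[OF measurable_generated[of m "{0..n}" T M borel]] that
      unfolding sets space by (intro sigma_sets.Basic) simp
  qed simp
  have "sets (F n) \<subseteq> sets ?F"
  proof (rule sets_event_history_subset[OF space Zm])
    fix m assume "m < n"
    then have "(\<lambda>\<omega>. T (Suc m) \<omega> - T m \<omega>) \<in> borel_measurable ?F"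
      using Tm[of "Suc m"] Tm[of m] by simp
    then show "\<tau> (Suc m) \<in> borel_measurable ?F" by (simp add: T_Suc)
  qed
  moreover have "?E \<subseteq> sets (F n)"
    using sets_generated_subset[of "F n" M "{0..n}" Z S] sets_generated_subset[of "F n" M "{0..n}" T borel]
      Z_measurable_F T_measurable_F by simp
  then have "sets ?F \<subseteq> sets (F n)"
    unfolding sets using sets.sigma_sets_subset[of ?E "F n"] by simp
  ultimately have "sigma_sets (space M) ?E =
      sigma_sets (space M) (sets (generated M S {0..n} Z) \<union> sets (generated M borel {1..n} \<tau>))"
    unfolding sets sets_event_history by (rule antisym[rotated])
  then show ?thesis
    unfolding event_history_def using E sets.space_closed[of "generated M borel {1..n} \<tau>"]
    by (intro sigma_eqI) simp_all
qed

lemma semi_markov_calendar: "semi_markov_process M S Q (calendar Z \<tau>)"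
  unfolding semi_markov_process_def
proof (intro conjI exI[of _ Z] exI[of _ T])
  show "\<forall>n. \<forall>E\<in>sets S. \<forall>u. AE \<omega> in M. cprob M
               (sigma (space M) (sets (generated M S {0..n} Z) \<union> sets (generated M borel {0..n} T)))
               (\<lambda>\<omega>. Z (Suc n) \<omega> \<in> E \<and> T (Suc n) \<omega> - T n \<omega> \<le> u) \<omega>
             = measure (Q (Z n \<omega>)) (E \<times> {0<..u})"
  proof (intro allI ballI)
    fix n E and u :: real assume E: "E \<in> sets S"
    have "{0<..u} \<in> sets borel" "{0<..u} \<subseteq> {0<..}" by auto
    then have "AE \<omega> in M. cprob M (F n) (\<lambda>\<omega>. Z (Suc n) \<omega> \<in> E \<and> \<tau> (Suc n) \<omega> \<in> {0<..u}) \<omega> = measure (Q (Z n \<omega>)) (E \<times> {0<..u})"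
      using mr E unfolding markov_renewal_def by blast
    moreover have "{\<omega> \<in> space M. Z (Suc n) \<omega> \<in> E \<and> T (Suc n) \<omega> - T n \<omega> \<le> u} =
       {\<omega> \<in> space M. Z (Suc n) \<omega> \<in> E \<and> \<tau> (Suc n) \<omega> \<in> {0<..u}}"
      using \<tau>_pos by (auto simp: T_Suc)
    ultimately show "AE \<omega> in M. cprob M
               (sigma (space M) (sets (generated M S {0..n} Z) \<union> sets (generated M borel {0..n} T)))
               (\<lambda>\<omega>. Z (Suc n) \<omega> \<in> E \<and> T (Suc n) \<omega> - T n \<omega> \<le> u) \<omega>
             = measure (Q (Z n \<omega>)) (E \<times> {0<..u})"
      unfolding sigma_epoch_history cprob_def by simp
  qed
  show "\<forall>\<omega>\<in>space M. \<forall>n t. T n \<omega> \<le> t \<and> t < T (Suc n) \<omega> \<longrightarrow> calendar Z \<tau> t \<omega> = Z n \<omega>"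
    using X_eq(2) by blast
qed (use prob_space_axioms kernel T_less ne in \<open>auto simp: non_explosive_def\<close>)

lemma homogeneous_markov_calendar_age: "homogeneous_markov_process M SA X"
  by (rule homogeneous_markovI[OF prob_space_axioms X_measurable transition_semigroup_trans_kernel markov_set_integral])

lemma calendar_fst: "calendar Z \<tau> t = (\<lambda>\<omega>. fst (X t \<omega>))"
  by (simp add: calendar_age_def)

context
  assumes age_indep: "age_independent S Q"
begin

text \<open>\<open>G\<close> ranges over the history that also records ages. This yields the Markov
  property of the state and its sufficiency with respect to the pair at once.\<close>

lemma markov_set_integral_calendar:
  assumes s: "0 \<le> s" and t: "0 \<le> t" and A [measurable]: "A \<in> sets S"
    and G: "G \<in> sets (generated M SA {0..s} X)"
  shows "(\<integral>\<omega>\<in>G. indicator {\<omega> \<in> space M. calendar Z \<tau> (s + t) \<omega> \<in> A} \<omega> \<partial>M) =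
    (\<integral>\<omega>\<in>G. measure (state_kernel t (calendar Z \<tau> s \<omega>)) A \<partial>M)"
proof -
  have [measurable]: "G \<in> sets M" using G sets_generated_X[OF s] by blast
  have "(\<integral>\<omega>\<in>G. indicator {\<omega> \<in> space M. calendar Z \<tau> (s + t) \<omega> \<in> A} \<omega> \<partial>M) =
     (\<integral>\<omega>\<in>G. indicator {\<omega> \<in> space M. X (s + t) \<omega> \<in> A \<times> UNIV} \<omega> \<partial>M)"
    by (simp add: calendar_fst mem_Times_iff)
  also have "\<dots> = (\<integral>\<omega>\<in>G. measure (trans_kernel t (X s \<omega>)) (A \<times> UNIV) \<partial>M)"
    by (rule markov_set_integral[OF s t _ G]) simp
  also have "\<dots> = (\<integral>\<omega>\<in>G. measure (state_kernel t (calendar Z \<tau> s \<omega>)) A \<partial>M)"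
    unfolding set_lebesgue_integral_def
  proof (intro integral_cong_AE)
    note tk = measurable_compose[OF X_measurable[OF s] measurable_compose[OF trans_kernel_measurable[OF t] measurable_measure_prob_algebra]]
    note sk = measurable_compose[OF calendar_measurable[OF s] measurable_compose[OF state_kernel_measurable[OF age_indep t] measurable_measure_prob_algebra]]
    show "(\<lambda>\<omega>. indicator G \<omega> *\<^sub>R measure (trans_kernel t (X s \<omega>)) (A \<times> UNIV)) \<in> borel_measurable M"
      using tk[of "A \<times> UNIV"] by measurable
    show "(\<lambda>\<omega>. indicator G \<omega> *\<^sub>R measure (state_kernel t (calendar Z \<tau> s \<omega>)) A) \<in> borel_measurable M"
      using sk[of A] by measurable
    show "AE \<omega> in M. indicator G \<omega> *\<^sub>R measure (trans_kernel t (X s \<omega>)) (A \<times> UNIV) =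
         indicator G \<omega> *\<^sub>R measure (state_kernel t (calendar Z \<tau> s \<omega>)) A"
      using AE_regular[OF s]
    proof eventually_elim
      case (elim \<omega>)
      have "emeasure (trans_kernel t (X s \<omega>)) (A \<times> UNIV) = emeasure (state_kernel t (calendar Z \<tau> s \<omega>)) A"
        unfolding calendar_fst emeasure_state_kernel[OF age_indep A]
        by (rule emeasure_trans_kernel_age_free[OF age_indep elim t A])
      then show ?case by (simp add: measure_def)
    qed
  qed
  finally show ?thesis .
qed

lemma sets_generated_calendar:
  "0 \<le> s \<Longrightarrow> sets (generated M S {0..s} (calendar Z \<tau>)) \<subseteq> sets (generated M SA {0..s} X)"
proof (intro sets_generated_subset)
  fix i assume "0 \<le> s" "i \<in> {0..s}"
  then have "X i \<in> measurable (generated M SA {0..s} X) SA"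
    by (intro measurable_generated) auto
  then show "calendar Z \<tau> i \<in> measurable (generated M SA {0..s} X) S"
    unfolding calendar_fst by (rule measurable_compose) simp
qed simp

lemma homogeneous_markov_calendar: "homogeneous_markov_process M S (calendar Z \<tau>)"
  using sets_generated_calendar
  by (intro homogeneous_markovI[OF prob_space_axioms calendar_measurable transition_semigroup_state_kernel[OF age_indep]]
      markov_set_integral_calendar) blast+

text \<open>The state kernel at the current state is a version of the conditional probability for
  both presents: it is measurable for the coarser one, and both are contained in the history of the
  pair.\<close>

lemma sufficient_calendar: "sufficient_for_future M SA X S (calendar Z \<tau>)"
  unfolding sufficient_for_future_def
proof (intro allI impI)
  fix s t :: real and A assume *: "0 \<le> s" "s \<le> t" and A [measurable]: "A \<in> sets S"
  let ?g = "\<lambda>\<omega>. measure (state_kernel (t - s) (calendar Z \<tau> s \<omega>)) A"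
  have sk: "state_kernel (t - s) \<in> measurable S (prob_algebra S)"
    using * by (intro state_kernel_measurable[OF age_indep]) simp
  have key: "AE \<omega> in M. cprob M N (\<lambda>\<omega>. calendar Z \<tau> t \<omega> \<in> A) \<omega> = ?g \<omega>"
    if N: "subalgebra M N" "sets N \<subseteq> sets (generated M SA {0..s} X)" "calendar Z \<tau> s \<in> measurable N S" for N
  proof (rule cprob_eqI[OF prob_space_axioms N(1)])
    have [measurable]: "calendar Z \<tau> t \<in> measurable M S" using * by simp
    show "{\<omega> \<in> space M. calendar Z \<tau> t \<omega> \<in> A} \<in> sets M" by measurable
    show "?g \<in> borel_measurable N"
      using measurable_compose[OF N(3) measurable_compose[OF sk measurable_measure_prob_algebra[OF A]]] .
    show "0 \<le> ?g \<omega> \<and> ?g \<omega> \<le> 1" if "\<omega> \<in> space M" for \<omega>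
      using measurable_space[OF sk measurable_space[OF calendar_measurable[OF *(1)] that]]
      by (auto simp: space_prob_algebra intro: prob_space.prob_le_1)
    show "(\<integral>\<omega>\<in>G. indicator {\<omega> \<in> space M. calendar Z \<tau> t \<omega> \<in> A} \<omega> \<partial>M) = (\<integral>\<omega>\<in>G. ?g \<omega> \<partial>M)"
      if "G \<in> sets N" for G
      using markov_set_integral_calendar[of s "t - s" A G] * A N(2) that by auto
  qed
  have "AE \<omega> in M. cprob M (generated M SA {s} X) (\<lambda>\<omega>. calendar Z \<tau> t \<omega> \<in> A) \<omega> = ?g \<omega>"
  proof (rule key)
    show "subalgebra M (generated M SA {s} X)" using * by (intro subalgebra_generated) auto
    show "sets (generated M SA {s} X) \<subseteq> sets (generated M SA {0..s} X)"
      using * by (intro sets_generated_subset) (auto intro!: measurable_generated)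
    have "X s \<in> measurable (generated M SA {s} X) SA" using * by (intro measurable_generated) auto
    then show "calendar Z \<tau> s \<in> measurable (generated M SA {s} X) S"
      unfolding calendar_fst by (rule measurable_compose) simp
  qed
  moreover have "AE \<omega> in M. cprob M (generated M S {s} (calendar Z \<tau>)) (\<lambda>\<omega>. calendar Z \<tau> t \<omega> \<in> A) \<omega> = ?g \<omega>"
  proof (rule key)
    show "subalgebra M (generated M S {s} (calendar Z \<tau>))" using * by (intro subalgebra_generated) auto
    have "sets (generated M S {s} (calendar Z \<tau>)) \<subseteq> sets (generated M S {0..s} (calendar Z \<tau>))"
      using * by (intro sets_generated_subset) (auto intro!: measurable_generated)
    then show "sets (generated M S {s} (calendar Z \<tau>)) \<subseteq> sets (generated M SA {0..s} X)"
      using sets_generated_calendar[OF *(1)] by blast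
    show "calendar Z \<tau> s \<in> measurable (generated M S {s} (calendar Z \<tau>)) S"
      using * by (intro measurable_generated) auto
  qed
  ultimately show "AE \<omega> in M. cprob M (generated M SA {s} X) (\<lambda>\<omega>. calendar Z \<tau> t \<omega> \<in> A) \<omega>
     = cprob M (generated M S {s} (calendar Z \<tau>)) (\<lambda>\<omega>. calendar Z \<tau> t \<omega> \<in> A) \<omega>"
    by eventually_elim simp
qed

end

lemma sufficient_projection_markov:
  assumes "\<pi> \<in> measurable S R"
    and "sufficient_for_future M SA X R (\<lambda>t \<omega>. \<pi> (calendar Z \<tau> t \<omega>))"
  shows "markov_process M R (\<lambda>t \<omega>. \<pi> (calendar Z \<tau> t \<omega>))"
proof (rule sufficient_imp_markov[OF prob_space_axioms _ _ _ assms(2)])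
  show "markov_process M SA X"
    using homogeneous_markov_calendar_age by (simp add: homogeneous_markov_process_def)
  show "(\<lambda>x. \<pi> (fst x)) \<in> measurable SA R"
    using assms(1) by measurable
qed (simp add: calendar_fst)

end

section \<open>Independent holding times\<close>

text \<open>If the pair process is Markov, sufficiency would make \<open>Y\<close> Markov; so a
  non-Markov \<open>Y\<close> exhibits the relevance of \<open>C\<close>.\<close>

lemma not_dynamically_relevant_iff:
  "\<not> dynamically_relevant M R Y V C \<longleftrightarrow>
     sufficient_for_future M (R \<Otimes>\<^sub>M V) (\<lambda>u \<omega>. (Y u \<omega>, C u \<omega>)) R Y"
  unfolding dynamically_relevant_def sufficient_for_future_def by blast

text \<open>The common frame of both examples: deterministic states and independent, identically
  distributed waiting times. The level \<open>\<delta>\<close> is exceeded with positive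
  probability, hence infinitely often, which rules out explosion.\<close>

locale iid_renewal =
  fixes \<rho> :: "real measure" and next_state :: "'z \<Rightarrow> 'z" and z\<^sub>0 :: 'z and \<delta> :: real
  assumes \<rho>_prob: "prob_space \<rho>" and \<rho>_sets [measurable_cong, simp]: "sets \<rho> = sets borel"
    and \<rho>_pos: "AE x in \<rho>. 0 < x"
    and \<delta>: "0 < \<delta>" "0 < measure \<rho> {\<delta><..}"
begin

sublocale \<rho>: prob_space \<rho> by (rule \<rho>_prob)

sublocale product: product_prob_space "\<lambda>_::nat. \<rho>" UNIV
  by unfold_locales

definition \<Omega> :: "(nat \<Rightarrow> real) measure" where
  "\<Omega> = PiM UNIV (\<lambda>_. \<rho>)"

text \<open>Sample points are arbitrary real sequences, but holding times must be positive everywhere.\<close>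

definition clip :: "real \<Rightarrow> real" where
  "clip x = (if 0 < x then x else 1)"

definition hold :: "nat \<Rightarrow> (nat \<Rightarrow> real) \<Rightarrow> real" where
  "hold n \<omega> = clip (\<omega> n)"

definition state :: "nat \<Rightarrow> (nat \<Rightarrow> real) \<Rightarrow> 'z" where
  "state n \<omega> = (next_state ^^ n) z\<^sub>0"

definition kern :: "'z \<Rightarrow> ('z \<times> real) measure" where
  "kern z = distr \<rho> (count_space UNIV \<Otimes>\<^sub>M borel) (\<lambda>u. (next_state z, clip u))"

sublocale \<Omega>: prob_space \<Omega>
  unfolding \<Omega>_def by (rule product.P.prob_space_axioms)

lemma space_\<Omega> [simp]: "space \<Omega> = UNIV"
proof -
  have "space \<rho> = UNIV" using sets_eq_imp_space_eq[OF \<rho>_sets] by simp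
  then show ?thesis by (simp add: \<Omega>_def space_PiM)
qed

lemma clip_measurable [measurable]: "clip \<in> borel_measurable borel"
  unfolding clip_def[abs_def] by measurable

lemma clip_pos: "0 < clip x"
  by (simp add: clip_def)

lemma component_measurable: "(\<lambda>\<omega>. \<omega> n) \<in> borel_measurable \<Omega>"
  unfolding \<Omega>_def using measurable_component_singleton[of n UNIV "\<lambda>_. \<rho>"]
  by (simp cong: measurable_cong_sets)

lemma hold_measurable [measurable]: "hold n \<in> borel_measurable \<Omega>"
proof -
  have "(\<lambda>\<omega>. clip (\<omega> n)) \<in> borel_measurable \<Omega>"
    using component_measurable clip_measurable by (rule measurable_compose)
  then show ?thesis by (simp add: hold_def[abs_def])
qed

lemma state_measurable: "state n \<in> measurable \<Omega> (count_space UNIV)"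
  by (simp add: state_def[abs_def])

lemma state_Suc: "state (Suc n) \<omega> = next_state (state n \<omega>)"
  by (simp add: state_def)

lemma renewal_kernel_kern: "renewal_kernel (count_space UNIV) kern"
  unfolding renewal_kernel_def
proof (intro conjI ballI)
  show "kern \<in> measurable (count_space UNIV) (prob_algebra (count_space UNIV \<Otimes>\<^sub>M borel))"
    by (auto simp: space_prob_algebra kern_def intro!: \<rho>.prob_space_distr)
  fix z :: 'z
  show "AE (z', u) in kern z. 0 < u"
    unfolding kern_def by (subst AE_distr_iff) (auto simp: clip_pos)
qed

lemma indep_coordinates: "\<Omega>.indep_vars (\<lambda>_. \<rho>) (\<lambda>i \<omega>. \<omega> i) UNIV"
proof (subst \<Omega>.indep_vars_iff_distr_eq_PiM)
  have id: "(\<lambda>x. x) \<in> measurable \<Omega> \<Omega>" by simp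
  have "distr \<Omega> \<rho> (\<lambda>\<omega>. \<omega> i) = \<rho>" for i
    unfolding \<Omega>_def using product.PiM_component[of i] by simp
  then show "distr \<Omega> (PiM UNIV (\<lambda>_. \<rho>)) (\<lambda>x. \<lambda>i\<in>UNIV. x i) = (\<Pi>\<^sub>M i\<in>UNIV. distr \<Omega> \<rho> (\<lambda>x. x i))"
    by (simp add: \<Omega>_def[symmetric] distr_id2 restrict_def)
qed (auto simp: component_measurable cong: measurable_cong_sets)

text \<open>The states are constants, so the history depends only on the coordinates up to
  \<open>n\<close>. It is pulled back through their restriction \<open>r\<close>, which is
  independent of coordinate \<open>Suc n\<close>.\<close>

lemma history_independent:
  assumes G: "G \<in> sets (event_history \<Omega> (count_space UNIV) state hold n)" and I: "I \<in> sets borel"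
  shows "measure \<Omega> (G \<inter> {\<omega>. hold (Suc n) \<omega> \<in> I}) = measure \<Omega> G * measure \<rho> (clip -` I)"
proof -
  define r :: "(nat \<Rightarrow> real) \<Rightarrow> nat \<Rightarrow> real" where "r = (\<lambda>\<omega>. restrict (\<lambda>i. \<omega> i) {..n})"
  define P where "P = PiM {..n} (\<lambda>_::nat. \<rho>)"
  define N where "N = vimage_algebra UNIV r P"
  have r: "r \<in> UNIV \<rightarrow> space P"
    using sets_eq_imp_space_eq[OF \<rho>_sets] by (auto simp: r_def P_def space_PiM)
  have rN: "r \<in> measurable N P"
    unfolding N_def by (rule measurable_vimage_algebra1[OF r])
  have "sets (event_history \<Omega> (count_space UNIV) state hold n) \<subseteq> sets N"
  proof (rule sets_event_history_subset)
    show "space N = space \<Omega>" by (simp add: N_def)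
    show "state m \<in> measurable N (count_space UNIV)" for m
      by (simp add: state_def[abs_def])
    fix m assume "m < n"
    then have "(\<lambda>x. x (Suc m)) \<in> measurable P \<rho>"
      unfolding P_def by (intro measurable_component_singleton) simp
    from measurable_compose[OF rN this] have "(\<lambda>\<omega>. r \<omega> (Suc m)) \<in> borel_measurable N"
      by (simp cong: measurable_cong_sets)
    then have "(\<lambda>\<omega>. clip (r \<omega> (Suc m))) \<in> borel_measurable N"
      by measurable
    then show "hold (Suc m) \<in> borel_measurable N"
      using \<open>m < n\<close> by (simp add: hold_def[abs_def] r_def)
  qed
  then obtain B where B: "B \<in> sets P" "G = r -` B"
    using G sets_vimage_algebra2[OF r] unfolding N_def by auto
  define C where "C = (\<lambda>x::nat \<Rightarrow> real. x (Suc n)) -` (clip -` I) \<inter> space (PiM {Suc n} (\<lambda>_. \<rho>))"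
  have J [measurable]: "clip -` I \<in> sets borel"
    using measurable_sets[OF clip_measurable I] by simp
  have "(\<lambda>x. x (Suc n)) \<in> measurable (PiM {Suc n} (\<lambda>_. \<rho>)) \<rho>"
    by (intro measurable_component_singleton) simp
  then have C: "C \<in> sets (PiM {Suc n} (\<lambda>_. \<rho>))"
    unfolding C_def by (rule measurable_sets) simp
  have sp: "restrict (\<lambda>i. \<omega> i) {Suc n} \<in> space (PiM {Suc n} (\<lambda>_. \<rho>))" for \<omega> :: "nat \<Rightarrow> real"
    using sets_eq_imp_space_eq[OF \<rho>_sets] by (auto simp: space_PiM)
  have "\<Omega>.indep_var P r (PiM {Suc n} (\<lambda>_. \<rho>)) (\<lambda>\<omega>. restrict (\<lambda>i. \<omega> i) {Suc n})"
    unfolding P_def r_def by (rule \<Omega>.indep_var_restrict[OF indep_coordinates]) auto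
  from \<Omega>.indep_varD[OF this B(1) C]
  have "measure \<Omega> ((\<lambda>\<omega>. (r \<omega>, restrict (\<lambda>i. \<omega> i) {Suc n})) -` (B \<times> C)) =
     measure \<Omega> (r -` B) * measure \<Omega> ((\<lambda>\<omega>. restrict (\<lambda>i. \<omega> i) {Suc n}) -` C)" by simp
  moreover have "(\<lambda>\<omega>. restrict (\<lambda>i. \<omega> i) {Suc n}) -` C = {\<omega>. hold (Suc n) \<omega> \<in> I}"
    using sp by (auto simp: C_def hold_def)
  moreover have "(\<lambda>\<omega>. (r \<omega>, restrict (\<lambda>i. \<omega> i) {Suc n})) -` (B \<times> C) =
      r -` B \<inter> (\<lambda>\<omega>. restrict (\<lambda>i. \<omega> i) {Suc n}) -` C" by auto
  moreover have "measure \<Omega> {\<omega>. hold (Suc n) \<omega> \<in> I} = measure \<rho> (clip -` I)"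
    using product.emeasure_PiM_Collect_single[of "Suc n" "clip -` I"]
    by (simp add: measure_def hold_def \<Omega>_def[symmetric])
  ultimately show ?thesis by (simp add: B(2))
qed

text \<open>Since the next waiting time is independent of the history and the next state is
  deterministic, the conditional probability is the constant \<open>c\<close>, which is also the
  value of the kernel on the rectangle.\<close>

lemma markov_renewal_iid: "markov_renewal \<Omega> (count_space UNIV) kern state hold"
  unfolding markov_renewal_def
proof (intro conjI allI ballI impI)
  fix n and E :: "'z set" and I :: "real set"
  assume I: "I \<in> sets borel"
  let ?F = "event_history \<Omega> (count_space UNIV) state hold n"
  define c where "c = of_bool ((next_state ^^ Suc n) z\<^sub>0 \<in> E) * measure \<rho> (clip -` I)"
  have sub: "subalgebra \<Omega> ?F"
  proof -
    have "sets ?F \<subseteq> sets \<Omega>"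
      by (rule sets_event_history_subset) (auto simp: state_measurable)
    then show ?thesis by (simp add: subalgebra_def event_history_def space_measure_of_conv)
  qed
  have D: "{\<omega> \<in> space \<Omega>. state (Suc n) \<omega> \<in> E \<and> hold (Suc n) \<omega> \<in> I} =
      (if (next_state ^^ Suc n) z\<^sub>0 \<in> E then {\<omega>. hold (Suc n) \<omega> \<in> I} else {})"
    by (auto simp: state_def)
  have [measurable]: "{\<omega>. hold (Suc n) \<omega> \<in> I} \<in> sets \<Omega>"
    using measurable_sets[OF hold_measurable I, of "Suc n"] by (simp add: vimage_def)
  have c: "measure (kern (state n \<omega>)) (E \<times> I) = c" for \<omega>
  proof -
    have "(\<lambda>u. (next_state (state n \<omega>), clip u)) -` (E \<times> I) \<inter> space \<rho> =
      (if (next_state ^^ Suc n) z\<^sub>0 \<in> E then clip -` I else {})"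
      using sets_eq_imp_space_eq[OF \<rho>_sets] by (auto simp: state_def)
    then show ?thesis
      unfolding kern_def c_def using I by (subst measure_distr) auto
  qed
  have "AE \<omega> in \<Omega>. cprob \<Omega> ?F (\<lambda>\<omega>. state (Suc n) \<omega> \<in> E \<and> hold (Suc n) \<omega> \<in> I) \<omega> = c"
  proof (rule cprob_eqI[OF \<Omega>.prob_space_axioms sub])
    show "{\<omega> \<in> space \<Omega>. state (Suc n) \<omega> \<in> E \<and> hold (Suc n) \<omega> \<in> I} \<in> sets \<Omega>"
      unfolding D by simp
    show "(\<integral>\<omega>\<in>G. indicator {\<omega> \<in> space \<Omega>. state (Suc n) \<omega> \<in> E \<and> hold (Suc n) \<omega> \<in> I} \<omega> \<partial>\<Omega>) = (\<integral>\<omega>\<in>G. c \<partial>\<Omega>)"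
      if G: "G \<in> sets ?F" for G
    proof -
      have [measurable]: "G \<in> sets \<Omega>" using G sub by (auto simp: subalgebra_def)
      show ?thesis
        unfolding D using history_independent[OF G I]
        by (simp add: set_lebesgue_integral_def c_def indicator_inter_arith[symmetric])
    qed
  qed (auto simp: c_def)
  then show "AE \<omega> in \<Omega>. cprob \<Omega> ?F (\<lambda>\<omega>. state (Suc n) \<omega> \<in> E \<and> hold (Suc n) \<omega> \<in> I) \<omega>
      = measure (kern (state n \<omega>)) (E \<times> I)"
    by (simp add: c)
qed (auto simp: \<Omega>.prob_space_axioms renewal_kernel_kern state_measurable clip_pos hold_def)

lemma measure_box:
  assumes "finite J" "\<And>i. i \<in> J \<Longrightarrow> A i \<in> sets borel"
  shows "measure \<Omega> {\<omega>. \<forall>i\<in>J. \<omega> i \<in> A i} = (\<Prod>i\<in>J. measure \<rho> (A i))"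
proof -
  have "emeasure \<Omega> {\<omega> \<in> space \<Omega>. \<forall>i\<in>J. \<omega> i \<in> A i} = (\<Prod>i\<in>J. emeasure \<rho> (A i))"
    unfolding \<Omega>_def using assms by (intro product.emeasure_PiM_Collect) auto
  then show ?thesis
    by (simp add: \<rho>.emeasure_eq_measure \<Omega>.emeasure_eq_measure prod_ennreal prod_nonneg)
qed

text \<open>The probability that all coordinates from \<open>m\<close> on are at most
  \<open>\<delta>\<close> is below every power of \<open>?q < 1\<close>, hence 0. So infinitely many
  waiting times exceed \<open>\<delta>\<close>, and each raises the epochs by more than
  \<open>\<delta>\<close>.\<close>

lemma non_explosive_iid: "non_explosive \<Omega> hold"
proof -
  note [measurable] = component_measurable
  let ?q = "measure \<rho> {..\<delta>}"
  have q: "?q < 1"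
  proof -
    have "measure \<rho> {\<delta><..} = 1 - ?q"
      using \<rho>.prob_compl[of "{..\<delta>}"] sets_eq_imp_space_eq[OF \<rho>_sets]
      by (simp add: Compl_eq_Diff_UNIV[symmetric] not_le Compl_atMost)
    then show ?thesis using \<delta>(2) by simp
  qed
  have "AE \<omega> in \<Omega>. \<exists>j\<ge>m. \<delta> < \<omega> j" for m :: nat
  proof -
    have [measurable]: "{\<omega>. \<forall>j\<ge>m. \<omega> j \<le> \<delta>} \<in> sets \<Omega>"
    proof -
      have "{\<omega> \<in> space \<Omega>. \<forall>j\<ge>m. \<omega> j \<le> \<delta>} \<in> sets \<Omega>" by measurable
      then show ?thesis by simp
    qed
    have "measure \<Omega> {\<omega>. \<forall>j\<ge>m. \<omega> j \<le> \<delta>} \<le> ?q ^ k" for k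
    proof -
      have "{\<omega> \<in> space \<Omega>. \<forall>j\<in>{m..<m + k}. \<omega> j \<in> {..\<delta>}} \<in> sets \<Omega>" by measurable
      then have "measure \<Omega> {\<omega>. \<forall>j\<ge>m. \<omega> j \<le> \<delta>} \<le> measure \<Omega> {\<omega>. \<forall>j\<in>{m..<m + k}. \<omega> j \<in> {..\<delta>}}"
        by (intro \<Omega>.finite_measure_mono) auto
      also have "\<dots> = ?q ^ k"
        by (subst measure_box) auto
      finally show ?thesis .
    qed
    moreover have "(\<lambda>k. ?q ^ k) \<longlonglongrightarrow> 0"
      using q by (intro LIMSEQ_realpow_zero) auto
    ultimately have "measure \<Omega> {\<omega>. \<forall>j\<ge>m. \<omega> j \<le> \<delta>} \<le> 0"
      by (intro LIMSEQ_le_const) auto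
    then have "AE \<omega> in \<Omega>. \<omega> \<notin> {\<omega>. \<forall>j\<ge>m. \<omega> j \<le> \<delta>}"
      by (subst \<Omega>.prob_eq_0[symmetric]) (auto intro: antisym)
    then show ?thesis by (simp add: not_le)
  qed
  then have "AE \<omega> in \<Omega>. \<forall>m. \<exists>j\<ge>m. \<delta> < \<omega> j"
    by (simp add: AE_all_countable)
  then show ?thesis
    unfolding non_explosive_def
  proof eventually_elim
    case (elim \<omega>)
    have T_Suc: "epoch hold (Suc n) \<omega> = epoch hold n \<omega> + clip (\<omega> (Suc n))" for n
      by (simp add: epoch_def hold_def)
    have mono: "epoch hold m \<omega> \<le> epoch hold n \<omega>" if "m \<le> n" for m n
      by (rule lift_Suc_mono_le[of "\<lambda>n. epoch hold n \<omega>", OF _ that]) (simp add: T_Suc less_imp_le clip_pos)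
    have unbounded: "\<exists>n. of_nat k * \<delta> \<le> epoch hold n \<omega>" for k
    proof (induction k)
      case 0
      show ?case by (intro exI[of _ 0]) (simp add: epoch_def)
    next
      case (Suc k)
      then obtain n where n: "of_nat k * \<delta> \<le> epoch hold n \<omega>" by blast
      obtain j where j: "Suc n \<le> j" "\<delta> < \<omega> j" using elim by blast
      then obtain i where i: "j = Suc i" "n \<le> i" by (cases j) auto
      have "\<delta> < clip (\<omega> (Suc i))" using j i \<delta>(1) by (simp add: clip_def)
      then have "of_nat (Suc k) * \<delta> \<le> epoch hold (Suc i) \<omega>"
        using n mono[OF i(2)] by (simp add: T_Suc algebra_simps)
      then show ?case by blast
    qed
    show ?case
      unfolding filterlim_at_top eventually_sequentially
    proof
      fix C :: real
      obtain k :: nat where "C / \<delta> \<le> k" using real_arch_simple by blast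
      then have "C \<le> k * \<delta>" using \<delta>(1) by (simp add: pos_divide_le_eq)
      moreover obtain n where "k * \<delta> \<le> epoch hold n \<omega>" using unbounded by blast
      ultimately have "\<forall>m\<ge>n. C \<le> epoch hold m \<omega>"
        using mono order_trans by meson
      then show "\<exists>n. \<forall>m\<ge>n. C \<le> epoch hold m \<omega>" by blast
    qed
  qed
qed

sublocale markov_renewal_process \<Omega> "count_space UNIV" kern state hold
  by unfold_locales (rule markov_renewal_iid non_explosive_iid)+

lemma hold_pos_eq: "0 < \<omega> n \<Longrightarrow> hold n \<omega> = \<omega> n"
  by (simp add: hold_def clip_def)

lemma T_1: "T (Suc 0) \<omega> = hold 1 \<omega>"
  and T_2: "T (Suc (Suc 0)) \<omega> = hold 1 \<omega> + hold 2 \<omega>"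
  and T_3: "T (Suc (Suc (Suc 0))) \<omega> = hold 1 \<omega> + hold 2 \<omega> + hold 3 \<omega>"
  by (simp_all add: epoch_def numeral_2_eq_2 numeral_3_eq_3)

lemma calendar_event_measurable:
  assumes "0 \<le> r" "0 \<le> s" "0 \<le> t"
  shows "{\<omega> \<in> space \<Omega>. P (calendar state hold r \<omega>) (calendar state hold s \<omega>) (calendar state hold t \<omega>)} \<in> sets \<Omega>"
proof -
  note [measurable] = event_count_measurable[OF assms(1)] event_count_measurable[OF assms(2)] event_count_measurable[OF assms(3)]
  show ?thesis
    unfolding calendar_def state_def by measurable
qed

end

section \<open>Counterexamples\<close>

context iid_renewal
begin

text \<open>In the examples three waiting times suffice to fix both calendar values, so a box in
  these coordinates bounds the probability from below.\<close>

lemma measure_calendar_pos: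
  fixes a b :: "nat \<Rightarrow> real"
  assumes r: "0 \<le> r" "0 \<le> s"
    and box: "\<And>\<omega>. \<omega> 1 \<in> {a 1..b 1} \<Longrightarrow> \<omega> 2 \<in> {a 2..b 2} \<Longrightarrow> \<omega> 3 \<in> {a 3..b 3} \<Longrightarrow>
      P (calendar state hold r \<omega>) (calendar state hold s \<omega>)"
    and pos: "\<And>i. i \<in> {1, 2, 3} \<Longrightarrow> 0 < measure \<rho> {a i..b i}"
  shows "0 < measure \<Omega> {\<omega> \<in> space \<Omega>. P (calendar state hold r \<omega>) (calendar state hold s \<omega>)}"
proof -
  have "0 < (\<Prod>i\<in>{1, 2, 3}. measure \<rho> {a i..b i})"
    using pos by (intro prod_pos) blast
  also have "\<dots> = measure \<Omega> {\<omega>. \<forall>i\<in>{1, 2, 3}. \<omega> i \<in> {a i..b i}}"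
    by (rule measure_box[symmetric]) auto
  also have "\<dots> \<le> measure \<Omega> {\<omega> \<in> space \<Omega>. P (calendar state hold r \<omega>) (calendar state hold s \<omega>)}"
    using box calendar_event_measurable[OF r r(2), of "\<lambda>x y _. P x y"]
    by (intro \<Omega>.finite_measure_mono) auto
  finally show ?thesis .
qed

end

text \<open>The flag counts events up to 2 and the first component is visible: 0, 1, 0, 0, ... . Seeing 1
  before the present 0 excludes another 1.\<close>

definition flag_next :: "nat \<times> nat \<Rightarrow> nat \<times> nat" where
  "flag_next x = (if snd x = 0 then (1, 1) else (0, 2))"

section \<open>Memoryless waiting times with a hidden flag\<close>

definition exp_law :: "real measure" where
  "exp_law = density lborel (exponential_density 1)"

lemma exp_law_interval_pos:
  assumes "0 \<le> a" "a < b"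
  shows "0 < measure exp_law {a..b}"
proof -
  interpret prob_space exp_law
    unfolding exp_law_def by (rule prob_space_exponential_density) simp
  have "0 < ennreal (exp (- b)) * ennreal (b - a)"
    using assms by (simp add: ennreal_mult[symmetric])
  also have "\<dots> = (\<integral>\<^sup>+x. ennreal (exp (- b)) * indicator {a..b} x \<partial>lborel)"
    using assms by (simp add: nn_integral_cmult)
  also have "\<dots> \<le> (\<integral>\<^sup>+x. ennreal (exponential_density 1 x) * indicator {a..b} x \<partial>lborel)"
    using assms by (intro nn_integral_mono) (auto simp: exponential_density_def indicator_def)
  also have "\<dots> = emeasure exp_law {a..b}"
    unfolding exp_law_def by (subst emeasure_density) auto
  finally show ?thesis by (simp add: emeasure_eq_measure)
qed

text \<open>Memorylessness in integral form: the substitution \<open>u = a + v\<close> splits the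
  density into \<open>exp (- a)\<close> and the density at \<open>v\<close>.\<close>

lemma nn_integral_exp_law_shift:
  assumes [measurable]: "h \<in> borel_measurable borel" and "0 \<le> a"
  shows "(\<integral>\<^sup>+u. indicator {a<..} u * h (u - a) \<partial>exp_law) =
    ennreal (exp (- a)) * (\<integral>\<^sup>+v. indicator {0<..} v * h v \<partial>exp_law)"
proof -
  have "(\<integral>\<^sup>+u. indicator {a<..} u * h (u - a) \<partial>exp_law) =
     (\<integral>\<^sup>+u. ennreal (exponential_density 1 u) * (indicator {a<..} u * h (u - a)) \<partial>lborel)"
    unfolding exp_law_def by (rule nn_integral_density) auto
  also have "\<dots> = (\<integral>\<^sup>+v. ennreal (exponential_density 1 (a + 1 * v)) * (indicator {a<..} (a + 1 * v) * h (a + 1 * v - a)) \<partial>lborel)"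
    by (subst nn_integral_real_affine[where t = a and c = 1]) auto
  also have "\<dots> = (\<integral>\<^sup>+v. ennreal (exp (- a)) * (ennreal (exponential_density 1 v) * (indicator {0<..} v * h v)) \<partial>lborel)"
  proof (rule nn_integral_cong)
    fix v :: real
    show "ennreal (exponential_density 1 (a + 1 * v)) * (indicator {a<..} (a + 1 * v) * h (a + 1 * v - a)) =
       ennreal (exp (- a)) * (ennreal (exponential_density 1 v) * (indicator {0<..} v * h v))"
      using assms(2)
      by (cases "0 < v") (simp_all add: exponential_density_def exp_add[symmetric] ennreal_mult[symmetric] mult.assoc[symmetric])
  qed
  also have "\<dots> = ennreal (exp (- a)) * (\<integral>\<^sup>+v. ennreal (exponential_density 1 v) * (indicator {0<..} v * h v) \<partial>lborel)"
    by (rule nn_integral_cmult) measurable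
  also have "(\<integral>\<^sup>+v. ennreal (exponential_density 1 v) * (indicator {0<..} v * h v) \<partial>lborel) = (\<integral>\<^sup>+v. indicator {0<..} v * h v \<partial>exp_law)"
    unfolding exp_law_def by (rule nn_integral_density[symmetric]) auto
  finally show ?thesis .
qed

lemma AE_exp_law_pos: "AE x in exp_law. 0 < x"
proof -
  have "AE x in lborel. x \<noteq> (0::real)"
    by (rule AE_lborel_singleton)
  then show ?thesis
    unfolding exp_law_def
    by (subst AE_density) (auto simp: exponential_density_def elim!: AE_mp)
qed

interpretation flag: iid_renewal exp_law flag_next "(0, 0)" 1
proof (rule iid_renewal.intro)
  interpret prob_space exp_law
    unfolding exp_law_def by (rule prob_space_exponential_density) simp
  show "prob_space exp_law" by (rule prob_space_axioms)
  show "sets exp_law = sets borel" by (simp add: exp_law_def)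
  show "AE x in exp_law. 0 < x" by (rule AE_exp_law_pos)
  have "0 < measure exp_law {2..3}" by (rule exp_law_interval_pos) auto
  also have "\<dots> \<le> measure exp_law {1<..}"
    by (rule finite_measure_mono) (auto simp: exp_law_def)
  finally show "0 < measure exp_law {1<..}" .
qed auto

text \<open>The shift by the age produces the factor \<open>exp (- a)\<close>, which is the survival
  probability and cancels in the residual law; \<open>clip\<close> is almost surely the
  identity.\<close>

lemma flag_age_independent: "age_independent (count_space UNIV) flag.kern"
proof -
  let ?Q = flag.kern
  have I: "(\<integral>\<^sup>+(z', u). indicator {a<..} u * f (z', u - a) \<partial>?Q z) =
     ennreal (exp (- a)) * (\<integral>\<^sup>+v. indicator {0<..} v * f (flag_next z, v) \<partial>exp_law)"
    if [measurable]: "f \<in> borel_measurable (count_space UNIV \<Otimes>\<^sub>M borel)" and "0 \<le> a" for f z a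
  proof -
    have [measurable]: "(\<lambda>v. f (flag_next z, v)) \<in> borel_measurable borel" by measurable
    have "(\<integral>\<^sup>+(z', u). indicator {a<..} u * f (z', u - a) \<partial>?Q z) =
       (\<integral>\<^sup>+u. indicator {a<..} (flag.clip u) * f (flag_next z, flag.clip u - a) \<partial>exp_law)"
      unfolding flag.kern_def split_beta' by (subst nn_integral_distr) auto
    also have "\<dots> = (\<integral>\<^sup>+u. indicator {a<..} u * f (flag_next z, u - a) \<partial>exp_law)"
      using AE_exp_law_pos by (intro nn_integral_cong_AE) (auto simp: flag.clip_def)
    also have "\<dots> = ennreal (exp (- a)) * (\<integral>\<^sup>+v. indicator {0<..} v * f (flag_next z, v) \<partial>exp_law)"
      using that(2) by (intro nn_integral_exp_law_shift) auto
    finally show ?thesis .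
  qed
  have "(\<integral>\<^sup>+v. indicator {0<..} v * 1 \<partial>exp_law) = (\<integral>\<^sup>+v. 1 \<partial>exp_law)"
    using AE_exp_law_pos by (intro nn_integral_cong_AE) auto
  then have one: "(\<integral>\<^sup>+v. indicator {0<..} v * 1 \<partial>exp_law) = 1"
    by (simp add: flag.\<rho>.emeasure_space_1)
  have surv: "flag.surv z a = ennreal (exp (- a))" if "0 \<le> a" for z a
    using I[of "\<lambda>_. 1" a z] that one by (simp add: flag.surv_nn_integral)
  have N: "(\<integral>\<^sup>+y. f y \<partial>residual_law (count_space UNIV) ?Q z a) = (\<integral>\<^sup>+v. indicator {0<..} v * f (flag_next z, v) \<partial>exp_law)"
    if "f \<in> borel_measurable (count_space UNIV \<Otimes>\<^sub>M borel)" "0 \<le> a" for f z a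
  proof -
    have "(\<integral>\<^sup>+y. f y \<partial>residual_law (count_space UNIV) ?Q z a) = ennreal (exp (- a)) * (\<integral>\<^sup>+v. indicator {0<..} v * f (flag_next z, v) \<partial>exp_law) / ennreal (exp (- a))"
      using flag.nn_integral_residual_law[of z f a] I[OF that] surv[OF that(2)] that(1) by simp
    also have "\<dots> = (\<integral>\<^sup>+v. indicator {0<..} v * f (flag_next z, v) \<partial>exp_law)"
      by (subst mult.commute, rule ennreal_mult_divide_eq) auto
    finally show ?thesis .
  qed
  have "residual_law (count_space UNIV) ?Q z a = residual_law (count_space UNIV) ?Q z b" if "0 \<le> a" "0 \<le> b" for z a b
  proof (rule measure_eqI)
    fix A assume "A \<in> sets (residual_law (count_space UNIV) ?Q z a)"
    then have A [measurable]: "A \<in> sets (count_space UNIV \<Otimes>\<^sub>M borel)"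
      by (simp add: residual_law_def)
    have "emeasure (residual_law (count_space UNIV) ?Q z c) A = (\<integral>\<^sup>+v. indicator {0<..} v * indicator A (flag_next z, v) \<partial>exp_law)"
      if "0 \<le> c" for c
    proof -
      have "A \<in> sets (residual_law (count_space UNIV) ?Q z c)" using A by (simp add: residual_law_def)
      then show ?thesis using N[of "indicator A" c z] that by simp
    qed
    then show "emeasure (residual_law (count_space UNIV) ?Q z a) A = emeasure (residual_law (count_space UNIV) ?Q z b) A"
      using that by simp
  qed (simp add: residual_law_def)
  then show ?thesis unfolding age_independent_def by blast
qed

lemma flag_state: "flag.state n \<omega> = (if n = 0 then (0, 0) else if n = 1 then (1, 1) else (0, 2))"
proof (induction n)
  case 0
  show ?case by (simp add: flag.state_def)
next
  case (Suc n)
  show ?case unfolding flag.state_Suc Suc by (simp add: flag_next_def)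
qed

lemma flag_projection_not_markov:
  "\<not> markov_process flag.\<Omega> (count_space UNIV) (\<lambda>t \<omega>. fst (calendar flag.state flag.hold t \<omega>))"
proof (rule not_markovI[where r = 1 and s = 2 and t = 3 and B = "{1}" and x = 0 and A = "{1}"])
  let ?X = "calendar flag.state flag.hold"
  have fst1: "n = 1" if "fst (flag.state n \<omega>) = 1" for n \<omega>
    using that by (simp add: flag_state split: if_splits)
  show "measure flag.\<Omega> {\<omega> \<in> space flag.\<Omega>. fst (?X 1 \<omega>) \<in> {1} \<and> fst (?X 2 \<omega>) = 0 \<and> fst (?X 3 \<omega>) \<in> {1}} = 0"
  proof (subst flag.\<Omega>.prob_eq_0)
    show "{\<omega> \<in> space flag.\<Omega>. fst (?X 1 \<omega>) \<in> {1} \<and> fst (?X 2 \<omega>) = 0 \<and> fst (?X 3 \<omega>) \<in> {1}} \<in> sets flag.\<Omega>"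
      by (rule flag.calendar_event_measurable) auto
    have "AE \<omega> in flag.\<Omega>. \<exists>m. flag.T m \<omega> \<le> 1 \<and> 1 < flag.T (Suc m) \<omega>"
      "AE \<omega> in flag.\<Omega>. \<exists>m. flag.T m \<omega> \<le> 3 \<and> 3 < flag.T (Suc m) \<omega>"
      by (intro flag.AE_epoch; simp)+
    then show "AE \<omega> in flag.\<Omega>. \<omega> \<notin> {\<omega> \<in> space flag.\<Omega>. fst (?X 1 \<omega>) \<in> {1} \<and> fst (?X 2 \<omega>) = 0 \<and> fst (?X 3 \<omega>) \<in> {1}}"
    proof eventually_elim
      case (elim \<omega>)
      then obtain m n where m: "flag.T m \<omega> \<le> 1" "1 < flag.T (Suc m) \<omega>"
        and n: "flag.T n \<omega> \<le> 3" "3 < flag.T (Suc n) \<omega>" by blast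
      \<comment> \<open>The visible value 1 belongs to event 1 alone. Seeing it at times 1 and 3
        leaves no jump between them, so time 2 shows it as well.\<close>
      have "fst (?X 2 \<omega>) = 1" if "fst (?X 1 \<omega>) = 1" "fst (?X 3 \<omega>) = 1"
      proof -
        have "m = 1" "n = 1"
          using that fst1 flag.X_eq(2)[OF _ m] flag.X_eq(2)[OF _ n] by auto
        then have "?X 2 \<omega> = flag.state 1 \<omega>"
          using m n by (intro flag.X_eq(2)) auto
        then show ?thesis by (simp add: flag_state)
      qed
      then show ?case by auto
    qed
  qed
  show "0 < measure flag.\<Omega> {\<omega> \<in> space flag.\<Omega>. fst (?X 1 \<omega>) \<in> {1} \<and> fst (?X 2 \<omega>) = 0}"
  \<comment> \<open>The first jump comes by time 1; the second lies between 5/4 and 2, and the third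
    waiting time of at least 2 keeps the flag at 2 beyond time 2.\<close>
  proof (rule flag.measure_calendar_pos[where a = "\<lambda>i. if i = 1 then 1/2 else if i = 2 then 3/4 else 2" and b = "\<lambda>i. if i = 3 then 3 else 1"])
    fix \<omega> :: "nat \<Rightarrow> real"
    assume "\<omega> 1 \<in> {if 1 = (1::nat) then 1/2 else if 1 = (2::nat) then 3/4 else 2..if 1 = (3::nat) then 3 else 1}"
      "\<omega> 2 \<in> {if 2 = (1::nat) then 1/2 else if 2 = (2::nat) then 3/4 else 2..if 2 = (3::nat) then 3 else 1}"
      "\<omega> 3 \<in> {if 3 = (1::nat) then 1/2 else if 3 = (2::nat) then 3/4 else 2..if 3 = (3::nat) then 3 else 1}"
    then have w: "1/2 \<le> \<omega> 1" "\<omega> 1 \<le> 1" "3/4 \<le> \<omega> 2" "\<omega> 2 \<le> 1" "2 \<le> \<omega> 3" "\<omega> 3 \<le> 3" by auto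
    then have h: "flag.hold 1 \<omega> = \<omega> 1" "flag.hold 2 \<omega> = \<omega> 2" "flag.hold 3 \<omega> = \<omega> 3"
      by (auto intro!: flag.hold_pos_eq)
    have "?X 1 \<omega> = flag.state (Suc 0) \<omega>"
      by (rule flag.X_eq(2)) (use w h in \<open>auto simp: flag.T_1 flag.T_2\<close>)
    moreover have "?X 2 \<omega> = flag.state (Suc (Suc 0)) \<omega>"
      by (rule flag.X_eq(2)) (use w h in \<open>auto simp: flag.T_2 flag.T_3\<close>)
    ultimately show "fst (?X 1 \<omega>) \<in> {1} \<and> fst (?X 2 \<omega>) = 0" by (simp add: flag_state)
  qed (auto intro!: exp_law_interval_pos)
  show "0 < measure flag.\<Omega> {\<omega> \<in> space flag.\<Omega>. fst (?X 2 \<omega>) = 0 \<and> fst (?X 3 \<omega>) \<in> {1}}"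
  \<comment> \<open>The first jump falls between 5/2 and 3, the second not before 7/2.\<close>
  proof (rule flag.measure_calendar_pos[where a = "\<lambda>i. if i = 1 then 5/2 else 1" and b = "\<lambda>i. 3"])
    fix \<omega> :: "nat \<Rightarrow> real"
    assume "\<omega> 1 \<in> {if 1 = (1::nat) then 5/2 else 1..3}" "\<omega> 2 \<in> {if 2 = (1::nat) then 5/2 else 1..3}"
    then have w: "5/2 \<le> \<omega> 1" "\<omega> 1 \<le> 3" "1 \<le> \<omega> 2" by auto
    then have h: "flag.hold 1 \<omega> = \<omega> 1" "flag.hold 2 \<omega> = \<omega> 2"
      by (auto intro!: flag.hold_pos_eq)
    have "?X 2 \<omega> = flag.state 0 \<omega>"
      by (rule flag.X_eq(2)) (use w h in \<open>auto simp: flag.T_1\<close>)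
    moreover have "?X 3 \<omega> = flag.state (Suc 0) \<omega>"
      by (rule flag.X_eq(2)) (use w h in \<open>auto simp: flag.T_1 flag.T_2\<close>)
    ultimately show "fst (?X 2 \<omega>) = 0 \<and> fst (?X 3 \<omega>) \<in> {1}" by (simp add: flag_state)
  qed (auto intro!: exp_law_interval_pos)
qed (auto intro: flag.\<Omega>.prob_space_axioms)

lemma flag_calendar_markov: "markov_process flag.\<Omega> (count_space UNIV) (calendar flag.state flag.hold)"
  using flag.homogeneous_markov_calendar[OF flag_age_independent] by (simp add: homogeneous_markov_process_def)

text \<open>Visible component and flag together are the full state, which is Markov. If the flag
  were irrelevant, the visible component would be sufficient for its own future and hence
  Markov.\<close>

lemma flag_dynamically_relevant:
  "dynamically_relevant flag.\<Omega> (count_space UNIV) (\<lambda>t \<omega>. fst (calendar flag.state flag.hold t \<omega>))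
     (count_space UNIV) (\<lambda>t \<omega>. snd (calendar flag.state flag.hold t \<omega>))"
proof (rule ccontr)
  assume "\<not> ?thesis"
  then have "sufficient_for_future flag.\<Omega> (count_space UNIV) (calendar flag.state flag.hold)
     (count_space UNIV) (\<lambda>t \<omega>. fst (calendar flag.state flag.hold t \<omega>))"
    unfolding not_dynamically_relevant_iff by (simp add: pair_measure_countable)
  then have "markov_process flag.\<Omega> (count_space UNIV) (\<lambda>t \<omega>. fst (calendar flag.state flag.hold t \<omega>))"
    by (rule sufficient_imp_markov[OF flag.\<Omega>.prob_space_axioms flag_calendar_markov, rotated 2]) simp_all
  then show False using flag_projection_not_markov by contradiction
qed

section \<open>Bounded waiting times, where the age matters\<close>

definition unif_law :: "real measure" where
  "unif_law = uniform_measure lborel {1..2}"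

lemma unif_law_interval:
  assumes "1 \<le> a" "a \<le> b" "b \<le> 2"
  shows "measure unif_law {a..b} = b - a"
proof -
  have "{1..2} \<inter> {a..b} = {a..b}" using assms by auto
  then show ?thesis
    using assms by (simp add: unif_law_def measure_def divide_ennreal_def)
qed

text \<open>The chain runs 0, 1, 2, 2, ... with holding times in \<open>[1, 2]\<close>, so an early arrival in 1 forces
  an early departure.\<close>

definition chain_next :: "nat \<Rightarrow> nat" where
  "chain_next n = min (Suc n) 2"

lemma AE_unif_law: "AE x in unif_law. 1 \<le> x \<and> x \<le> 2"
  unfolding unif_law_def by (rule AE_uniform_measureI) auto

interpretation chain: iid_renewal unif_law chain_next 0 "1/2"
proof (rule iid_renewal.intro)
  interpret prob_space unif_law
    unfolding unif_law_def by (rule prob_space_uniform_measure) auto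
  show "prob_space unif_law" by (rule prob_space_axioms)
  show "sets unif_law = sets borel" by (simp add: unif_law_def)
  show "AE x in unif_law. 0 < x" using AE_unif_law by eventually_elim simp
  have "0 < measure unif_law {1..2}" by (simp add: unif_law_interval)
  also have "\<dots> \<le> measure unif_law {1/2<..}"
    by (rule finite_measure_mono) (auto simp: unif_law_def)
  finally show "0 < measure unif_law {1/2<..}" .
qed auto

lemma chain_state: "chain.state n \<omega> = min n 2"
proof (induction n)
  case 0
  show ?case by (simp add: chain.state_def)
next
  case (Suc n)
  show ?case unfolding chain.state_Suc Suc by (simp add: chain_next_def)
qed

lemma chain_not_markov: "\<not> markov_process chain.\<Omega> (count_space UNIV) (calendar chain.state chain.hold)"
proof (rule not_markovI[where r = "3/2" and s = "5/2" and t = "7/2" and B = "{1}" and x = 1 and A = "{1}"])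
  let ?X = "calendar chain.state chain.hold"
  have st1: "n = 1" if "chain.state n \<omega> = 1" for n \<omega>
    using that by (simp add: chain_state)
  show "measure chain.\<Omega> {\<omega> \<in> space chain.\<Omega>. ?X (3/2) \<omega> \<in> {1} \<and> ?X (5/2) \<omega> = 1 \<and> ?X (7/2) \<omega> \<in> {1}} = 0"
  proof (subst chain.\<Omega>.prob_eq_0)
    show "{\<omega> \<in> space chain.\<Omega>. ?X (3/2) \<omega> \<in> {1} \<and> ?X (5/2) \<omega> = 1 \<and> ?X (7/2) \<omega> \<in> {1}} \<in> sets chain.\<Omega>"
      by (rule chain.calendar_event_measurable) auto
    have "AE \<omega> in chain.\<Omega>. \<exists>m. chain.T m \<omega> \<le> 3/2 \<and> 3/2 < chain.T (Suc m) \<omega>"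
      "AE \<omega> in chain.\<Omega>. \<exists>m. chain.T m \<omega> \<le> 7/2 \<and> 7/2 < chain.T (Suc m) \<omega>"
      by (intro chain.AE_epoch; simp)+
    moreover have "AE \<omega> in chain.\<Omega>. 1 \<le> \<omega> 2 \<and> \<omega> 2 \<le> 2"
      unfolding chain.\<Omega>_def by (rule chain.product.AE_component[OF _ AE_unif_law]) simp
    ultimately show "AE \<omega> in chain.\<Omega>. \<omega> \<notin> {\<omega> \<in> space chain.\<Omega>. ?X (3/2) \<omega> \<in> {1} \<and> ?X (5/2) \<omega> = 1 \<and> ?X (7/2) \<omega> \<in> {1}}"
    proof eventually_elim
      case (elim \<omega>)
      then obtain m n where m: "chain.T m \<omega> \<le> 3/2" "3/2 < chain.T (Suc m) \<omega>"
        and n: "chain.T n \<omega> \<le> 7/2" "7/2 < chain.T (Suc n) \<omega>" by blast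
      \<comment> \<open>State 1 at both outer times means that the first epoch is at most 3/2 and
        the second beyond 7/2. The second waiting time would exceed 2, against its law.\<close>
      have False if "?X (3/2) \<omega> = 1" "?X (7/2) \<omega> = 1"
      proof -
        have "m = Suc 0" "n = Suc 0"
          using that st1 chain.X_eq(2)[OF _ m] chain.X_eq(2)[OF _ n] by auto
        then show False
          using m n elim chain.hold_pos_eq[of \<omega> 2] by (simp add: chain.T_1 chain.T_2)
      qed
      then show ?case by auto
    qed
  qed
  show "0 < measure chain.\<Omega> {\<omega> \<in> space chain.\<Omega>. ?X (3/2) \<omega> \<in> {1} \<and> ?X (5/2) \<omega> = 1}"
  \<comment> \<open>State 1 is entered by 3/2 and left no earlier than 5/4 + 3/2 = 11/4, after the
    present 5/2.\<close>
  proof (rule chain.measure_calendar_pos[where a = "\<lambda>i. if i = 1 then 5/4 else 3/2" and b = "\<lambda>i. if i = 1 then 3/2 else 2"])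
    fix \<omega> :: "nat \<Rightarrow> real"
    assume "\<omega> 1 \<in> {if 1 = (1::nat) then 5/4 else 3/2..if 1 = (1::nat) then 3/2 else 2}"
      "\<omega> 2 \<in> {if 2 = (1::nat) then 5/4 else 3/2..if 2 = (1::nat) then 3/2 else 2}"
    then have w: "5/4 \<le> \<omega> 1" "\<omega> 1 \<le> 3/2" "3/2 \<le> \<omega> 2" by auto
    then have h: "chain.hold 1 \<omega> = \<omega> 1" "chain.hold 2 \<omega> = \<omega> 2"
      by (auto intro!: chain.hold_pos_eq)
    have "?X (3/2) \<omega> = chain.state (Suc 0) \<omega>" "?X (5/2) \<omega> = chain.state (Suc 0) \<omega>"
      by (rule chain.X_eq(2), use w h in \<open>auto simp: chain.T_1 chain.T_2\<close>)+
    then show "?X (3/2) \<omega> \<in> {1} \<and> ?X (5/2) \<omega> = 1" by (simp add: chain_state)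
  qed (auto simp: unif_law_interval)
  show "0 < measure chain.\<Omega> {\<omega> \<in> space chain.\<Omega>. ?X (5/2) \<omega> = 1 \<and> ?X (7/2) \<omega> \<in> {1}}"
  \<comment> \<open>A late entry, between 15/8 and 2, lets state 1 last until 15/4 at least, beyond
    the final time 7/2.\<close>
  proof (rule chain.measure_calendar_pos[where a = "\<lambda>i. 15/8" and b = "\<lambda>i. 2"])
    fix \<omega> :: "nat \<Rightarrow> real"
    assume "\<omega> 1 \<in> {15/8..2}" "\<omega> 2 \<in> {15/8..2}"
    then have w: "15/8 \<le> \<omega> 1" "\<omega> 1 \<le> 2" "15/8 \<le> \<omega> 2" by auto
    then have h: "chain.hold 1 \<omega> = \<omega> 1" "chain.hold 2 \<omega> = \<omega> 2"
      by (auto intro!: chain.hold_pos_eq)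
    have "?X (5/2) \<omega> = chain.state (Suc 0) \<omega>" "?X (7/2) \<omega> = chain.state (Suc 0) \<omega>"
      by (rule chain.X_eq(2), use w h in \<open>auto simp: chain.T_1 chain.T_2\<close>)+
    then show "?X (5/2) \<omega> = 1 \<and> ?X (7/2) \<omega> \<in> {1}" by (simp add: chain_state)
  qed (auto simp: unif_law_interval)
qed (auto intro: chain.\<Omega>.prob_space_axioms)

text \<open>State and age together are Markov, so sufficiency of the state would make the calendar
  process Markov.\<close>

lemma chain_not_sufficient:
  "\<not> sufficient_for_future chain.\<Omega> (count_space UNIV \<Otimes>\<^sub>M borel) (calendar_age chain.state chain.hold)
     (count_space UNIV) (calendar chain.state chain.hold)"
proof
  assume *: "sufficient_for_future chain.\<Omega> (count_space UNIV \<Otimes>\<^sub>M borel)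
     (calendar_age chain.state chain.hold) (count_space UNIV) (calendar chain.state chain.hold)"
  have "markov_process chain.\<Omega> (count_space UNIV) (calendar chain.state chain.hold)"
    by (rule chain.sufficient_projection_markov[of "\<lambda>x. x", OF _ *]) simp
  then show False using chain_not_markov by contradiction
qed

lemma chain_dynamically_relevant:
  "dynamically_relevant chain.\<Omega> (count_space UNIV) (calendar chain.state chain.hold) borel (age chain.hold)"
proof -
  have "(\<lambda>u \<omega>. (calendar chain.state chain.hold u \<omega>, age chain.hold u \<omega>)) = calendar_age chain.state chain.hold"
    by (simp add: calendar_age_def fun_eq_iff)
  then have "\<not> ?thesis \<longleftrightarrow> sufficient_for_future chain.\<Omega> (count_space UNIV \<Otimes>\<^sub>M borel)
     (calendar_age chain.state chain.hold) (count_space UNIV) (calendar chain.state chain.hold)"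
    unfolding not_dynamically_relevant_iff by (rule arg_cong)
  then show ?thesis
    using chain_not_sufficient by blast
qed

theorem proposition2:
  fixes M :: "'w measure" and S :: "'z measure" and R :: "'x measure"
    and Q :: "'z \<Rightarrow> ('z \<times> real) measure"
    and Z :: "nat \<Rightarrow> 'w \<Rightarrow> 'z" and \<tau> :: "nat \<Rightarrow> 'w \<Rightarrow> real"
    and \<pi> :: "'z \<Rightarrow> 'x"
  assumes "markov_renewal M S Q Z \<tau>"
    and "non_explosive M \<tau>"
    and "\<pi> \<in> measurable S R"
  shows
    "(semi_markov_process M S Q (calendar Z \<tau>) \<and>
      homogeneous_markov_process M (S \<Otimes>\<^sub>M borel) (calendar_age Z \<tau>))
   \<and>
     ((age_independent S Q \<longrightarrow>
         sufficient_for_future M (S \<Otimes>\<^sub>M borel) (calendar_age Z \<tau>) S (calendar Z \<tau>) \<and>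
         homogeneous_markov_process M S (calendar Z \<tau>)) \<and>
      (\<exists>(M' :: (nat \<Rightarrow> real) measure) (Q' :: nat \<Rightarrow> (nat \<times> real) measure) Z' \<tau>'.
         markov_renewal M' (count_space UNIV) Q' Z' \<tau>' \<and> non_explosive M' \<tau>' \<and>
         \<not> markov_process M' (count_space UNIV) (calendar Z' \<tau>')))
   \<and>
     ((sufficient_for_future M (S \<Otimes>\<^sub>M borel) (calendar_age Z \<tau>) R (\<lambda>t \<omega>. \<pi> (calendar Z \<tau> t \<omega>)) \<longrightarrow>
         markov_process M R (\<lambda>t \<omega>. \<pi> (calendar Z \<tau> t \<omega>))) \<and>
      (\<exists>(M' :: (nat \<Rightarrow> real) measure) (Q' :: nat \<times> nat \<Rightarrow> ((nat \<times> nat) \<times> real) measure) Z' \<tau>'.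
         markov_renewal M' (count_space UNIV) Q' Z' \<tau>' \<and> non_explosive M' \<tau>' \<and>
         age_independent (count_space UNIV) Q' \<and>
         markov_process M' (count_space UNIV) (calendar Z' \<tau>') \<and>
         \<not> sufficient_for_future M' (count_space UNIV \<Otimes>\<^sub>M borel) (calendar_age Z' \<tau>')
             (count_space UNIV) (\<lambda>t \<omega>. fst (calendar Z' \<tau>' t \<omega>)) \<and>
         \<not> markov_process M' (count_space UNIV) (\<lambda>t \<omega>. fst (calendar Z' \<tau>' t \<omega>)) \<and>
         dynamically_relevant M' (count_space UNIV) (\<lambda>t \<omega>. fst (calendar Z' \<tau>' t \<omega>))
             (count_space UNIV) (\<lambda>t \<omega>. snd (calendar Z' \<tau>' t \<omega>))) \<and>
      (\<exists>(M' :: (nat \<Rightarrow> real) measure) (Q' :: nat \<Rightarrow> (nat \<times> real) measure) Z' \<tau>'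
          (\<pi>' :: nat \<Rightarrow> nat).
         markov_renewal M' (count_space UNIV) Q' Z' \<tau>' \<and> non_explosive M' \<tau>' \<and> inj \<pi>' \<and>
         \<not> sufficient_for_future M' (count_space UNIV \<Otimes>\<^sub>M borel) (calendar_age Z' \<tau>')
             (count_space UNIV) (\<lambda>t \<omega>. \<pi>' (calendar Z' \<tau>' t \<omega>)) \<and>
         \<not> markov_process M' (count_space UNIV) (\<lambda>t \<omega>. \<pi>' (calendar Z' \<tau>' t \<omega>)) \<and>
         dynamically_relevant M' (count_space UNIV) (\<lambda>t \<omega>. \<pi>' (calendar Z' \<tau>' t \<omega>))
             borel (age \<tau>')))"
proof -
  interpret markov_renewal_process M S Q Z \<tau>
    using assms(1,2) by unfold_locales
  have flag_not_sufficient: "\<not> sufficient_for_future flag.\<Omega> (count_space UNIV \<Otimes>\<^sub>M borel)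
      (calendar_age flag.state flag.hold) (count_space UNIV) (\<lambda>t \<omega>. fst (calendar flag.state flag.hold t \<omega>))"
  proof
    assume *: "sufficient_for_future flag.\<Omega> (count_space UNIV \<Otimes>\<^sub>M borel)
      (calendar_age flag.state flag.hold) (count_space UNIV) (\<lambda>t \<omega>. fst (calendar flag.state flag.hold t \<omega>))"
    have "markov_process flag.\<Omega> (count_space UNIV) (\<lambda>t \<omega>. fst (calendar flag.state flag.hold t \<omega>))"
      by (rule flag.sufficient_projection_markov[OF _ *]) simp
    then show False using flag_projection_not_markov by contradiction
  qed
  have chain_id: "(\<lambda>t \<omega>. id (calendar chain.state chain.hold t \<omega>)) = calendar chain.state chain.hold"
    by simp
  show ?thesis
  proof (intro conjI impI)
    show "semi_markov_process M S Q (calendar Z \<tau>)" by (rule semi_markov_calendar)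
    show "homogeneous_markov_process M (S \<Otimes>\<^sub>M borel) (calendar_age Z \<tau>)"
      by (rule homogeneous_markov_calendar_age)
    show "sufficient_for_future M (S \<Otimes>\<^sub>M borel) (calendar_age Z \<tau>) S (calendar Z \<tau>)"
      if "age_independent S Q" using that by (rule sufficient_calendar)
    show "homogeneous_markov_process M S (calendar Z \<tau>)"
      if "age_independent S Q" using that by (rule homogeneous_markov_calendar)
    show "markov_process M R (\<lambda>t \<omega>. \<pi> (calendar Z \<tau> t \<omega>))"
      if "sufficient_for_future M (S \<Otimes>\<^sub>M borel) (calendar_age Z \<tau>) R (\<lambda>t \<omega>. \<pi> (calendar Z \<tau> t \<omega>))"
      using assms(3) that by (rule sufficient_projection_markov)
  next
    show "\<exists>(M' :: (nat \<Rightarrow> real) measure) (Q' :: nat \<Rightarrow> (nat \<times> real) measure) Z' \<tau>'.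
         markov_renewal M' (count_space UNIV) Q' Z' \<tau>' \<and> non_explosive M' \<tau>' \<and>
         \<not> markov_process M' (count_space UNIV) (calendar Z' \<tau>')"
      using chain.markov_renewal_iid chain.non_explosive_iid chain_not_markov by blast
  next
    show "\<exists>(M' :: (nat \<Rightarrow> real) measure) (Q' :: nat \<times> nat \<Rightarrow> ((nat \<times> nat) \<times> real) measure) Z' \<tau>'.
         markov_renewal M' (count_space UNIV) Q' Z' \<tau>' \<and> non_explosive M' \<tau>' \<and>
         age_independent (count_space UNIV) Q' \<and>
         markov_process M' (count_space UNIV) (calendar Z' \<tau>') \<and>
         \<not> sufficient_for_future M' (count_space UNIV \<Otimes>\<^sub>M borel) (calendar_age Z' \<tau>')
             (count_space UNIV) (\<lambda>t \<omega>. fst (calendar Z' \<tau>' t \<omega>)) \<and>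
         \<not> markov_process M' (count_space UNIV) (\<lambda>t \<omega>. fst (calendar Z' \<tau>' t \<omega>)) \<and>
         dynamically_relevant M' (count_space UNIV) (\<lambda>t \<omega>. fst (calendar Z' \<tau>' t \<omega>))
             (count_space UNIV) (\<lambda>t \<omega>. snd (calendar Z' \<tau>' t \<omega>))"
      using flag.markov_renewal_iid flag.non_explosive_iid flag_age_independent flag_calendar_markov
        flag_not_sufficient flag_projection_not_markov flag_dynamically_relevant by blast
  next
    show "\<exists>(M' :: (nat \<Rightarrow> real) measure) (Q' :: nat \<Rightarrow> (nat \<times> real) measure) Z' \<tau>'
          (\<pi>' :: nat \<Rightarrow> nat).
         markov_renewal M' (count_space UNIV) Q' Z' \<tau>' \<and> non_explosive M' \<tau>' \<and> inj \<pi>' \<and>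
         \<not> sufficient_for_future M' (count_space UNIV \<Otimes>\<^sub>M borel) (calendar_age Z' \<tau>')
             (count_space UNIV) (\<lambda>t \<omega>. \<pi>' (calendar Z' \<tau>' t \<omega>)) \<and>
         \<not> markov_process M' (count_space UNIV) (\<lambda>t \<omega>. \<pi>' (calendar Z' \<tau>' t \<omega>)) \<and>
         dynamically_relevant M' (count_space UNIV) (\<lambda>t \<omega>. \<pi>' (calendar Z' \<tau>' t \<omega>))
             borel (age \<tau>')"
      \<comment> \<open>With the identity as projection nothing of the state is lost, so the failure
        is due to the age.\<close>
      by (rule exI[of _ chain.\<Omega>], rule exI[of _ chain.kern], rule exI[of _ chain.state],
          rule exI[of _ chain.hold], rule exI[of _ id])
         (simp only: chain_id chain.markov_renewal_iid chain.non_explosive_iid inj_on_id chain_not_sufficient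
           chain_not_markov chain_dynamically_relevant simp_thms)
  qed
qed

end
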